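(* Assume that the directed graphs $(\mathcal X,\mathcal E_{\mathcal X})$ and $(\mathcal Y,\mathcal E_{\mathcal Y})$ are irreducible; that for each $y\in\mathcal Y$ and $(x,x')\in\mathcal E_{\mathcal X}$ the function $\lambda_{x,x'}(\cdot,y):M_1(\mathcal X)\to\mathbb R_+$ is Lipschitz continuous with $\inf_{\xi}\lambda_{x,x'}(\xi,y)>0$; and that for each $(y,y')\in\mathcal E_{\mathcal Y}$ the function $\gamma_{y,y'}:M_1(\mathcal X)\to\mathbb R_+$ is continuous with $\inf_{\xi}\gamma_{y,y'}(\xi)>0$. Fix $T>0$. Suppose $(\mu,\theta)\in D([0,T],M_1(\mathcal X))\times D_{\uparrow}([0,T],M(\mathcal Y))$ satisfies $I^*(\mu,\theta)<\infty$, and write $\theta(dy\,dt)=m_t(dy)\,dt$ with $m_t\in M_1(\mathcal Y)$ for almost all $t\in[0,T]$. (1) We have $$\begin{aligned}I^*(\mu,\theta)=\int_0^T\Big\{&\sup_{\alpha\in\mathbb R^{|\mathcal X|}}\Big(\langle\alpha,\dot\mu_t-\bar\Lambda^*_{\mu_t,m_t}\mu_t\rangle-\sum_{(x,x')\in\mathcal E_{\mathcal X}}\tau(\alpha(x')-\alpha(x))\,\bar\lambda_{x,x'}(\mu_t,m_t)\,\mu_t(x)\Big)\\&+\sup_{g:\mathcal Y\to\mathbb R}\sum_{y\in\mathcal Y}\Big(-L_{\mu_t}g(y)-\sum_{y':(y,y')\in\mathcal E_{\mathcal Y}}\tau(g(y')-g(y))\,\gamma_{y,y'}(\mu_t)\Big)m_t(y)\Big\}\,dt.\end{aligned}$$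 (2) There exist $h_{\mathcal X}\in\mathcal H_{\mathcal X}(\mu,\theta)$ and $h_{\mathcal Y}\in\mathcal H_{\mathcal Y}(\mu,\theta)$, with $h_{\mathcal X}\in L^{\tau^*}([0,T]\times\mathcal E_{\mathcal X},\rho_{\mathcal X})$ and $h_{\mathcal Y}\in L^{\tau^*}([0,T]\times\mathcal E_{\mathcal Y},\rho_{\mathcal Y})$, such that $$\int_0^T\sum_{(x,x')\in\mathcal E_{\mathcal X}}h_{\mathcal X}(t,(x,x'))\,(\alpha_t(x')-\alpha_t(x))\,\bar\lambda_{x,x'}(\mu_t,m_t)\mu_t(x)\,dt=\int_0^T\langle\alpha_t,\dot\mu_t-\bar\Lambda^*_{\mu_t,m_t}\mu_t\rangle\,dt$$ for all bounded measurable $\alpha:[0,T]\times\mathcal X\to\mathbb R$, and $$\int_0^T\sum_{(y,y')\in\mathcal E_{\mathcal Y}}h_{\mathcal Y}(t,(y,y'))\,(g_t(y')-g_t(y))\,\gamma_{y,y'}(\mu_t)m_t(y)\,dt=-\int_0^T\sum_{(y,y')\in\mathcal E_{\mathcal Y}}(g_t(y')-g_t(y))\,\gamma_{y,y'}(\mu_t)m_t(y)\,dt$$ for all bounded measurable $g:[0,T]\times\mathcal Y\to\mathbb R$, and $$I^*(\mu,\theta)=\int_0^T\sum_{(x,x')\in\mathcal E_{\mathcal X}}\tau^*(h_{\mathcal X}(t,(x,x')))\bar\lambda_{x,x'}(\mu_t,m_t)\mu_t(x)\,dt+\int_0^T\sum_{(y,y')\in\mathcal E_{\mathcal Y}}\tau^*(h_{\mathcal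 Y}(t,(y,y')))\gamma_{y,y'}(\mu_t)m_t(y)\,dt.$$ (3) If moreover $\inf_{t\in[0,T]}\min_{x\in\mathcal X}\mu_t(x)>0$ and $\inf_{t\in[0,T]}\min_{y\in\mathcal Y}m_t(y)>0$, then the suprema over $\alpha$ and $g$ in (1) are attained by $\hat\alpha_t\in\mathbb R^{|\mathcal X|}$ and $\hat g_t:\mathcal Y\to\mathbb R$ that satisfy, for almost all $t\in[0,T]$, $$\dot\mu_t(x)-(\bar\Lambda^*_{\mu_t,m_t}\mu_t)(x)+\mu_t(x)\sum_{x':(x,x')\in\mathcal E_{\mathcal X}}(e^{\hat\alpha_t(x')-\hat\alpha_t(x)}-1)\bar\lambda_{x,x'}(\mu_t,m_t)-\sum_{x_0:(x_0,x)\in\mathcal E_{\mathcal X}}\mu_t(x_0)(e^{\hat\alpha_t(x)-\hat\alpha_t(x_0)}-1)\bar\lambda_{x_0,x}(\mu_t,m_t)=0\quad\forall x\in\mathcal X,$$ $$m_t(y)\sum_{y':(y,y')\in\mathcal E_{\mathcal Y}}e^{\hat g_t(y')-\hat g_t(y)}\gamma_{y,y'}(\mu_t)-\sum_{y_0:(y_0,y)\in\mathcal E_{\mathcal Y}}m_t(y_0)e^{\hat g_t(y)-\hat g_t(y_0)}\gamma_{y_0,y}(\mu_t)=0\quad\forall y\in\mathcal Y.$$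
   Context: $\mathcal X,\mathcal Y$ are finite sets with directed graphs $(\mathcal X,\mathcal E_{\mathcal X})$, $(\mathcal Y,\mathcal E_{\mathcal Y})$ (edges join distinct vertices); a directed graph is irreducible if there is a directed path from every vertex to every other vertex. $M_1(S)$ and $M(S)$ denote the probability measures and the finite measures on $S$ with the weak topology; for finite $S$ a measure is identified with its vector of point masses. For $\xi\in M_1(\mathcal X)$ let $L_\xi g(y)=\sum_{y':(y,y')\in\mathcal E_{\mathcal Y}}(g(y')-g(y))\gamma_{y,y'}(\xi)$. $D([0,T],S)$ is the space of càdlàg functions $[0,T]\to S$. $D_{\uparrow}([0,T],M(\mathcal Y))\subset D([0,T],M(\mathcal Y))$ is the set of $\theta$ such that $\theta_t-\theta_s\in M(\mathcal Y)$ for $0\le s\le t\le T$ and $\theta_t(\mathcal Y)=t$ for all $t$; each such $\theta$, viewed as a measure on $[0,T]\times\mathcal Y$ via $\theta([0,t]\times A)=\theta_t(A)$, can be written $\theta(dy\,dt)=m_t(dy)\,dt$ with $m_t\in M_1(\mathcal Y)$ for a.e. $t$. $\tau(u)=e^u-u-1$; its convex dual is $\tau^*(u)=+\infty$ for $u<-1$, $\tau^*(-1)=1$, $\tau^*(u)=(u+1)\log(u+1)-u$ for $u>-1$. For $\xi\in M_1(\mathcal X)$, $m\in M_1(\mathcal Y)$: $\bar\lambda_{x,x'}(\xi,m)=\sum_y\lambda_{x,x'}(\xi,y)m(y)$ and $(\bar\Lambda^*_{\xi,m}\xi)(x)=\sum_{x_0:(x_0,x)\in\mathcal E_{\mathcal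 X}}\xi(x_0)\bar\lambda_{x_0,x}(\xi,m)-\xi(x)\sum_{x':(x,x')\in\mathcal E_{\mathcal X}}\bar\lambda_{x,x'}(\xi,m)$. Admissible pairs $(\alpha,g)$: $\alpha$ consists of $n\in\mathbb N$, time points $0=t_0<t_1<\dots<t_n<T$ (put $t_{n+1}=T$) and continuous maps $\alpha_{t_i}:M_1(\mathcal X)\to\mathbb R^{|\mathcal X|}$, $0\le i\le n$; $g:[0,T]\times M_1(\mathcal X)\times\mathcal Y\to\mathbb R$, $(t,u,y)\mapsto g_t(u,y)$, is continuously differentiable in $t$ and $u$. With $a_s=\alpha_{t_{i-1}}(\mu_{t_{i-1}})$ for $s\in[t_{i-1},t_i)$, $1\le i\le n+1$, $$\begin{aligned}U_T^{\alpha,g}(\mu,\theta)=&\sum_{i=1}^{n+1}\langle\alpha_{t_{i-1}}(\mu_{t_{i-1}}),\mu_{t_i}-\mu_{t_{i-1}}\rangle-\int_0^T\langle a_s,\bar\Lambda^*_{\mu_s,m_s}\mu_s\rangle ds\\&-\int_0^T\sum_{(x,x')\in\mathcal E_{\mathcal X}}\tau(a_s(x')-a_s(x))\bar\lambda_{x,x'}(\mu_s,m_s)\mu_s(x)\,ds\\&-\int_0^T\sum_{y\in\mathcal Y}\Big(L_{\mu_s}g_s(\mu_s,\cdot)(y)+\sum_{y':(y,y')\in\mathcal E_{\mathcal Y}}\tau(g_s(\mu_s,y')-g_s(\mu_s,y))\gamma_{y,y'}(\mu_s)\Big)m_s(y)\,ds,\end{aligned}$$ and $I^*(\mu,\theta)=\sup_{\alpha,g}U_T^{\alpha,g}(\mu,\theta)$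 over all admissible pairs. (If $I^*(\mu,\theta)<\infty$ then $t\mapsto\mu_t$ is absolutely continuous, so $\dot\mu_t$ exists for a.e. $t$.) Let $\rho_{\mathcal X}$ be the finite measure on $[0,T]\times\mathcal E_{\mathcal X}$ with $\rho_{\mathcal X}(dt,\{(x,x')\})=\bar\lambda_{x,x'}(\mu_t,m_t)\mu_t(x)\,dt$, and $\rho_{\mathcal Y}$ the finite measure on $[0,T]\times\mathcal E_{\mathcal Y}$ with $\rho_{\mathcal Y}(dt,\{(y,y')\})=\gamma_{y,y'}(\mu_t)m_t(y)\,dt$. $L^{\tau^*}(S,\vartheta)$ denotes the Orlicz space over $(S,\vartheta)$ for the Young function $u\mapsto\tau^*(|u|)$, with its Orlicz norm. $\mathcal H_{\mathcal X}(\mu,\theta)$ is the closure in $L^{\tau^*}([0,T]\times\mathcal E_{\mathcal X},\rho_{\mathcal X})$ of the set of functions $(t,(x,x'))\mapsto\exp\{\alpha_t(x')-\alpha_t(x)\}-1$ with $\alpha:[0,T]\times\mathcal X\to\mathbb R$ continuously differentiable in $t$; $\mathcal H_{\mathcal Y}(\mu,\theta)$ is the closure in $L^{\tau^*}([0,T]\times\mathcal E_{\mathcal Y},\rho_{\mathcal Y})$ of the set of functions $(t,(y,y'))\mapsto\exp\{g_t(y')-g_t(y)\}-1$ with $g:[0,T]\times\mathcal Y\to\mathbb R$ continuously differentiable in $t$. *)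

theory Defs
  imports "HOL-Analysis.Analysis"
begin

text \<open>
  Finite vertex sets are finite types. Measures on, and real functions of, a finite set
  are vectors \<^typ>\<open>real^'a\<close>; the weak topology is the Euclidean one. Paths are total functions
  of time of which only the restriction to \<open>[0,T]\<close> matters; the measure on \<open>[0,T]\<close>
  is \<open>lebesgue_on {0..T}\<close>.
\<close>

definition prob_vecs :: "(real^'a::finite) set" where
  "prob_vecs = {\<xi>. (\<forall>x. 0 \<le> \<xi> $ x) \<and> (\<Sum>x\<in>UNIV. \<xi> $ x) = 1}"

definition fin_measures :: "(real^'a::finite) set" where
  "fin_measures = {\<nu>. \<forall>x. 0 \<le> \<nu> $ x}"

definition irreducible_digraph :: "('a \<times> 'a) set \<Rightarrow> bool" where
  "irreducible_digraph E \<longleftrightarrow> (\<forall>x x'. x \<noteq> x' \<longrightarrow> (x, x') \<in> E\<^sup>+)"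

definition cadlag :: "real \<Rightarrow> 'a::topological_space set \<Rightarrow> (real \<Rightarrow> 'a) set" where
  "cadlag T S = {f. (\<forall>t\<in>{0..T}. f t \<in> S) \<and>
     (\<forall>t\<in>{0..<T}. (f \<longlongrightarrow> f t) (at_right t)) \<and>
     (\<forall>t\<in>{0<..T}. \<exists>l\<in>S. (f \<longlongrightarrow> l) (at_left t))}"

definition cadlag_up :: "real \<Rightarrow> (real \<Rightarrow> real^'y::finite) set" where
  "cadlag_up T = {\<theta> \<in> cadlag T fin_measures.
     (\<forall>s t. 0 \<le> s \<longrightarrow> s \<le> t \<longrightarrow> t \<le> T \<longrightarrow> \<theta> t - \<theta> s \<in> fin_measures) \<and>
     (\<forall>t\<in>{0..T}. (\<Sum>y\<in>UNIV. \<theta> t $ y) = t)}"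

text \<open>\<open>\<theta>(dy dt) = m\<^sub>t(dy) dt\<close>, tested on the sets \<open>[0,t] \<times> A\<close>, whose measure is \<open>\<theta>\<^sub>t(A)\<close>.\<close>

definition time_density :: "real \<Rightarrow> (real \<Rightarrow> real^'y::finite) \<Rightarrow> (real \<Rightarrow> real^'y) \<Rightarrow> bool" where
  "time_density T \<theta> m \<longleftrightarrow>
     m \<in> borel_measurable (lebesgue_on {0..T}) \<and>
     (AE t in lebesgue_on {0..T}. m t \<in> prob_vecs) \<and>
     (\<forall>t\<in>{0..T}. \<forall>A. (\<Sum>y\<in>A. \<theta> t $ y) = (LINT s|lebesgue_on {0..t}. (\<Sum>y\<in>A. m s $ y)))"

definition tau :: "real \<Rightarrow> real" where
  "tau u = exp u - u - 1"

definition tau_star :: "real \<Rightarrow> ereal" where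
  "tau_star u = (if u < -1 then \<infinity> else if u = -1 then 1 else ereal ((u + 1) * ln (u + 1) - u))"

definition convex_dual :: "(real \<Rightarrow> ereal) \<Rightarrow> real \<Rightarrow> ereal" where
  "convex_dual f u = (SUP v. ereal (u * v) - f v)"

lemma tau_star_eq_convex_dual: "tau_star = convex_dual (\<lambda>v. ereal (tau v))"
proof
  fix u :: real
  have d: "convex_dual (\<lambda>v. ereal (tau v)) u = (SUP v. ereal ((u + 1) * v - exp v + 1))"
    by (simp add: convex_dual_def tau_def algebra_simps)
  consider "u < -1" | "u = -1" | "u > -1" by linarith
  then show "tau_star u = convex_dual (\<lambda>v. ereal (tau v)) u"
  proof cases
    case 1
    have "\<exists>v. B < (u + 1) * v - exp v + 1" for B
    proof -
      define v where "v = - (\<bar>B\<bar> + 1) / (- (u + 1))"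
      have "(u + 1) * v = \<bar>B\<bar> + 1" using 1 by (simp add: v_def field_simps)
      moreover have "v \<le> 0" using 1 by (auto simp: v_def intro!: divide_nonpos_pos)
      then have "exp v \<le> 1" by simp
      ultimately have "B < (u + 1) * v - exp v + 1" by linarith
      then show ?thesis by blast
    qed
    then have "(SUP v. ereal ((u + 1) * v - exp v + 1)) = \<infinity>"
      by (intro SUP_PInfty) (metis UNIV_I ereal_less_eq(3) less_imp_le)
    then show ?thesis using 1 d by (simp add: tau_star_def)
  next
    case 2
    have "((\<lambda>v :: real. ereal (1 - exp v)) \<longlongrightarrow> ereal (1 - 0)) at_bot"
      by (intro tendsto_intros tendsto_diff exp_at_bot)
    then have "1 \<le> (SUP v. ereal (1 - exp v))"
      by (intro tendsto_upperbound[where F = at_bot and f = "\<lambda>v :: real. ereal (1 - exp v)"])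
        (auto simp: one_ereal_def intro!: always_eventually SUP_upper)
    moreover have "(SUP v :: real. ereal (1 - exp v)) \<le> 1"
      by (intro SUP_least) (simp add: one_ereal_def)
    ultimately show ?thesis using 2 d by (simp add: tau_star_def)
  next
    case 3
    define w where "w = ln (u + 1)"
    have w: "exp w = u + 1" using 3 by (simp add: w_def)
    have "(SUP v. ereal ((u + 1) * v - exp v + 1)) = ereal ((u + 1) * w - u)"
    proof (rule antisym)
      show "(SUP v. ereal ((u + 1) * v - exp v + 1)) \<le> ereal ((u + 1) * w - u)"
      proof (intro SUP_least, simp only: ereal_less_eq)
        fix v
        have "(u + 1) * (1 + (v - w)) \<le> exp w * exp (v - w)"
          unfolding w using 3 by (intro mult_left_mono exp_ge_add_one_self) auto
        also have "\<dots> = exp v" by (simp add: exp_diff)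
        finally show "(u + 1) * v - exp v + 1 \<le> (u + 1) * w - u" by (simp add: algebra_simps)
      qed
      show "ereal ((u + 1) * w - u) \<le> (SUP v. ereal ((u + 1) * v - exp v + 1))"
        by (rule SUP_upper2[of w]) (auto simp: w)
    qed
    then show ?thesis using 3 d by (simp add: tau_star_def w_def)
  qed
qed

definition generator ::
    "('y \<times> 'y) set \<Rightarrow> ('y \<Rightarrow> 'y \<Rightarrow> real^'x::finite \<Rightarrow> real) \<Rightarrow> real^'x \<Rightarrow> real^'y::finite \<Rightarrow> 'y \<Rightarrow> real" where
  "generator E\<^sub>Y gam \<xi> g y = (\<Sum>y' | (y, y') \<in> E\<^sub>Y. (g $ y' - g $ y) * gam y y' \<xi>)"

definition lam_bar ::
    "('x \<Rightarrow> 'x \<Rightarrow> real^'x::finite \<Rightarrow> 'y::finite \<Rightarrow> real) \<Rightarrow> 'x \<Rightarrow> 'x \<Rightarrow> real^'x \<Rightarrow> real^'y \<Rightarrow> real" where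
  "lam_bar lam x x' \<xi> m = (\<Sum>y\<in>UNIV. lam x x' \<xi> y * m $ y)"

text \<open>The vector \<open>\<Lambda>\<^sup>*\<xi>\<close> for the averaged operator with parameters \<open>(\<xi>,m)\<close>.\<close>

definition Lambda_star ::
    "('x \<times> 'x) set \<Rightarrow> ('x \<Rightarrow> 'x \<Rightarrow> real^'x::finite \<Rightarrow> 'y::finite \<Rightarrow> real) \<Rightarrow> real^'x \<Rightarrow> real^'y \<Rightarrow> real^'x" where
  "Lambda_star E\<^sub>X lam \<xi> m = (\<chi> x.
     (\<Sum>x0 | (x0, x) \<in> E\<^sub>X. \<xi> $ x0 * lam_bar lam x0 x \<xi> m) -
     \<xi> $ x * (\<Sum>x' | (x, x') \<in> E\<^sub>X. lam_bar lam x x' \<xi> m))"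

text \<open>Continuous differentiability on a set that need not be open (an interval, or an interval
  times a simplex): derivatives are taken within the set.\<close>

definition C1_on :: "'a::real_normed_vector set \<Rightarrow> ('a \<Rightarrow> 'b::real_normed_vector) \<Rightarrow> bool" where
  "C1_on S f \<longleftrightarrow> (\<exists>f' :: 'a \<Rightarrow> 'a \<Rightarrow>\<^sub>L 'b. continuous_on S f' \<and>
     (\<forall>x\<in>S. (f has_derivative blinfun_apply (f' x)) (at x within S)))"

text \<open>The data \<open>\<alpha>\<close> of an admissible pair are \<open>n\<close>, the time points \<open>tt 0, \<dots>, tt (n + 1)\<close>
  with \<open>tt (n + 1) = T\<close>, and the maps \<open>A i\<close>, standing for \<open>\<alpha>\<close> at time \<open>tt i\<close>, \<open>0 \<le> i \<le> n\<close>.\<close>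

definition admissible ::
    "real \<Rightarrow> nat \<Rightarrow> (nat \<Rightarrow> real) \<Rightarrow> (nat \<Rightarrow> real^'x::finite \<Rightarrow> real^'x) \<Rightarrow>
     (real \<Rightarrow> real^'x \<Rightarrow> real^'y::finite) \<Rightarrow> bool" where
  "admissible T n tt A g \<longleftrightarrow>
     tt 0 = 0 \<and> tt (n + 1) = T \<and> (\<forall>i\<le>n. tt i < tt (i + 1)) \<and>
     (\<forall>i\<le>n. continuous_on prob_vecs (A i)) \<and>
     C1_on ({0..T} \<times> prob_vecs) (\<lambda>(t, u). g t u)"

definition step_path ::
    "(real \<Rightarrow> real^'x::finite) \<Rightarrow> nat \<Rightarrow> (nat \<Rightarrow> real) \<Rightarrow> (nat \<Rightarrow> real^'x \<Rightarrow> real^'x) \<Rightarrow> real \<Rightarrow> real^'x" where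
  "step_path \<mu> n tt A s =
     (\<Sum>i=1..n+1. indicator {tt (i - 1)..<tt i} s *\<^sub>R A (i - 1) (\<mu> (tt (i - 1))))"

definition U_functional ::
    "real \<Rightarrow> ('x \<times> 'x) set \<Rightarrow> ('y \<times> 'y) set \<Rightarrow>
     ('x \<Rightarrow> 'x \<Rightarrow> real^'x::finite \<Rightarrow> 'y::finite \<Rightarrow> real) \<Rightarrow> ('y \<Rightarrow> 'y \<Rightarrow> real^'x \<Rightarrow> real) \<Rightarrow>
     (real \<Rightarrow> real^'x) \<Rightarrow> (real \<Rightarrow> real^'y) \<Rightarrow>
     nat \<Rightarrow> (nat \<Rightarrow> real) \<Rightarrow> (nat \<Rightarrow> real^'x \<Rightarrow> real^'x) \<Rightarrow> (real \<Rightarrow> real^'x \<Rightarrow> real^'y) \<Rightarrow> real" where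
  "U_functional T E\<^sub>X E\<^sub>Y lam gam \<mu> m n tt A g =
     (let a = step_path \<mu> n tt A in
      (\<Sum>i=1..n+1. A (i - 1) (\<mu> (tt (i - 1))) \<bullet> (\<mu> (tt i) - \<mu> (tt (i - 1))))
      - (LINT s|lebesgue_on {0..T}. a s \<bullet> Lambda_star E\<^sub>X lam (\<mu> s) (m s))
      - (LINT s|lebesgue_on {0..T}.
           (\<Sum>(x, x')\<in>E\<^sub>X. tau (a s $ x' - a s $ x) * lam_bar lam x x' (\<mu> s) (m s) * \<mu> s $ x))
      - (LINT s|lebesgue_on {0..T}.
           (\<Sum>y\<in>UNIV. (generator E\<^sub>Y gam (\<mu> s) (g s (\<mu> s)) y +
              (\<Sum>y' | (y, y') \<in> E\<^sub>Y.
                 tau (g s (\<mu> s) $ y' - g s (\<mu> s) $ y) * gam y y' (\<mu> s))) * m s $ y)))"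

text \<open>The density of \<open>\<theta>\<close> is unique up to null sets, which do not affect the integrals.\<close>

definition I_star ::
    "real \<Rightarrow> ('x \<times> 'x) set \<Rightarrow> ('y \<times> 'y) set \<Rightarrow>
     ('x \<Rightarrow> 'x \<Rightarrow> real^'x::finite \<Rightarrow> 'y::finite \<Rightarrow> real) \<Rightarrow> ('y \<Rightarrow> 'y \<Rightarrow> real^'x \<Rightarrow> real) \<Rightarrow>
     (real \<Rightarrow> real^'x) \<Rightarrow> (real \<Rightarrow> real^'y) \<Rightarrow> ereal" where
  "I_star T E\<^sub>X E\<^sub>Y lam gam \<mu> \<theta> =
     (SUP (n, tt, A, g) \<in> {(n, tt, A, g). admissible T n tt A g}.
        ereal (U_functional T E\<^sub>X E\<^sub>Y lam gam \<mu> (SOME m. time_density T \<theta> m) n tt A g))"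

text \<open>The expressions maximised over \<open>\<alpha>\<close> and \<open>g\<close> at a fixed time, with
  \<open>v\<close> standing for the time derivative of \<open>\<mu>\<close>. Both vanish at \<open>0\<close>, so their suprema are nonnegative
  and may be read as extended nonnegative reals.\<close>

definition objective_X ::
    "('x \<times> 'x) set \<Rightarrow> ('x \<Rightarrow> 'x \<Rightarrow> real^'x::finite \<Rightarrow> 'y::finite \<Rightarrow> real) \<Rightarrow>
     real^'x \<Rightarrow> real^'y \<Rightarrow> real^'x \<Rightarrow> real^'x \<Rightarrow> real" where
  "objective_X E\<^sub>X lam \<xi> m v \<alpha> =
     \<alpha> \<bullet> (v - Lambda_star E\<^sub>X lam \<xi> m) -
     (\<Sum>(x, x')\<in>E\<^sub>X. tau (\<alpha> $ x' - \<alpha> $ x) * lam_bar lam x x' \<xi> m * \<xi> $ x)"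

definition objective_Y ::
    "('y \<times> 'y) set \<Rightarrow> ('y \<Rightarrow> 'y \<Rightarrow> real^'x::finite \<Rightarrow> real) \<Rightarrow>
     real^'x \<Rightarrow> real^'y::finite \<Rightarrow> real^'y \<Rightarrow> real" where
  "objective_Y E\<^sub>Y gam \<xi> m g =
     (\<Sum>y\<in>UNIV. (- generator E\<^sub>Y gam \<xi> g y -
        (\<Sum>y' | (y, y') \<in> E\<^sub>Y. tau (g $ y' - g $ y) * gam y y' \<xi>)) * m $ y)"

definition rho_X ::
    "real \<Rightarrow> ('x \<times> 'x) set \<Rightarrow> ('x \<Rightarrow> 'x \<Rightarrow> real^'x::finite \<Rightarrow> 'y::finite \<Rightarrow> real) \<Rightarrow>
     (real \<Rightarrow> real^'x) \<Rightarrow> (real \<Rightarrow> real^'y) \<Rightarrow> (real \<times> 'x \<times> 'x) measure" where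
  "rho_X T E\<^sub>X lam \<mu> m =
     density (lebesgue_on {0..T} \<Otimes>\<^sub>M count_space E\<^sub>X)
       (\<lambda>(t, x, x'). ennreal (lam_bar lam x x' (\<mu> t) (m t) * \<mu> t $ x))"

definition rho_Y ::
    "real \<Rightarrow> ('y \<times> 'y) set \<Rightarrow> ('y \<Rightarrow> 'y \<Rightarrow> real^'x::finite \<Rightarrow> real) \<Rightarrow>
     (real \<Rightarrow> real^'x) \<Rightarrow> (real \<Rightarrow> real^'y::finite) \<Rightarrow> (real \<times> 'y \<times> 'y) measure" where
  "rho_Y T E\<^sub>Y gam \<mu> m =
     density (lebesgue_on {0..T} \<Otimes>\<^sub>M count_space E\<^sub>Y)
       (\<lambda>(t, y, y'). ennreal (gam y y' (\<mu> t) * m t $ y))"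

text \<open>Orlicz spaces consist of functions rather than of classes modulo null sets; the Orlicz norm
  is the dual one, a supremum over the unit ball of the complementary modular.\<close>

definition orlicz_space :: "'s measure \<Rightarrow> (real \<Rightarrow> ereal) \<Rightarrow> ('s \<Rightarrow> real) set" where
  "orlicz_space M \<Phi> = {f \<in> borel_measurable M.
     \<exists>c>0. (\<integral>\<^sup>+ s. e2ennreal (\<Phi> (c * f s)) \<partial>M) < \<infinity>}"

definition orlicz_norm :: "'s measure \<Rightarrow> (real \<Rightarrow> ereal) \<Rightarrow> ('s \<Rightarrow> real) \<Rightarrow> ennreal" where
  "orlicz_norm M \<Phi> f =
     (SUP k \<in> {k \<in> borel_measurable M. (\<integral>\<^sup>+ s. e2ennreal (convex_dual \<Phi> (k s)) \<partial>M) \<le> 1}.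
        \<integral>\<^sup>+ s. ennreal \<bar>f s * k s\<bar> \<partial>M)"

abbreviation young_tau :: "real \<Rightarrow> ereal" where
  "young_tau \<equiv> \<lambda>u. tau_star \<bar>u\<bar>"

text \<open>The closure defining both \<open>H\<^sub>X\<close> (with \<open>M = rho_X \<dots>\<close>) and \<open>H\<^sub>Y\<close> (with \<open>M = rho_Y \<dots>\<close>).\<close>

definition H_closure :: "real \<Rightarrow> (real \<times> 'a \<times> 'a) measure \<Rightarrow> (real \<times> 'a::finite \<times> 'a \<Rightarrow> real) set" where
  "H_closure T M = {h \<in> orlicz_space M young_tau.
     \<forall>\<epsilon>>0. \<exists>\<alpha> :: real \<Rightarrow> real^'a. C1_on {0..T} \<alpha> \<and>
       orlicz_norm M young_tau
         (\<lambda>(t, x, x'). h (t, x, x') - (exp (\<alpha> t $ x' - \<alpha> t $ x) - 1)) < ennreal \<epsilon>}"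

text \<open>Bounded measurable functions on \<open>[0,T] \<times> S\<close>, for finite \<open>S\<close>.\<close>

definition bounded_measurable :: "real \<Rightarrow> (real \<Rightarrow> real^'a::finite) \<Rightarrow> bool" where
  "bounded_measurable T f \<longleftrightarrow> f \<in> borel_measurable (lebesgue_on {0..T}) \<and> bounded (f ` {0..T})"

end

theory Submission
  imports Defs
begin

text \<open>
  Since \<open>\<alpha> \<bullet> Lambda_star \<xi> m\<close> is the sum of \<open>\<alpha>(x') - \<alpha>(x)\<close> against the jump rates, both expressions maximised
  at a fixed time have the form \<open>\<alpha> \<bullet> v - (\<Sum>e\<in>E. r e * (exp (\<nabla>\<alpha> e) - 1))\<close>, with \<open>v = 0\<close> for the
  second one. This form satisfies an exact midpoint identity with defect
  \<open>\<Sum>e. r e * (exp (\<nabla>\<alpha> e / 2) - exp (\<nabla>\<beta> e / 2))\<^sup>2 / 2\<close>, so along a maximising sequence \<open>exp (\<nabla>\<alpha>\<^sub>n e)\<close>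
  converges wherever \<open>r e > 0\<close>, whether or not the supremum is attained. The limit is \<open>1 + h\<close>; perturbing the
  sequence gives the Euler--Lagrange identity, and passing to the limit in the values gives \<open>\<Sum>e. r e * \<tau>\<^sup>*(h e)\<close>.
  If all rates are positive, irreducibility bounds \<open>\<nabla>\<alpha>\<^sub>n\<close> on every edge from both sides, since each edge
  lies on a cycle, and the supremum is attained.

  The same identity, integrated over time and applied to step functions \<open>\<alpha>\<close> on uniform grids, shows that the fluxes of
  a maximising sequence for the whole functional are Cauchy in \<open>L\<^sup>1\<close>. Their limit is a flux whose
  divergence is the density of \<open>\<mu>\<close>, so \<open>\<mu>\<close> is an indefinite integral and Lebesgue's differentiation theorem
  applies. Choosing at each time the best of the first \<open>N\<close> vectors of a countable dense set produces measurable
  controls that exhaust the pointwise suprema; they are approximated boundedly by step functions and by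
  polynomials in time.
\<close>

section \<open>Lebesgue differentiation on the line\<close>

text \<open>The obstacle is degeneracy. Rates may vanish with \<mu> or m, and an optimal flow may
  vanish on an edge of positive rate; the potentials of a maximising sequence may then diverge, and
  there is no maximiser at which to differentiate. Square roots of tilted rates are the right
  coordinates: the midpoint defect is a squared Hellinger distance, insensitive to additive
  constants in the potential and to gradients that run to minus infinity. The same obstacle recurs
  over time, where \<mu> is only known to be cadlag and the functional sees it through finitely many
  increments. Uniform grids are used there because two step functions always live on a common
  refinement, so their midpoint is again a competitor.

  Membership in the Orlicz closure needs small norm, which convergence of a single modular does not
  give in general. Here the Young function grows like \<open>u * ln u\<close> and satisfies
  \<open>psi (c * u) \<le> c\<^sup>2 * psi u\<close> for \<open>1 \<le> c\<close>. Hence the modular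
  of every multiple of h is controlled by the integrable pointwise supremum, and a modular at most 1
  at scale c makes the norm at most \<open>2 / c\<close>.\<close>

lemma Lebesgue_differentiation_real:
  fixes f :: "real \<Rightarrow> 'b::euclidean_space"
  assumes f: "f integrable_on {a..b}"
  shows "negligible {t \<in> {a<..<b}. \<not> ((\<lambda>x. integral {a..x} f) has_vector_derivative f t) (at t)}"
proof -
  \<comment> \<open>An interval around t is bad if the mean of f over it misses \<open>f t\<close>
    by at least \<open>1 / Suc n\<close>; differentiability can only fail where bad intervals of
    some level n become arbitrarily short. By the Henstock lemma the bad intervals of a fine
    disjoint family have small total length, and Vitali covering turns this into smallness of
    \<open>E n\<close>.\<close>
  define bad where "bad n t u v \<longleftrightarrow> a \<le> u \<and> u \<le> t \<and> t \<le> v \<and> v \<le> b \<and> u < v \<and>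
      (v - u) / Suc n \<le> norm ((v - u) *\<^sub>R f t - integral {u..v} f)" for n :: nat and t u v
  define E where "E n = {t \<in> {a<..<b}. \<forall>d>0. \<exists>u v. v - u < d \<and> bad n t u v}" for n
  have "negligible (E n)" for n
    unfolding negligible_outer_le
  proof (intro allI impI)
    fix e :: real assume "0 < e"
    \<comment> \<open>Each bad interval carries an error of at least its length divided by
      \<open>Suc n\<close>, so an error budget of \<open>e / Suc n\<close> leaves total length below
      e.\<close>
    then have "0 < e / Suc n" by simp
    from Henstock_lemma[OF f[unfolded cbox_interval[symmetric]] this] obtain \<gamma> where \<gamma>: "gauge \<gamma>"
      and H: "\<And>p. \<lbrakk>p tagged_partial_division_of (cbox a b); \<gamma> fine p\<rbrakk> \<Longrightarrow>
             (\<Sum>(x,k)\<in>p. norm (measure lborel k *\<^sub>R f x - integral k f)) < e / Suc n" by blast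
    define K where "K = {(t, u, v). bad n t u v \<and> {u..v} \<subseteq> \<gamma> t}"
    have cb: "cball ((u + v) / 2) ((v - u) / 2) = {u..v}" if "u < v" for u v :: real
      using that by (auto simp: cball_eq_atLeastAtMost field_simps)
    obtain C where C: "countable C" "C \<subseteq> K"
      "pairwise (\<lambda>i j. disjnt (cball ((\<lambda>(t,u,v). (u + v) / 2) i) ((\<lambda>(t,u,v). (v - u) / 2) i))
           (cball ((\<lambda>(t,u,v). (u + v) / 2) j) ((\<lambda>(t,u,v). (v - u) / 2) j))) C"
      "negligible (E n - (\<Union>i\<in>C. cball ((\<lambda>(t,u,v). (u + v) / 2) i) ((\<lambda>(t,u,v). (v - u) / 2) i)))"
    proof (rule Vitali_covering_theorem_cballs)
      show "0 < (\<lambda>(t,u,v). (v - u) / 2) i" if "i \<in> K" for i :: "real \<times> real \<times> real"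
        using that by (auto simp: K_def bad_def)
    next
      fix t d :: real assume t: "t \<in> E n" and d: "0 < d"
      from \<gamma> have "open (\<gamma> t)" "t \<in> \<gamma> t" by (auto simp: gauge_def)
      then obtain r where r: "0 < r" "ball t r \<subseteq> \<gamma> t" by (meson open_contains_ball)
      from t have "\<exists>u v. v - u < min d r \<and> bad n t u v"
        using d r unfolding E_def mem_Collect_eq by (meson min_less_iff_conj)
      then obtain u v where uv: "v - u < min d r" "bad n t u v" by blast
      have "{u..v} \<subseteq> ball t r" using uv by (auto simp: bad_def dist_real_def)
      with r uv have "(t, u, v) \<in> K" by (auto simp: K_def)
      then show "\<exists>i. i \<in> K \<and> t \<in> cball ((\<lambda>(t,u,v). (u + v) / 2) i) ((\<lambda>(t,u,v). (v - u) / 2) i) \<and>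
          (\<lambda>(t,u,v). (v - u) / 2) i < d"
        using uv d by (intro exI[of _ "(t, u, v)"]) (auto simp: cb bad_def)
    qed
    define J where "J i = {fst (snd i)..snd (snd i)}" for i :: "real \<times> real \<times> real"
    have CK: "fst (snd i) < snd (snd i)" "bad n (fst i) (fst (snd i)) (snd (snd i))" "J i \<subseteq> \<gamma> (fst i)"
      if "i \<in> C" for i
      using set_mp[OF C(2) that] by (auto simp: K_def bad_def J_def split_beta)
    have cbJ: "cball ((\<lambda>(t,u,v). (u + v) / 2) i) ((\<lambda>(t,u,v). (v - u) / 2) i) = J i" if "i \<in> C" for i
      using CK(1)[OF that] by (auto simp: J_def cb split: prod.splits)
    have disj: "disjnt (J i) (J j)" if "i \<in> C" "j \<in> C" "i \<noteq> j" for i j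
      using C(3) that unfolding pairwise_def by (metis cbJ)
    have neg: "negligible (E n - (\<Union>i\<in>C. J i))"
      using C(4) cbJ by simp
    \<comment> \<open>The Henstock lemma speaks of finite divisions, so the bound is proved for
      finite subfamilies and then passed to the countable union.\<close>
    have bound: "measure lebesgue (\<Union>i\<in>C'. J i) \<le> e" if C': "C' \<subseteq> C" "finite C'" for C'
    proof -
      define p where "p = (\<lambda>i. (fst i, J i)) ` C'"
      have inj: "inj_on (\<lambda>i. (fst i, J i)) C'"
      proof (rule inj_onI, rule ccontr)
        fix i j assume ij: "i \<in> C'" "j \<in> C'" "(fst i, J i) = (fst j, J j)" "i \<noteq> j"
        then have "disjnt (J i) (J i)" using disj[of i j] C' by auto
        moreover have "J i \<noteq> {}" using CK(1)[of i] ij C' by (auto simp: J_def)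
        ultimately show False by (simp add: disjnt_def)
      qed
      have "p tagged_partial_division_of cbox a b"
        unfolding tagged_partial_division_of_def p_def
      proof (intro conjI allI impI)
        show "finite ((\<lambda>i. (fst i, J i)) ` C')" using C' by simp
        show "x \<in> k" "k \<subseteq> cbox a b" "\<exists>a b. k = cbox a b" if "(x, k) \<in> (\<lambda>i. (fst i, J i)) ` C'" for x k
        proof -
          from that obtain i where i: "i \<in> C" "x = fst i" "k = J i" using C' by auto
          show "x \<in> k" "k \<subseteq> cbox a b" using CK(2)[OF i(1)] i by (auto simp: J_def bad_def)
          show "\<exists>a b. k = cbox a b" unfolding i J_def cbox_interval[symmetric] by blast
        qed
        show "interior k1 \<inter> interior k2 = {}"
          if "(x1, k1) \<in> (\<lambda>i. (fst i, J i)) ` C' \<and> (x2, k2) \<in> (\<lambda>i. (fst i, J i)) ` C' \<and> (x1, k1) \<noteq> (x2, k2)"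
          for x1 k1 x2 k2
        proof -
          from that obtain i j where ij: "i \<in> C'" "j \<in> C'" "(x1, k1) = (fst i, J i)" "(x2, k2) = (fst j, J j)"
            by blast
          with that have "k1 = J i" "k2 = J j" "i \<noteq> j" by auto
          with ij have "disjnt k1 k2" using disj[of i j] C' by auto
          then show ?thesis using interior_subset[of k1] interior_subset[of k2] by (auto simp: disjnt_def)
        qed
      qed
      moreover have "\<gamma> fine p"
        unfolding fine_def p_def using C' CK(3) by blast
      ultimately have "(\<Sum>(x,k)\<in>p. norm (measure lborel k *\<^sub>R f x - integral k f)) < e / Suc n" by (rule H)
      also have "(\<Sum>(x,k)\<in>p. norm (measure lborel k *\<^sub>R f x - integral k f)) =
          (\<Sum>i\<in>C'. norm (measure lborel (J i) *\<^sub>R f (fst i) - integral (J i) f))"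
        unfolding p_def by (subst sum.reindex[OF inj]) simp
      finally have "(\<Sum>i\<in>C'. norm (measure lborel (J i) *\<^sub>R f (fst i) - integral (J i) f)) < e / Suc n" .
      moreover have "(\<Sum>i\<in>C'. measure lborel (J i) / Suc n) \<le>
          (\<Sum>i\<in>C'. norm (measure lborel (J i) *\<^sub>R f (fst i) - integral (J i) f))"
      proof (rule sum_mono)
        fix i assume "i \<in> C'"
        with C' have "i \<in> C" by auto
        from CK(1,2)[OF this] show "measure lborel (J i) / Suc n \<le>
            norm (measure lborel (J i) *\<^sub>R f (fst i) - integral (J i) f)"
          by (simp add: J_def bad_def)
      qed
      ultimately have "(\<Sum>i\<in>C'. measure lborel (J i)) / Suc n < e / Suc n" by (simp add: sum_divide_distrib)
      then have "(\<Sum>i\<in>C'. measure lebesgue (J i)) < e"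
        by (simp add: divide_less_cancel J_def measure_completion)
      moreover have "measure lebesgue (\<Union>i\<in>C'. J i) \<le> (\<Sum>i\<in>C'. measure lebesgue (J i))"
        using C' by (intro measure_UNION_le) (auto simp: J_def)
      ultimately show ?thesis by simp
    qed
    have lm: "(\<Union>i\<in>C. J i) \<in> lmeasurable" and le: "measure lebesgue (\<Union>i\<in>C. J i) \<le> e"
      using fmeasurable_UN_bound[OF C(1), of J lebesgue e] measure_UN_bound[OF C(1), of J lebesgue e] bound
      by (auto simp: J_def)
    show "\<exists>S. E n \<subseteq> S \<and> S \<in> lmeasurable \<and> measure lebesgue S \<le> e"
    proof (intro exI conjI)
      show "E n \<subseteq> (\<Union>i\<in>C. J i) \<union> (E n - (\<Union>i\<in>C. J i))" by auto
      show "(\<Union>i\<in>C. J i) \<union> (E n - (\<Union>i\<in>C. J i)) \<in> lmeasurable"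
        using lm neg by (intro fmeasurable.Un) (auto intro: negligible_imp_measurable)
      show "measure lebesgue ((\<Union>i\<in>C. J i) \<union> (E n - (\<Union>i\<in>C. J i))) \<le> e"
        using measure_Un_le[of "\<Union>i\<in>C. J i" lebesgue "E n - (\<Union>i\<in>C. J i)"] lm neg le
          negligible_imp_measure0[OF neg] negligible_imp_measurable[OF neg] by (auto dest: fmeasurableD)
    qed
  qed
  then have "negligible (\<Union>n. E n)" by (intro negligible_countable_Union) auto
  then show ?thesis
  proof (rule negligible_subset, intro subsetI)
    fix t assume "t \<in> {t \<in> {a<..<b}. \<not> ((\<lambda>x. integral {a..x} f) has_vector_derivative f t) (at t)}"
    then have t: "a < t" "t < b" and nd: "\<not> ((\<lambda>x. integral {a..x} f) has_vector_derivative f t) (at t)" by auto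
    show "t \<in> (\<Union>n. E n)"
    proof (rule ccontr)
      assume "t \<notin> (\<Union>n. E n)"
      then have good: "\<exists>d>0. \<forall>u v. v - u < d \<longrightarrow> \<not> bad n t u v" for n using t by (auto simp: E_def)
      have comb: "integral {a..y} f - integral {a..x} f = integral {x..y} f" if "a \<le> x" "x \<le> y" "y \<le> b" for x y
        using Henstock_Kurzweil_Integration.integral_combine[OF that(1,2), of f] integrable_on_subinterval[OF f, of a y] that
        by (simp add: algebra_simps)
      have "((\<lambda>x. integral {a..x} f) has_vector_derivative f t) (at t)"
        unfolding has_vector_derivative_def has_derivative_at_alt
      proof (intro conjI allI impI)
        show "bounded_linear (\<lambda>x. x *\<^sub>R f t)" by (rule bounded_linear_scaleR_left)
        fix e :: real assume "0 < e"
        then obtain n where n: "inverse (real (Suc n)) < e" using reals_Archimedean by blast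
        obtain d where d: "0 < d" "\<And>u v. v - u < d \<Longrightarrow> \<not> bad n t u v" using good[of n] by blast
        show "\<exists>d>0. \<forall>y. norm (y - t) < d \<longrightarrow>
            norm (integral {a..y} f - integral {a..t} f - (y - t) *\<^sub>R f t) \<le> e * norm (y - t)"
        proof (intro exI[of _ "min d (min (t - a) (b - t))"] conjI allI impI)
          show "0 < min d (min (t - a) (b - t))" using d t by simp
          fix y assume y: "norm (y - t) < min d (min (t - a) (b - t))"
          have *: "norm ((v - u) *\<^sub>R f t - integral {u..v} f) \<le> e * (v - u)"
            if "a \<le> u" "u \<le> t" "t \<le> v" "v \<le> b" "u < v" "v - u < d" for u v
          proof -
            have "norm ((v - u) *\<^sub>R f t - integral {u..v} f) < inverse (real (Suc n)) * (v - u)"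
              using d(2)[OF that(6)] that by (simp add: bad_def divide_inverse mult.commute not_le)
            also have "\<dots> \<le> e * (v - u)" using n that by (intro mult_right_mono) auto
            finally show ?thesis by simp
          qed
          consider "y = t" | "y < t" | "t < y" by linarith
          then show "norm (integral {a..y} f - integral {a..t} f - (y - t) *\<^sub>R f t) \<le> e * norm (y - t)"
          proof cases
            case 2
            then have "norm ((t - y) *\<^sub>R f t - integral {y..t} f) \<le> e * (t - y)" using y t by (intro *) auto
            moreover have "integral {a..y} f - integral {a..t} f - (y - t) *\<^sub>R f t = (t - y) *\<^sub>R f t - integral {y..t} f"
              using comb[of y t] 2 y t by (simp add: algebra_simps)
            ultimately show ?thesis using 2 by simp
          next
            case 3
            then have "norm ((y - t) *\<^sub>R f t - integral {t..y} f) \<le> e * (y - t)" using y t by (intro *) auto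
            moreover have "integral {a..y} f - integral {a..t} f - (y - t) *\<^sub>R f t = - ((y - t) *\<^sub>R f t - integral {t..y} f)"
              using comb[of t y] 3 y t by (simp add: algebra_simps)
            ultimately show ?thesis using 3 by (simp only: norm_minus_cancel) simp
          qed simp
        qed
      qed
      with nd show False by blast
    qed
  qed
qed

section \<open>The maximisation problem at a fixed time\<close>

text \<open>Discrete gradient along an edge; constants are in its kernel, so potentials matter only
  up to an additive constant.\<close>

definition gr :: "real^'a \<Rightarrow> 'a::finite \<times> 'a \<Rightarrow> real" where
  "gr a e = a $ snd e - a $ fst e"

text \<open>Dual functional of an entropic flow problem: v is the prescribed divergence and the
  potential a is its multiplier. The supremum turns out to be the \<open>ent\<close> cost of the
  optimal flow \<open>r e * w e\<close> (\<open>S_eq\<close>).\<close>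

definition obj :: "('a \<times> 'a) set \<Rightarrow> ('a \<times> 'a \<Rightarrow> real) \<Rightarrow> real^'a::finite \<Rightarrow> real^'a \<Rightarrow> real" where
  "obj E r v a = a \<bullet> v - (\<Sum>e\<in>E. r e * (exp (gr a e) - 1))"

text \<open>\<open>ent (1 + u) = tau_star u\<close> for \<open>u \<ge> -1\<close>, including \<open>u = -1\<close> because \<open>0 * ln 0 = 0\<close>.\<close>

definition ent :: "real \<Rightarrow> real" where
  "ent w = w * ln w - w + 1"

lemma gr_add [simp]: "gr (a + b) e = gr a e + gr b e"
  and gr_scaleR [simp]: "gr (c *\<^sub>R a) e = c * gr a e"
  and gr_zero [simp]: "gr 0 e = 0"
  by (simp_all add: gr_def algebra_simps)

lemma gr_bound: "\<bar>gr a e\<bar> \<le> 2 * norm a"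
  unfolding gr_def using component_le_norm_cart[of a "snd e"] component_le_norm_cart[of a "fst e"] by linarith

lemma tau_star_ent: "0 \<le> w \<Longrightarrow> tau_star (w - 1) = ereal (ent w)"
  by (cases "w = 0") (auto simp: tau_star_def ent_def one_ereal_def)

lemma ent_nonneg: "0 \<le> w \<Longrightarrow> 0 \<le> ent w"
proof (cases "w = 0")
  case False
  assume "0 \<le> w"
  with False have w: "0 < w" by simp
  have "ln (1 / w) \<le> 1 / w - 1" using w by (intro ln_le_minus_one) auto
  then have "w * (1 - 1 / w) \<le> w * ln w" using w by (intro mult_left_mono) (auto simp: ln_div)
  then show ?thesis using w by (simp add: ent_def algebra_simps)
qed (simp add: ent_def)

lemma exp_square_half: "exp (x / 2) ^ 2 = exp (x::real)"
  by (simp flip: exp_of_nat_mult)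

text \<open>\<open>exp\<close> at a midpoint is the product of the two square roots, and
  \<open>x * y = (x\<^sup>2 + y\<^sup>2) / 2 - (x - y)\<^sup>2 / 2\<close>; convexity thus has an
  exact quadratic remainder.\<close>

lemma sum_exp_midpoint:
  "(\<Sum>e\<in>E. r e * (exp (gr (midpoint a b) e) - 1)) =
     ((\<Sum>e\<in>E. r e * (exp (gr a e) - 1)) + (\<Sum>e\<in>E. r e * (exp (gr b e) - 1))) / 2 -
     (\<Sum>e\<in>E. r e * (exp (gr a e / 2) - exp (gr b e / 2))\<^sup>2 / 2)"
proof -
  have "r e * (exp (gr (midpoint a b) e) - 1) = (r e * (exp (gr a e) - 1) + r e * (exp (gr b e) - 1)) / 2 -
      r e * (exp (gr a e / 2) - exp (gr b e / 2))\<^sup>2 / 2" for e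
  proof -
    have "exp (gr (midpoint a b) e) = exp (gr a e / 2) * exp (gr b e / 2)"
      by (simp add: midpoint_def exp_add[symmetric] add_divide_distrib)
    then show ?thesis
      using exp_square_half[of "gr a e"] exp_square_half[of "gr b e"]
      by (simp add: power2_diff field_simps)
  qed
  then show ?thesis by (simp only: sum.distrib[symmetric] sum_subtractf[symmetric] sum_divide_distrib)
qed

lemma obj_midpoint:
  "obj E r v (midpoint a b) = (obj E r v a + obj E r v b) / 2 +
     (\<Sum>e\<in>E. r e * (exp (gr a e / 2) - exp (gr b e / 2))\<^sup>2 / 2)"
  unfolding obj_def sum_exp_midpoint by (simp add: midpoint_def inner_add_left field_simps)

text \<open>A sequence instead of a maximiser: if the optimal flow vanishes on an edge of positive
  rate, the gradients there tend to minus infinity and only their exponentials have a finite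
  limit.\<close>

locale maximizing_sequence =
  fixes E :: "('a::finite \<times> 'a) set" and r :: "'a \<times> 'a \<Rightarrow> real" and v :: "real^'a"
    and S :: real and \<alpha> :: "nat \<Rightarrow> real^'a"
  assumes r_nonneg: "\<And>e. e \<in> E \<Longrightarrow> 0 \<le> r e"
    and le_S: "\<And>a. obj E r v a \<le> S"
    and lim_S: "(\<lambda>n. obj E r v (\<alpha> n)) \<longlonglongrightarrow> S"
begin

text \<open>The midpoint of two members has value at most S, so the defect is bounded by the sum of
  their distances from S in value. This makes the square roots \<open>z\<close> Cauchy once the
  positive \<open>r e\<close> is divided out.\<close>

lemma convergent_exp:
  assumes e: "e \<in> E" "0 < r e"
  shows "convergent (\<lambda>n. exp (gr (\<alpha> n) e))"
proof -
  define z where "z n = exp (gr (\<alpha> n) e / 2)" for n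
  have key: "r e * (z n - z k)\<^sup>2 \<le> (S - obj E r v (\<alpha> n)) + (S - obj E r v (\<alpha> k))" for n k
  proof -
    have "r e * (z n - z k)\<^sup>2 / 2 \<le> (\<Sum>e\<in>E. r e * (exp (gr (\<alpha> n) e / 2) - exp (gr (\<alpha> k) e / 2))\<^sup>2 / 2)"
      unfolding z_def using e r_nonneg by (intro member_le_sum) auto
    also have "\<dots> = obj E r v (midpoint (\<alpha> n) (\<alpha> k)) - (obj E r v (\<alpha> n) + obj E r v (\<alpha> k)) / 2"
      by (simp add: obj_midpoint)
    also have "\<dots> \<le> S - (obj E r v (\<alpha> n) + obj E r v (\<alpha> k)) / 2" using le_S by simp
    finally show ?thesis by (simp add: field_simps)
  qed
  have "Cauchy z"
  proof (rule metric_CauchyI)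
    fix \<epsilon> :: real assume "0 < \<epsilon>"
    then have "S - r e * \<epsilon>\<^sup>2 / 2 < S" using e by simp
    from order_tendstoD(1)[OF lim_S this] obtain N where
      N: "\<And>n. N \<le> n \<Longrightarrow> S - r e * \<epsilon>\<^sup>2 / 2 < obj E r v (\<alpha> n)" by (auto simp: eventually_sequentially)
    show "\<exists>M. \<forall>m\<ge>M. \<forall>n\<ge>M. dist (z m) (z n) < \<epsilon>"
    proof (intro exI allI impI)
      fix m n assume "N \<le> m" "N \<le> n"
      then have "r e * (z m - z n)\<^sup>2 < r e * \<epsilon>\<^sup>2" using key[of m n] N[of m] N[of n] by argo
      then have "\<bar>z m - z n\<bar>\<^sup>2 < \<epsilon>\<^sup>2" using e by simp
      then show "dist (z m) (z n) < \<epsilon>"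
        unfolding dist_real_def by (rule power2_less_imp_less) (use \<open>0 < \<epsilon>\<close> in auto)
    qed
  qed
  then have "convergent z" by (rule Cauchy_convergent)
  then have "convergent (\<lambda>n. z n * z n)" by (intro convergent_mult)
  then show ?thesis by (simp add: z_def flip: exp_add)
qed

text \<open>The value \<open>1\<close> on edges without rate makes \<open>w - 1\<close> and hence its \<open>tau_star\<close> vanish there.\<close>

definition w :: "'a \<times> 'a \<Rightarrow> real" where
  "w e = (if 0 < r e then lim (\<lambda>n. exp (gr (\<alpha> n) e)) else 1)"

lemma w_tendsto: "e \<in> E \<Longrightarrow> 0 < r e \<Longrightarrow> (\<lambda>n. exp (gr (\<alpha> n) e)) \<longlonglongrightarrow> w e"
  using convergent_exp by (auto simp: w_def convergent_LIMSEQ_iff)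

lemma w_nonneg: "e \<in> E \<Longrightarrow> 0 \<le> w e"
proof (cases "0 < r e")
  case True
  assume "e \<in> E"
  show ?thesis by (rule LIMSEQ_le_const[OF w_tendsto[OF \<open>e \<in> E\<close> True]]) auto
qed (simp add: w_def)

lemma r_w_tendsto: "e \<in> E \<Longrightarrow> (\<lambda>n. r e * exp (gr (\<alpha> n) e)) \<longlonglongrightarrow> r e * w e"
  using r_nonneg[of e] by (cases "r e = 0") (auto intro!: tendsto_mult_left w_tendsto)

lemma Euler_Lagrange: "\<beta> \<bullet> v = (\<Sum>e\<in>E. r e * w e * gr \<beta> e)"
proof -
  \<comment> \<open>\<open>\<phi> s\<close> is the limiting gain from moving the whole sequence by
    \<open>s *\<^sub>R \<beta>\<close>. The gain of the n-th member is at most its distance from S,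
    so \<open>\<phi>\<close> has its maximum 0 at 0 and its derivative vanishes there.\<close>
  define \<phi> where "\<phi> s = s * (\<beta> \<bullet> v) - (\<Sum>e\<in>E. r e * w e * (exp (s * gr \<beta> e) - 1))" for s
  have "\<phi> s \<le> 0" for s
  proof -
    have eq: "obj E r v (\<alpha> n + s *\<^sub>R \<beta>) - obj E r v (\<alpha> n) =
        s * (\<beta> \<bullet> v) - (\<Sum>e\<in>E. r e * exp (gr (\<alpha> n) e) * (exp (s * gr \<beta> e) - 1))" for n
      by (simp add: obj_def inner_add_left exp_add algebra_simps sum_subtractf sum.distrib)
    have "(\<lambda>n. s * (\<beta> \<bullet> v) - (\<Sum>e\<in>E. r e * exp (gr (\<alpha> n) e) * (exp (s * gr \<beta> e) - 1))) \<longlonglongrightarrow> \<phi> s"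
      unfolding \<phi>_def by (intro tendsto_intros r_w_tendsto) auto
    moreover have "(\<lambda>n. S - obj E r v (\<alpha> n)) \<longlonglongrightarrow> S - S" by (intro tendsto_intros lim_S)
    ultimately have "\<phi> s \<le> S - S"
      using le_S by (elim LIMSEQ_le) (auto simp flip: eq)
    then show ?thesis by simp
  qed
  moreover have "\<phi> 0 = 0" by (simp add: \<phi>_def)
  moreover have "DERIV \<phi> 0 :> \<beta> \<bullet> v - (\<Sum>e\<in>E. r e * w e * gr \<beta> e)"
    unfolding \<phi>_def by (auto intro!: derivative_eq_intros sum.cong)
  ultimately have "\<beta> \<bullet> v - (\<Sum>e\<in>E. r e * w e * gr \<beta> e) = 0"
    by (intro DERIV_local_max[of \<phi> _ 0 1]) auto
  then show ?thesis by simp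
qed

text \<open>Euler--Lagrange rewrites \<open>\<alpha> n \<bullet> v\<close> edgewise, so the value
  becomes a sum of terms that converge one by one. If \<open>w e = 0\<close>, the product
  \<open>w e * gr (\<alpha> n) e\<close> is identically zero although the gradient diverges, and no
  indeterminate form arises.\<close>

lemma S_eq: "S = (\<Sum>e\<in>E. r e * ent (w e))"
proof -
  have "(\<lambda>n. r e * (w e * gr (\<alpha> n) e - exp (gr (\<alpha> n) e) + 1)) \<longlonglongrightarrow> r e * ent (w e)" if e: "e \<in> E" for e
  proof (cases "r e = 0")
    case False
    with e r_nonneg have re: "0 < r e" by (metis less_eq_real_def)
    have L: "(\<lambda>n. w e * gr (\<alpha> n) e) \<longlonglongrightarrow> w e * ln (w e)"
    proof (cases "w e = 0")
      case False
      then have "(\<lambda>n. ln (exp (gr (\<alpha> n) e))) \<longlonglongrightarrow> ln (w e)" by (intro tendsto_ln w_tendsto e re)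
      then have "(\<lambda>n. w e * ln (exp (gr (\<alpha> n) e))) \<longlonglongrightarrow> w e * ln (w e)" by (rule tendsto_mult_left)
      then show ?thesis by (simp only: ln_exp)
    qed simp
    show ?thesis unfolding ent_def
      by (intro tendsto_mult_left tendsto_add tendsto_diff tendsto_const L w_tendsto e re)
  qed simp
  then have "(\<lambda>n. \<Sum>e\<in>E. r e * (w e * gr (\<alpha> n) e - exp (gr (\<alpha> n) e) + 1)) \<longlonglongrightarrow> (\<Sum>e\<in>E. r e * ent (w e))"
    by (intro tendsto_sum)
  moreover have "(\<Sum>e\<in>E. r e * (w e * gr (\<alpha> n) e - exp (gr (\<alpha> n) e) + 1)) = obj E r v (\<alpha> n)" for n
    unfolding obj_def Euler_Lagrange by (simp add: algebra_simps sum_subtractf sum.distrib)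
  ultimately show ?thesis using LIMSEQ_unique[OF lim_S] by simp
qed

lemma convergent_gr:
  assumes irr: "irrefl E" "irreducible_digraph E" and pos: "\<And>e. e \<in> E \<Longrightarrow> 0 < r e" and e: "e \<in> E"
  shows "0 < w e" "(\<lambda>n. gr (\<alpha> n) e) \<longlonglongrightarrow> ln (w e)"
proof -
  obtain x x' where xx: "e = (x, x')" by force
  have step: "\<exists>B. \<forall>n. gr (\<alpha> n) (y, y') \<le> B" if "(y, y') \<in> E" for y y'
  proof -
    have "convergent (\<lambda>n. exp (gr (\<alpha> n) (y, y')))" by (rule convergent_exp[OF that pos[OF that]])
    then obtain B where "\<And>n. norm (exp (gr (\<alpha> n) (y, y'))) \<le> B"
      by (metis Bseq_def convergent_imp_Bseq)
    moreover have "gr (\<alpha> n) (y, y') \<le> exp (gr (\<alpha> n) (y, y'))" for n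
      using exp_ge_add_one_self[of "gr (\<alpha> n) (y, y')"] by linarith
    ultimately show ?thesis by (metis abs_le_D1 order_trans real_norm_def)
  qed
  have "\<exists>B. \<forall>n. gr (\<alpha> n) (y, y') \<le> B" if "(y, y') \<in> E\<^sup>+" for y y'
    using that
  proof induction
    case (base y')
    then show ?case by (rule step)
  next
    case (step y' y'')
    then obtain B B' where "\<And>n. gr (\<alpha> n) (y, y') \<le> B" "\<And>n. gr (\<alpha> n) (y', y'') \<le> B'"
      using \<open>\<And>y y'. (y, y') \<in> E \<Longrightarrow> \<exists>B. \<forall>n. gr (\<alpha> n) (y, y') \<le> B\<close> by metis
    then have "gr (\<alpha> n) (y, y'') \<le> B + B'" for n
      using add_mono[of "gr (\<alpha> n) (y, y')" B "gr (\<alpha> n) (y', y'')" B'] by (simp add: gr_def)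
    then show ?case by blast
  qed
  moreover have "x' \<noteq> x" using e irr xx by (auto simp: irrefl_def)
  then have "(x', x) \<in> E\<^sup>+" using irr by (auto simp: irreducible_digraph_def)
  ultimately obtain B where B: "\<And>n. gr (\<alpha> n) (x', x) \<le> B" by metis
  have "exp (- B) \<le> exp (gr (\<alpha> n) e)" for n using B[of n] by (simp add: xx gr_def)
  then have "exp (- B) \<le> w e"
    by (intro LIMSEQ_le_const[OF w_tendsto[OF e pos[OF e]]]) auto
  then show pw: "0 < w e" by (meson exp_gt_zero less_le_trans)
  have "(\<lambda>n. ln (exp (gr (\<alpha> n) e))) \<longlonglongrightarrow> ln (w e)" using pw by (intro tendsto_ln w_tendsto e pos) auto
  then show "(\<lambda>n. gr (\<alpha> n) e) \<longlonglongrightarrow> ln (w e)" by simp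
qed

lemma maximizer_exists:
  assumes irr: "irrefl E" "irreducible_digraph E" and pos: "\<And>e. e \<in> E \<Longrightarrow> 0 < r e"
  obtains a where "obj E r v a = S" "\<And>e. e \<in> E \<Longrightarrow> w e = exp (gr a e)"
proof -
  \<comment> \<open>Any vertex serves: anchoring fixes the additive constant that the gradients
    leave open, and paths from \<open>x0\<close> make the anchored potentials converge.\<close>
  define x0 :: 'a where "x0 = undefined"
  have conv: "convergent (\<lambda>n. gr (\<alpha> n) (x, x'))" if "(x, x') \<in> E\<^sup>+" for x x'
    using that
  proof induction
    case (base x')
    then show ?case using convergent_gr(2)[OF irr pos] by (auto simp: convergent_def)
  next
    case (step x' x'')
    have "convergent (\<lambda>n. gr (\<alpha> n) (x', x''))"
      using step convergent_gr(2)[OF irr pos] by (auto simp: convergent_def)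
    with step.IH have "convergent (\<lambda>n. gr (\<alpha> n) (x, x') + gr (\<alpha> n) (x', x''))" by (rule convergent_add)
    then show ?case by (simp add: gr_def)
  qed
  have conv0: "convergent (\<lambda>n. gr (\<alpha> n) (x0, x))" for x
    using conv[of x0 x] irr(2) by (cases "x = x0") (auto simp: irreducible_digraph_def gr_def convergent_const)
  define a :: "real^'a" where "a = (\<chi> x. lim (\<lambda>n. gr (\<alpha> n) (x0, x)))"
  have lim: "(\<lambda>n. gr (\<alpha> n) (x0, x)) \<longlonglongrightarrow> a $ x" for x
    using conv0[of x] by (simp add: a_def convergent_LIMSEQ_iff)
  have gra: "(\<lambda>n. gr (\<alpha> n) e) \<longlonglongrightarrow> gr a e" for e
    using tendsto_diff[OF lim[of "snd e"] lim[of "fst e"]] by (simp add: gr_def)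
  have we: "w e = exp (gr a e)" if "e \<in> E" for e
    using LIMSEQ_unique[OF gra convergent_gr(2)[OF irr pos that]] convergent_gr(1)[OF irr pos that] by simp
  have "obj E r v a = (\<Sum>e\<in>E. r e * ent (w e))"
    unfolding obj_def Euler_Lagrange sum_subtractf[symmetric]
    by (intro sum.cong refl) (simp add: we ent_def algebra_simps)
  then have "obj E r v a = S" using S_eq by simp
  with we that show ?thesis by blast
qed

end

section \<open>Measurable paths, grids and the Young function\<close>

lemma C1_on_polynomial:
  fixes p :: "real \<Rightarrow> 'b::euclidean_space"
  assumes "polynomial_function p"
  shows "C1_on S p"
proof -
  obtain p' where p': "polynomial_function p'" "\<And>x. (p has_vector_derivative p' x) (at x)"
    using has_vector_derivative_polynomial_function[OF assms] by blast
  show ?thesis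
    unfolding C1_on_def
  proof (intro exI conjI ballI)
    show "continuous_on S (\<lambda>t. blinfun_scaleR_left (p' t))"
      using p'(1) by (intro bounded_linear.continuous_on[OF bounded_linear_blinfun_scaleR_left]
          continuous_on_polymonial_function)
    show "(p has_derivative blinfun_scaleR_left (p' t)) (at t within S)" for t
      using has_vector_derivative_at_within[OF p'(2)] by (simp add: has_vector_derivative_def)
  qed
qed

lemma C1_on_imp_continuous_on: "C1_on S f \<Longrightarrow> continuous_on S f"
  unfolding C1_on_def by (metis continuous_on_eq_continuous_within has_derivative_continuous)

text \<open>Lets a control that depends on time alone serve as the feedback \<open>g\<close> of an
  admissible pair.\<close>

lemma C1_on_fst:
  fixes p :: "'a::real_normed_vector \<Rightarrow> 'b::real_normed_vector"
  assumes "C1_on S p"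
  shows "C1_on (S \<times> U) (\<lambda>(t, u::'c::real_normed_vector). p t)"
proof -
  obtain p' where p': "continuous_on S p'" "\<And>x. x \<in> S \<Longrightarrow> (p has_derivative blinfun_apply (p' x)) (at x within S)"
    using assms unfolding C1_on_def by blast
  define F :: "('a \<times> 'c) \<Rightarrow>\<^sub>L 'a" where "F = Blinfun fst"
  have F: "blinfun_apply F = fst" unfolding F_def by (rule bounded_linear_Blinfun_apply) (rule bounded_linear_fst)
  show ?thesis
    unfolding C1_on_def
  proof (intro exI conjI ballI)
    show "continuous_on (S \<times> U) (\<lambda>x. p' (fst x) o\<^sub>L F)"
      by (intro bounded_bilinear.continuous_on[OF bounded_bilinear_blinfun_compose] continuous_on_const
          continuous_on_compose2[OF p'(1)] continuous_on_fst continuous_on_id) auto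
    fix x assume "x \<in> S \<times> U"
    then have "fst x \<in> S" by auto
    from p'(2)[OF this] have "(p has_derivative blinfun_apply (p' (fst x))) (at (fst x) within fst ` (S \<times> U))"
      by (rule has_derivative_subset) auto
    then have "((\<lambda>z. p (fst z)) has_derivative (\<lambda>z. p' (fst x) (fst z))) (at x within S \<times> U)"
      by (rule has_derivative_in_compose[OF bounded_linear_imp_has_derivative[OF bounded_linear_fst]])
    then show "((\<lambda>(t, u). p t) has_derivative blinfun_apply (p' (fst x) o\<^sub>L F)) (at x within S \<times> U)"
      by (simp add: F case_prod_beta' fun_eq_iff blinfun_compose.rep_eq comp_def)
  qed
qed

lemma LIMSEQ_of_inverse_Suc_bound:
  fixes f :: "nat \<Rightarrow> 'a::real_normed_vector"
  assumes "\<And>n. norm (f n - a) \<le> 1 / real (Suc n)"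
  shows "f \<longlonglongrightarrow> a"
proof -
  have "(\<lambda>n. f n - a) \<longlonglongrightarrow> 0"
  proof (rule Lim_null_comparison)
    show "\<forall>\<^sub>F n in sequentially. norm (f n - a) \<le> 1 / real (Suc n)"
      using assms by (intro always_eventually allI)
    show "(\<lambda>n. 1 / real (Suc n)) \<longlonglongrightarrow> 0"
      using LIMSEQ_inverse_real_of_nat by (simp add: inverse_eq_divide)
  qed
  then show ?thesis by (rule LIM_zero_cancel)
qed

text \<open>A measurable function is an a.e. limit of continuous ones. Projecting these onto a ball
  that contains the range of f gives the uniform bound that dominated convergence will ask for and
  leaves the limit unchanged; Stone--Weierstrass then supplies polynomials, which are
  smooth.\<close>

lemma bounded_measurable_C1_approx:
  fixes f :: "real \<Rightarrow> real^'a::finite"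
  assumes f: "bounded_measurable T f"
  obtains p B where "\<And>n. C1_on {0..T} (p n)" "\<And>n t. t \<in> {0..T} \<Longrightarrow> norm (p n t) \<le> B"
    "AE t in lebesgue_on {0..T}. (\<lambda>n. p n t) \<longlonglongrightarrow> f t"
proof -
  from f obtain B where B: "0 < B" "\<And>t. t \<in> {0..T} \<Longrightarrow> norm (f t) \<le> B"
    unfolding bounded_measurable_def bounded_pos by auto
  from f have "f measurable_on {0..T}"
    by (subst measurable_on_iff_borel_measurable) (auto simp: bounded_measurable_def)
  then obtain N g where N: "negligible N" and g: "\<And>n. continuous_on UNIV (g n)"
    "\<And>x. x \<notin> N \<Longrightarrow> (\<lambda>n. g n x) \<longlonglongrightarrow> (if x \<in> {0..T} then f x else 0)"
    unfolding measurable_on_def by blast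
  define cp where "cp = closest_point (cball (0::real^'a) B)"
  have cp: "continuous_on UNIV cp" "\<And>x. norm (cp x) \<le> B" "\<And>x. norm x \<le> B \<Longrightarrow> cp x = x"
    using B(1) closest_point_in_set[of "cball (0::real^'a) B"]
    by (auto simp: cp_def intro!: continuous_on_closest_point closest_point_self)
  have "\<exists>p. polynomial_function p \<and> (\<forall>t\<in>{0..T}. norm (cp (g n t) - p t) < 1 / Suc n)" for n
    by (intro Stone_Weierstrass_polynomial_function)
      (auto intro!: continuous_on_compose2[OF cp(1)] continuous_on_subset[OF g(1)])
  then obtain p where p: "\<And>n. polynomial_function (p n)"
    "\<And>n t. t \<in> {0..T} \<Longrightarrow> norm (cp (g n t) - p n t) < 1 / Suc n" by metis
  show ?thesis
  proof
    show "C1_on {0..T} (p n)" for n by (rule C1_on_polynomial) (rule p)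
    fix n t assume t: "t \<in> {0..T}"
    have "norm (p n t) \<le> norm (cp (g n t)) + norm (cp (g n t) - p n t)"
      by (metis norm_triangle_sub norm_minus_commute)
    also have "\<dots> \<le> B + 1"
      by (intro add_mono cp(2) less_imp_le[OF less_le_trans[OF p(2)[OF t]]]) auto
    finally show "norm (p n t) \<le> B + 1" .
  next
    have "AE t in lebesgue. t \<notin> N" using N by (simp add: negligible_iff_null_sets AE_not_in)
    then have "AE t in lebesgue_on {0..T}. t \<notin> N"
      by (subst AE_restrict_space_iff) auto
    then show "AE t in lebesgue_on {0..T}. (\<lambda>n. p n t) \<longlonglongrightarrow> f t"
      using AE_space
    proof eventually_elim
      case (elim t)
      then have t: "t \<in> {0..T}" by (simp add: space_restrict_space)
      have "(\<lambda>n. g n t) \<longlonglongrightarrow> f t" using g(2)[of t] elim t by simp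
      then have "(\<lambda>n. cp (g n t)) \<longlonglongrightarrow> cp (f t)"
        using cp(1) by (auto simp: continuous_on_eq_continuous_at intro: isCont_tendsto_compose)
      then have 1: "(\<lambda>n. cp (g n t)) \<longlonglongrightarrow> f t" using cp(3)[OF B(2)[OF t]] by simp
      have "(\<lambda>n. cp (g n t) - p n t) \<longlonglongrightarrow> 0"
        using p(2)[OF t] by (intro LIMSEQ_of_inverse_Suc_bound) (auto intro: less_imp_le)
      from tendsto_diff[OF 1 this] show ?case by simp
    qed
  qed
qed

section \<open>Rounding down to uniform grids\<close>

definition grid :: "real \<Rightarrow> nat \<Rightarrow> real \<Rightarrow> real" where
  "grid T N t = real_of_int \<lfloor>t * real N / T\<rfloor> * T / real N"

text \<open>Factoring through the integer floor makes this true for an arbitrary f;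
  \<open>cadlag_measurable\<close> relies on that.\<close>

lemma grid_measurable [measurable]: "(\<lambda>t. f (grid T N t)) \<in> borel_measurable borel"
  unfolding grid_def
  by (rule measurable_compose[where g = "\<lambda>k. f (real_of_int k * T / real N)" and N = "count_space UNIV"])
     measurable

lemma grid_bounds:
  assumes "0 < T" "0 < N"
  shows "grid T N t \<le> t" "t < grid T N t + T / N"
proof -
  have "real_of_int \<lfloor>t * real N / T\<rfloor> * T \<le> t * real N"
    using of_int_floor_le[of "t * real N / T"] assms by (subst (asm) pos_le_divide_eq) auto
  then show "grid T N t \<le> t" using assms by (simp add: grid_def pos_divide_le_eq)
  have "t * real N / T < real_of_int \<lfloor>t * real N / T\<rfloor> + 1" by linarith
  then show "t < grid T N t + T / N" using assms by (simp add: grid_def field_simps)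
qed

lemma grid_nonneg: "0 < T \<Longrightarrow> 0 < N \<Longrightarrow> 0 \<le> t \<Longrightarrow> 0 \<le> grid T N t"
  by (simp add: grid_def)

text \<open>The next node is strictly to the right of t even when t is itself a node, so
  right-continuity applies along these nodes.\<close>

lemma grid_next_at_right:
  assumes "0 < T"
  shows "filterlim (\<lambda>N. grid T (Suc N) t + T / real (Suc N)) (at_right t) sequentially"
  unfolding filterlim_at
proof (intro conjI always_eventually allI)
  fix N
  have "t < grid T (Suc N) t + T / real (Suc N)" by (rule grid_bounds(2)) (use assms in auto)
  then show "grid T (Suc N) t + T / real (Suc N) \<in> {t<..}" "grid T (Suc N) t + T / real (Suc N) \<noteq> t"
    by simp_all
next
  show "(\<lambda>N. grid T (Suc N) t + T / real (Suc N)) \<longlonglongrightarrow> t"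
  proof (rule tendsto_sandwich)
    show "\<forall>\<^sub>F N in sequentially. t \<le> grid T (Suc N) t + T / real (Suc N)"
      using grid_bounds(2)[OF assms] by (intro always_eventually allI less_imp_le) (simp del: of_nat_Suc)
    show "\<forall>\<^sub>F N in sequentially. grid T (Suc N) t + T / real (Suc N) \<le> t + T * inverse (real (Suc N))"
      using grid_bounds(1)[OF assms] by (intro always_eventually allI) (simp add: divide_inverse)
    show "(\<lambda>N. t + T * inverse (real (Suc N))) \<longlonglongrightarrow> t"
      using tendsto_add[OF tendsto_const tendsto_mult_left[OF LIMSEQ_inverse_real_of_nat]] by simp
  qed simp
qed

lemma continuous_grid_approx:
  fixes f :: "real \<Rightarrow> 'b::real_normed_vector"
  assumes "continuous_on {0..T} f" "0 < T" "0 < \<epsilon>"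
  obtains N where "0 < N" "\<And>t. t \<in> {0..T} \<Longrightarrow> norm (f (grid T N t) - f t) < \<epsilon>"
proof -
  have "uniformly_continuous_on {0..T} f" using assms(1) by (intro compact_uniformly_continuous) auto
  then obtain d where d: "0 < d" "\<And>t t'. t \<in> {0..T} \<Longrightarrow> t' \<in> {0..T} \<Longrightarrow> dist t' t < d \<Longrightarrow> dist (f t') (f t) < \<epsilon>"
    using assms(3) unfolding uniformly_continuous_on_def by metis
  obtain N where N: "T / d < real N" using reals_Archimedean2 by blast
  moreover have "0 < T / d" using d assms by simp
  ultimately have N0: "0 < N" by (metis less_trans of_nat_0_less_iff)
  have TN: "T / N < d" using N N0 d assms by (simp add: field_simps)
  show ?thesis
  proof
    show "0 < N" by fact
    fix t assume t: "t \<in> {0..T}"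
    have "dist (f (grid T N t)) (f t) < \<epsilon>"
      using grid_bounds[OF assms(2) N0, of t] grid_nonneg[OF assms(2) N0, of t] t TN
      by (intro d) (auto simp: dist_real_def)
    then show "norm (f (grid T N t) - f t) < \<epsilon>" by (simp add: dist_norm)
  qed
qed

lemma bounded_measurable_grid_approx:
  fixes f :: "real \<Rightarrow> real^'a::finite"
  assumes f: "bounded_measurable T f" and T: "0 < T"
  obtains p N B where "\<And>n. 0 < N n" "\<And>n t. t \<in> {0..T} \<Longrightarrow> norm (p n (grid T (N n) t)) \<le> B"
    "AE t in lebesgue_on {0..T}. (\<lambda>n. p n (grid T (N n) t)) \<longlonglongrightarrow> f t"
proof -
  obtain p B where p: "\<And>n. C1_on {0..T} (p n)" "\<And>n t. t \<in> {0..T} \<Longrightarrow> norm (p n t) \<le> B"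
    "AE t in lebesgue_on {0..T}. (\<lambda>n. p n t) \<longlonglongrightarrow> f t"
    by (rule bounded_measurable_C1_approx[OF f]) blast
  have "\<exists>N. 0 < N \<and> (\<forall>t\<in>{0..T}. norm (p n (grid T N t) - p n t) < 1 / Suc n)" for n
    by (rule continuous_grid_approx[OF C1_on_imp_continuous_on[OF p(1)[of n]] T, of "1 / Suc n"]) auto
  then obtain N where N: "\<And>n. 0 < N n" "\<And>n t. t \<in> {0..T} \<Longrightarrow> norm (p n (grid T (N n) t) - p n t) < 1 / Suc n"
    by metis
  show ?thesis
  proof
    show "0 < N n" for n by (rule N)
    show "norm (p n (grid T (N n) t)) \<le> B" if t: "t \<in> {0..T}" for n t
      using grid_bounds[OF T N(1)[of n], of t] grid_nonneg[OF T N(1)[of n], of t] t by (intro p(2)) auto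
    show "AE t in lebesgue_on {0..T}. (\<lambda>n. p n (grid T (N n) t)) \<longlonglongrightarrow> f t"
      using p(3) AE_space
    proof eventually_elim
      case (elim t)
      then have t: "t \<in> {0..T}" by (simp add: space_restrict_space)
      have "(\<lambda>n. p n (grid T (N n) t) - p n t) \<longlonglongrightarrow> 0"
        using N(2)[OF t] by (intro LIMSEQ_of_inverse_Suc_bound) (auto intro: less_imp_le)
      from tendsto_add[OF this elim(1)] show ?case by simp
    qed
  qed
qed

section \<open>Measurable choice among finitely many candidates\<close>

primrec best_index :: "(nat \<Rightarrow> 'b \<Rightarrow> real) \<Rightarrow> nat \<Rightarrow> 'b \<Rightarrow> nat" where
  "best_index \<Phi> 0 t = 0"
| "best_index \<Phi> (Suc N) t = (if \<Phi> (best_index \<Phi> N t) t < \<Phi> (Suc N) t then Suc N else best_index \<Phi> N t)"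

lemma best_index_le: "best_index \<Phi> N t \<le> N"
  by (induction N) auto

lemma best_index_max: "k \<le> N \<Longrightarrow> \<Phi> k t \<le> \<Phi> (best_index \<Phi> N t) t"
  by (induction N) (auto simp: le_Suc_eq intro: order_trans less_imp_le)

text \<open>The choice is recorded as an index: its values are countable, so measurability of the
  chosen value follows from that of the single candidates.\<close>

lemma best_index_measurable:
  assumes [measurable]: "\<And>k. \<Phi> k \<in> borel_measurable M"
  shows "best_index \<Phi> N \<in> measurable M (count_space UNIV)"
proof (induction N)
  case (Suc N)
  note [measurable] = Suc
  have [measurable]: "(\<lambda>t. \<Phi> (best_index \<Phi> N t) t) \<in> borel_measurable M"
    by (rule measurable_compose_countable[where f = \<Phi>]) measurable
  have "(\<lambda>t. if \<Phi> (best_index \<Phi> N t) t < \<Phi> (Suc N) t then Suc N else best_index \<Phi> N t) \<in>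
      measurable M (count_space UNIV)" by measurable
  then show ?case by (simp add: fun_eq_iff cong: measurable_cong)
next
  case 0
  have "(\<lambda>t. 0::nat) \<in> measurable M (count_space UNIV)" by simp
  then show ?case by (simp cong: measurable_cong)
qed

section \<open>The Young function and its growth\<close>

definition psi :: "real \<Rightarrow> real" where
  "psi u = ent (1 + \<bar>u\<bar>)"

lemma young_tau_psi: "young_tau u = ereal (psi u)"
  using tau_star_ent[of "1 + \<bar>u\<bar>"] by (simp add: psi_def)

lemma psi_nonneg [simp]: "0 \<le> psi u"
  by (simp add: psi_def ent_nonneg)

lemma psi_zero [simp]: "psi 0 = 0"
  by (simp add: psi_def ent_def)

lemma continuous_psi [continuous_intros]: "continuous_on S f \<Longrightarrow> continuous_on S (\<lambda>x. psi (f x))"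
  unfolding psi_def ent_def by (intro continuous_intros) (auto simp: add_nonneg_eq_0_iff)

lemma psi_measurable [measurable]: "psi \<in> borel_measurable borel"
  by (intro borel_measurable_continuous_onI continuous_psi continuous_on_id)

lemma ent_mono: "1 \<le> a \<Longrightarrow> a \<le> b \<Longrightarrow> ent a \<le> ent b"
proof (rule DERIV_nonneg_imp_nondecreasing[of a b ent])
  assume a: "1 \<le> a" "a \<le> b"
  then show "a \<le> b" by simp
  fix x assume "a \<le> x" "x \<le> b"
  then show "\<exists>y. DERIV ent x :> y \<and> 0 \<le> y"
    using a unfolding ent_def by (intro exI[of _ "ln x"]) (auto intro!: derivative_eq_intros)
qed

lemma psi_mono: "\<bar>a\<bar> \<le> \<bar>b\<bar> \<Longrightarrow> psi a \<le> psi b"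
  unfolding psi_def by (intro ent_mono) auto

text \<open>The absolute sum is at most twice the larger term, so monotonicity gives the
  bound.\<close>

lemma psi_add_le: "psi (a + b) \<le> psi (2 * a) + psi (2 * b)"
proof (cases "\<bar>a\<bar> \<le> \<bar>b\<bar>")
  case True
  then have "psi (a + b) \<le> psi (2 * b)" by (intro psi_mono) auto
  then show ?thesis using psi_nonneg[of "2 * a"] by linarith
next
  case False
  then have "psi (a + b) \<le> psi (2 * a)" by (intro psi_mono) auto
  then show ?thesis using psi_nonneg[of "2 * b"] by linarith
qed

text \<open>The doubling condition, by which modulars finite at one scale are finite at every scale.
  The derivative of the difference of the two sides at \<open>x \<ge> 0\<close> is
  \<open>c * (c * ln (1 + x) - ln (1 + c * x))\<close>, nonnegative by Bernoulli's inequality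
  \<open>1 + c * x \<le> (1 + x) powr c\<close>.\<close>

lemma psi_scale:
  assumes c: "1 \<le> c"
  shows "psi (c * u) \<le> c\<^sup>2 * psi u"
proof -
  define D where "D x = c\<^sup>2 * ((1 + x) * ln (1 + x) - x) - ((1 + c * x) * ln (1 + c * x) - c * x)" for x
  have "D 0 \<le> D \<bar>u\<bar>"
  proof (rule DERIV_nonneg_imp_nondecreasing[of 0 "\<bar>u\<bar>" D])
    fix x :: real assume x: "0 \<le> x"
    then have p: "0 < 1 + x" "0 < 1 + c * x" using c by (auto intro: add_pos_nonneg)
    have "1 + c * x \<le> (1 + x) powr c"
    proof -
      have "(\<lambda>y. (1 + y) powr c - c * y) 0 \<le> (\<lambda>y. (1 + y) powr c - c * y) x"
      proof (rule DERIV_nonneg_imp_nondecreasing[OF x])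
        fix y :: real assume y: "0 \<le> y"
        have "1 \<le> (1 + y) powr (c - 1)" using y c by (intro ge_one_powr_ge_zero) auto
        then have "0 \<le> c * (1 + y) powr (c - 1) - c" using c by (simp add: algebra_simps)
        moreover have "DERIV (\<lambda>y. (1 + y) powr c - c * y) y :> c * (1 + y) powr (c - 1) - c"
          using y by (auto intro!: derivative_eq_intros simp: powr_diff)
        ultimately show "\<exists>z. DERIV (\<lambda>y. (1 + y) powr c - c * y) y :> z \<and> 0 \<le> z" by blast
      qed
      then show ?thesis by simp
    qed
    then have "ln (1 + c * x) \<le> c * ln (1 + x)"
      using p by (metis ln_powr ln_le_cancel_iff powr_gt_zero less_irrefl)
    then have "0 \<le> c * (c * ln (1 + x) - ln (1 + c * x))" using c by simp
    moreover have "DERIV D x :> c * (c * ln (1 + x) - ln (1 + c * x))"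
    proof -
      have d: "DERIV (\<lambda>x. (1 + b * x) * ln (1 + b * x) - b * x) x :> b * ln (1 + b * x)" if "0 < 1 + b * x" for b
      proof -
        have "DERIV (\<lambda>x. (1 + b * x) * ln (1 + b * x) - b * x) x :>
            b * ln (1 + b * x) + (1 + b * x) * (b / (1 + b * x)) - b"
          using that by (auto intro!: derivative_eq_intros)
        then show ?thesis using that by simp
      qed
      have "DERIV D x :> c\<^sup>2 * (1 * ln (1 + 1 * x)) - c * ln (1 + c * x)"
        unfolding D_def using d[of 1] d[of c] p by (intro DERIV_diff DERIV_cmult) auto
      then show ?thesis by (simp add: power2_eq_square algebra_simps)
    qed
    ultimately show "\<exists>y. DERIV D x :> y \<and> 0 \<le> y" by blast
  qed simp
  then show ?thesis using c by (simp add: D_def psi_def ent_def abs_mult algebra_simps)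
qed

text \<open>The modular sees \<open>\<bar>h\<bar>\<close> while the cost sees h. They agree for
  \<open>0 \<le> h\<close>; on the rest \<open>psi h\<close> is at most
  \<open>psi 1 = 2 * ln 2 - 1\<close>, which the constant absorbs.\<close>

lemma psi_le_ent:
  assumes "-1 \<le> h"
  shows "psi h \<le> ent (1 + h) + 1"
proof (cases "0 \<le> h")
  case False
  then have "psi h \<le> psi 1" using assms by (intro psi_mono) auto
  also have "psi 1 \<le> 1" using ln2_le_25_over_36 by (simp add: psi_def ent_def)
  finally show ?thesis using ent_nonneg[of "1 + h"] assms by simp
qed (simp add: psi_def)

section \<open>The Orlicz norm and measurable maximisers\<close>

text \<open>A supremum of affine functions is lower semicontinuous: its superlevel sets are unions
  of open sets, whatever the function being dualised.\<close>

lemma convex_dual_measurable [measurable]: "convex_dual \<Phi> \<in> borel_measurable borel"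
proof (rule borel_measurableI_greater)
  fix c :: ereal
  have "{v. c < convex_dual \<Phi> v} = (\<Union>u. {v. c < ereal (u * v) - \<Phi> u})"
    by (auto simp: convex_dual_def less_SUP_iff mult.commute)
  moreover have "open {v. c < ereal (u * v) - \<Phi> u}" for u
  proof (cases "\<Phi> u")
    case (real y)
    have "open {v. c < ereal (u * v - y)}"
      by (intro open_Collect_less continuous_intros)
    then show ?thesis using real by simp
  qed auto
  ultimately show "{x \<in> space borel. c < convex_dual \<Phi> x} \<in> sets borel"
    by (simp add: open_UN)
qed

lemma Young_inequality_psi:
  assumes c: "0 < c"
  shows "ennreal \<bar>f * k\<bar> \<le> ennreal (1 / c) * (ennreal (psi (c * f)) + e2ennreal (convex_dual young_tau k))"
proof -
  \<comment> \<open>The sign is that of k, so that \<open>k * u\<close> becomes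
    \<open>c * \<bar>f * k\<bar>\<close>, while \<open>psi\<close> only sees
    \<open>\<bar>u\<bar>\<close>.\<close>
  define u where "u = sgn k * (c * \<bar>f\<bar>)"
  have uk: "k * u = c * \<bar>f * k\<bar>" by (simp add: u_def abs_mult abs_sgn[of k] algebra_simps)
  have psiu: "psi u \<le> psi (c * f)" using c by (intro psi_mono) (auto simp: u_def abs_mult sgn_if)
  have ge: "ereal (k * u) - young_tau u \<le> convex_dual young_tau k"
    unfolding convex_dual_def by (rule SUP_upper) simp
  have "ereal (k * 0) - young_tau 0 \<le> convex_dual young_tau k"
    unfolding convex_dual_def by (rule SUP_upper) simp
  then have nonneg: "0 \<le> convex_dual young_tau k" using young_tau_psi[of 0] by simp
  have "ennreal (c * \<bar>f * k\<bar>) \<le> ennreal (psi (c * f)) + e2ennreal (convex_dual young_tau k)"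
  proof (cases "convex_dual young_tau k")
    case (real y)
    then have "0 \<le> y" using nonneg by simp
    have "c * \<bar>f * k\<bar> \<le> psi (c * f) + y"
      using ge[unfolded real uk] young_tau_psi[of u] psiu by simp
    then have "ennreal (c * \<bar>f * k\<bar>) \<le> ennreal (psi (c * f) + y)" by (rule ennreal_leI)
    then show ?thesis using \<open>0 \<le> y\<close> by (simp add: real ennreal.abs_eq[symmetric] ennreal_plus e2ennreal_ereal)
  qed (use nonneg in auto)
  then have "ennreal (1 / c) * ennreal (c * \<bar>f * k\<bar>) \<le>
      ennreal (1 / c) * (ennreal (psi (c * f)) + e2ennreal (convex_dual young_tau k))"
    by (intro mult_left_mono) auto
  then show ?thesis using c by (simp add: ennreal_mult[symmetric])
qed

text \<open>Young's inequality is integrated over the dual unit ball: the modular of f and the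
  complementary modular of k contribute at most 1 each, whence the 2. A modular bound at a large
  scale c thereby becomes a small norm.\<close>

lemma orlicz_norm_le:
  assumes [measurable]: "f \<in> borel_measurable M" and c: "0 < c"
    and le: "(\<integral>\<^sup>+ s. ennreal (psi (c * f s)) \<partial>M) \<le> 1"
  shows "orlicz_norm M young_tau f \<le> ennreal (2 / c)"
  unfolding orlicz_norm_def
proof (rule SUP_least)
  fix k assume "k \<in> {k \<in> borel_measurable M. (\<integral>\<^sup>+ s. e2ennreal (convex_dual young_tau (k s)) \<partial>M) \<le> 1}"
  then have k [measurable]: "k \<in> borel_measurable M"
    and k1: "(\<integral>\<^sup>+ s. e2ennreal (convex_dual young_tau (k s)) \<partial>M) \<le> 1" by auto
  have [measurable]: "(\<lambda>s. convex_dual young_tau (k s)) \<in> borel_measurable M"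
    by (rule measurable_compose[OF k convex_dual_measurable])
  have "(\<integral>\<^sup>+ s. ennreal \<bar>f s * k s\<bar> \<partial>M) \<le>
      (\<integral>\<^sup>+ s. ennreal (1 / c) * (ennreal (psi (c * f s)) + e2ennreal (convex_dual young_tau (k s))) \<partial>M)"
    by (intro nn_integral_mono Young_inequality_psi c)
  also have "\<dots> = ennreal (1 / c) * ((\<integral>\<^sup>+ s. ennreal (psi (c * f s)) \<partial>M) +
      (\<integral>\<^sup>+ s. e2ennreal (convex_dual young_tau (k s)) \<partial>M))"
    by (simp add: nn_integral_cmult nn_integral_add)
  also have "\<dots> \<le> ennreal (1 / c) * (1 + 1)" by (intro mult_left_mono add_mono le k1) auto
  also have "\<dots> = ennreal (2 / c)"
    using c by (simp add: ennreal_mult[symmetric] flip: ennreal_numeral)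
  finally show "(\<integral>\<^sup>+ s. ennreal \<bar>f s * k s\<bar> \<partial>M) \<le> ennreal (2 / c)" .
qed

section \<open>Suprema over dense sets and pointwise maximisers\<close>

lemma measurable_pair_count_space_finite:
  assumes "finite E" and "\<And>e. e \<in> E \<Longrightarrow> (\<lambda>t. G (t, e)) \<in> measurable N K"
  shows "G \<in> measurable (N \<Otimes>\<^sub>M count_space E) K"
  using assms
  by (intro measurable_compose_countable'[where f = "\<lambda>e x. G (fst x, e)" and g = snd and I = E, simplified])
    (auto intro: countable_finite measurable_compose[OF measurable_fst])

lemma SUP_dense:
  fixes f :: "'b::topological_space \<Rightarrow> real"
  assumes f: "continuous_on UNIV f" and q: "\<And>U. open U \<Longrightarrow> U \<noteq> {} \<Longrightarrow> \<exists>k::nat. q k \<in> U"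
  shows "(SUP a. ereal (f a)) = (SUP k. ereal (f (q k)))"
proof (rule antisym)
  show "(SUP a. ereal (f a)) \<le> (SUP k. ereal (f (q k)))"
  proof (rule SUP_least, rule dense_le)
    fix a c assume "c < ereal (f a)"
    have "open {x. c < ereal (f x)}"
      using f by (intro open_Collect_less continuous_intros) auto
    with q[of "{x. c < ereal (f x)}"] \<open>c < ereal (f a)\<close> obtain k where "c < ereal (f (q k))" by blast
    then show "c \<le> (SUP k. ereal (f (q k)))" by (meson SUP_upper2 UNIV_I less_imp_le)
  qed
qed (auto intro: SUP_mono)

lemma continuous_on_gr [continuous_intros]: "continuous_on S f \<Longrightarrow> continuous_on S (\<lambda>x. gr (f x) e)"
  unfolding gr_def by (intro continuous_intros)

lemma continuous_on_obj: "continuous_on S (obj E r v)"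
  unfolding obj_def by (intro continuous_intros)

lemma obj_zero [simp]: "obj E r v 0 = 0"
  by (simp add: obj_def)

lemma borel_measurable_vec_nth' [measurable (raw)]:
  fixes f :: "'b \<Rightarrow> real^'n"
  assumes "f \<in> borel_measurable M" shows "(\<lambda>x. f x $ i) \<in> borel_measurable M"
  by (rule measurable_compose[OF assms borel_measurable_continuous_onI]) (intro continuous_intros)

lemma gr_measurable [measurable (raw)]:
  "f \<in> borel_measurable M \<Longrightarrow> (\<lambda>x. gr (f x) e) \<in> borel_measurable M"
  unfolding gr_def by (intro borel_measurable_diff borel_measurable_vec_nth')

lemma SUP_obj_nonneg: "0 \<le> (SUP a. ereal (obj E r v a))"
  by (rule SUP_upper2[of 0]) auto

lemma pointwise_maximizer:
  assumes irr: "irrefl E" "irreducible_digraph E" and pos: "\<And>e. e \<in> E \<Longrightarrow> 0 < r e"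
    and fin: "(SUP a. ereal (obj E r v a)) < \<infinity>"
  obtains a where "(SUP a. ereal (obj E r v a)) = ereal (obj E r v a)"
    "\<And>\<beta>. \<beta> \<bullet> v = (\<Sum>e\<in>E. r e * exp (gr a e) * gr \<beta> e)"
proof -
  obtain S where S: "(SUP a. ereal (obj E r v a)) = ereal S"
    using fin SUP_obj_nonneg[of E r v] by (cases "SUP a. ereal (obj E r v a)") auto
  have le: "obj E r v a \<le> S" for a
    using SUP_upper[of a UNIV "\<lambda>a. ereal (obj E r v a)"] S by simp
  have "\<exists>a. S - 1 / Suc n < obj E r v a" for n
  proof -
    have "ereal (S - 1 / Suc n) < (SUP a. ereal (obj E r v a))" unfolding S by simp
    then show ?thesis by (auto simp: less_SUP_iff)
  qed
  then obtain \<alpha> where \<alpha>: "\<And>n. S - 1 / Suc n < obj E r v (\<alpha> n)" by metis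
  have "(\<lambda>n. obj E r v (\<alpha> n)) \<longlonglongrightarrow> S"
    by (rule LIMSEQ_of_inverse_Suc_bound) (use \<alpha> le in \<open>auto simp: abs_le_iff less_imp_le diff_le_eq less_diff_eq algebra_simps\<close>)
  with le pos interpret maximizing_sequence E r v S \<alpha> by unfold_locales (auto intro: less_imp_le)
  obtain a where a: "obj E r v a = S" "\<And>e. e \<in> E \<Longrightarrow> w e = exp (gr a e)"
    using maximizer_exists[OF irr pos] by blast
  show ?thesis
    by (rule that[of a]) (use a S Euler_Lagrange in \<open>auto intro!: sum.cong\<close>)
qed

text \<open>Instantiated once for each chain. The bounds on the rates hold almost everywhere only,
  as \<open>m t\<close> is a probability vector only for almost every t.\<close>

locale flow_rates =
  fixes T :: real and E :: "('a::finite \<times> 'a) set" and r :: "real \<Rightarrow> 'a \<times> 'a \<Rightarrow> real" and C :: real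
  assumes T_pos: "0 < T"
    and r_meas: "\<And>e. e \<in> E \<Longrightarrow> (\<lambda>t. r t e) \<in> borel_measurable (lebesgue_on {0..T})"
    and r_bounds: "AE t in lebesgue_on {0..T}. \<forall>e\<in>E. 0 \<le> r t e \<and> r t e \<le> C"
begin

abbreviation L :: "real measure" where "L \<equiv> lebesgue_on {0..T}"

text \<open>Specialises to \<open>rho_X\<close> and \<open>rho_Y\<close> in the two
  instances.\<close>

definition M :: "(real \<times> 'a \<times> 'a) measure" where
  "M = density (L \<Otimes>\<^sub>M count_space E) (\<lambda>(t, e). ennreal (r t e))"

lemma sum_meas [measurable (raw)]:
  fixes f :: "'b \<Rightarrow> 'a \<times> 'a \<Rightarrow> 'c::{second_countable_topology,topological_comm_monoid_add}"
  assumes "\<And>e. e \<in> E \<Longrightarrow> (\<lambda>x. f x e) \<in> borel_measurable N"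
  shows "(\<lambda>x. \<Sum>e\<in>E. f x e) \<in> borel_measurable N"
  using assms by (rule borel_measurable_sum)

lemma finite_L: "finite_measure L"
  by (rule finite_measure_lebesgue_on) simp

lemma sets_M: "sets M = sets (L \<Otimes>\<^sub>M count_space E)"
  by (simp add: M_def)

lemma measurable_M:
  assumes "\<And>e. e \<in> E \<Longrightarrow> (\<lambda>t. G (t, e)) \<in> borel_measurable L"
  shows "G \<in> borel_measurable M"
  using measurable_pair_count_space_finite[of E G L borel, OF finite assms]
  by (simp cong: measurable_cong_sets add: sets_M)

lemma nn_integral_M:
  assumes G: "\<And>e. e \<in> E \<Longrightarrow> (\<lambda>t. G (t, e)) \<in> borel_measurable L"
  shows "(\<integral>\<^sup>+ s. G s \<partial>M) = (\<integral>\<^sup>+ t. (\<Sum>e\<in>E. ennreal (r t e) * G (t, e)) \<partial>L)"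
proof -
  interpret cs: sigma_finite_measure "count_space E" by (rule sigma_finite_measure_count_space_finite) simp
  have [measurable]: "G \<in> borel_measurable (L \<Otimes>\<^sub>M count_space E)"
    by (rule measurable_pair_count_space_finite) (use G in auto)
  have [measurable]: "(\<lambda>(t, e). ennreal (r t e)) \<in> borel_measurable (L \<Otimes>\<^sub>M count_space E)"
    by (rule measurable_pair_count_space_finite) (use r_meas in auto)
  have "(\<integral>\<^sup>+ s. G s \<partial>M) = (\<integral>\<^sup>+ s. (\<lambda>(t, e). ennreal (r t e)) s * G s \<partial>(L \<Otimes>\<^sub>M count_space E))"
    unfolding M_def by (rule nn_integral_density) measurable
  also have "\<dots> = (\<integral>\<^sup>+ t. \<integral>\<^sup>+ e. (\<lambda>(t, e). ennreal (r t e)) (t, e) * G (t, e) \<partial>count_space E \<partial>L)"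
    by (rule cs.nn_integral_fst[symmetric]) measurable
  also have "\<dots> = (\<integral>\<^sup>+ t. (\<Sum>e\<in>E. ennreal (r t e) * G (t, e)) \<partial>L)"
    by (simp add: nn_integral_count_space_finite)
  finally show ?thesis .
qed

lemma maximizing_paths:
  assumes v [measurable]: "v \<in> borel_measurable L"
  obtains \<alpha> where "\<And>N. bounded_measurable T (\<alpha> N)"
    "\<And>t. incseq (\<lambda>N. obj E (r t) (v t) (\<alpha> N t))"
    "\<And>t. (SUP a. ereal (obj E (r t) (v t) a)) = (SUP N. ereal (obj E (r t) (v t) (\<alpha> N t)))"
    "\<And>N t. 0 \<le> obj E (r t) (v t) (\<alpha> N t)"
proof -
  obtain D :: "(real^'a) set" where D: "countable D" "\<And>X. open X \<Longrightarrow> X \<noteq> {} \<Longrightarrow> \<exists>d\<in>D. d \<in> X"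
    using countable_dense_exists by blast
  then have "D \<noteq> {}" by blast
  \<comment> \<open>The zero vector heads the dense sequence: every best candidate then has
    nonnegative value, so the values can be integrated in \<open>ennreal\<close> by monotone
    convergence.\<close>
  define q where "q k = (case k of 0 \<Rightarrow> 0 | Suc k \<Rightarrow> from_nat_into D k)" for k
  have q0: "q 0 = 0" by (simp add: q_def)
  have q: "\<exists>k. q k \<in> U" if U: "open U" "U \<noteq> {}" for U
  proof -
    obtain d where "d \<in> D" "d \<in> U" using D(2)[OF U] by blast
    then have "q (Suc (to_nat_on D d)) \<in> U" using D(1) by (simp add: q_def)
    then show ?thesis by blast
  qed
  define \<Phi> where "\<Phi> k t = obj E (r t) (v t) (q k)" for k t
  define \<alpha> where "\<alpha> N t = q (best_index \<Phi> N t)" for N t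
  note r_meas [measurable]
  have \<Phi>_meas: "\<Phi> k \<in> borel_measurable L" for k
    unfolding \<Phi>_def obj_def by measurable
  have eq: "obj E (r t) (v t) (\<alpha> N t) = \<Phi> (best_index \<Phi> N t) t" for N t by (simp add: \<Phi>_def \<alpha>_def)
  have max: "\<Phi> k t \<le> obj E (r t) (v t) (\<alpha> N t)" if "k \<le> N" for k N t
    unfolding eq by (rule best_index_max) (rule that)
  show ?thesis
  proof
    show "bounded_measurable T (\<alpha> N)" for N
      unfolding bounded_measurable_def
    proof
      show "\<alpha> N \<in> borel_measurable L"
        unfolding \<alpha>_def by (rule measurable_compose[OF best_index_measurable[OF \<Phi>_meas]]) simp
      have "\<alpha> N ` {0..T} \<subseteq> q ` {..N}"
        by (intro image_subsetI) (simp add: \<alpha>_def best_index_le)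
      then show "bounded (\<alpha> N ` {0..T})" by (rule finite_imp_bounded[OF finite_subset]) simp
    qed
    show "incseq (\<lambda>N. obj E (r t) (v t) (\<alpha> N t))" for t
    proof (rule incseq_SucI)
      fix N show "obj E (r t) (v t) (\<alpha> N t) \<le> obj E (r t) (v t) (\<alpha> (Suc N) t)"
        unfolding eq[of t N] by (rule max) (rule le_SucI[OF best_index_le])
    qed
    show "0 \<le> obj E (r t) (v t) (\<alpha> N t)" for N t
      using max[of 0 N t] by (simp add: \<Phi>_def q0)
    show "(SUP a. ereal (obj E (r t) (v t) a)) = (SUP N. ereal (obj E (r t) (v t) (\<alpha> N t)))" for t
    proof (rule antisym)
      have "(SUP a. ereal (obj E (r t) (v t) a)) = (SUP k. ereal (\<Phi> k t))"
        unfolding \<Phi>_def by (rule SUP_dense[OF continuous_on_obj q])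
      also have "\<dots> \<le> (SUP N. ereal (obj E (r t) (v t) (\<alpha> N t)))"
        by (rule SUP_mono) (use max in auto)
      finally show "(SUP a. ereal (obj E (r t) (v t) a)) \<le> (SUP N. ereal (obj E (r t) (v t) (\<alpha> N t)))" .
    qed (auto intro: SUP_mono)
  qed
qed

lemma SUP_obj_measurable:
  assumes v [measurable]: "v \<in> borel_measurable L"
  shows "(\<lambda>t. SUP a. ereal (obj E (r t) (v t) a)) \<in> borel_measurable L"
proof -
  note r_meas [measurable]
  obtain \<alpha> where \<alpha>_bm: "\<And>N. bounded_measurable T (\<alpha> N)"
    and "\<And>t. incseq (\<lambda>N. obj E (r t) (v t) (\<alpha> N t))"
    and \<alpha>: "\<And>t. (SUP a. ereal (obj E (r t) (v t) a)) = (SUP N. ereal (obj E (r t) (v t) (\<alpha> N t)))"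
    and "\<And>N t. 0 \<le> obj E (r t) (v t) (\<alpha> N t)"
    by (rule maximizing_paths[OF v]) blast
  have [measurable]: "\<alpha> N \<in> borel_measurable L" for N using \<alpha>_bm by (simp add: bounded_measurable_def)
  show ?thesis unfolding \<alpha> unfolding obj_def by measurable
qed

definition J :: "(real \<Rightarrow> real^'a) \<Rightarrow> ennreal" where
  "J v = (\<integral>\<^sup>+ t. e2ennreal (SUP a. ereal (obj E (r t) (v t) a)) \<partial>L)"

end

section \<open>Optimal flows and their approximation\<close>

lemma tendsto_psi [tendsto_intros]: "(f \<longlongrightarrow> a) F \<Longrightarrow> ((\<lambda>x. psi (f x)) \<longlongrightarrow> psi a) F"
  by (rule continuous_on_tendsto_compose[of UNIV psi]) (auto intro: continuous_psi continuous_on_id)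

lemma tendsto_gr [tendsto_intros]: "(f \<longlongrightarrow> a) F \<Longrightarrow> ((\<lambda>x. gr (f x) e) \<longlongrightarrow> gr a e) F"
  unfolding gr_def by (intro tendsto_intros)

context flow_rates
begin

lemma integrable_const_L: "integrable L (\<lambda>t. c :: real)"
  by (rule finite_measure.integrable_const[OF finite_L])

lemma C1_measurable: "C1_on {0..T} p \<Longrightarrow> p \<in> borel_measurable L"
  by (intro continuous_imp_measurable_on_sets_lebesgue C1_on_imp_continuous_on) auto

text \<open>Integrand in time of the Orlicz modular of c times the distance from h to the function
  generated by the potential a; for \<open>a = 0\<close> it is the modular of
  \<open>c * h\<close>.\<close>

definition modular :: "(real \<times> 'a \<times> 'a \<Rightarrow> real) \<Rightarrow> real \<Rightarrow> real \<Rightarrow> real^'a \<Rightarrow> real" where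
  "modular h c t a = (\<Sum>e\<in>E. r t e * psi (c * (h (t, e) - (exp (gr a e) - 1))))"

lemma modular_measurable:
  assumes [measurable]: "\<And>e. e \<in> E \<Longrightarrow> (\<lambda>t. h (t, e)) \<in> borel_measurable L" "f \<in> borel_measurable L"
  shows "(\<lambda>t. modular h c t (f t)) \<in> borel_measurable L"
proof -
  note r_meas [measurable]
  show ?thesis unfolding modular_def by measurable
qed

lemma modular_nonneg: "\<forall>e\<in>E. 0 \<le> r t e \<and> r t e \<le> C \<Longrightarrow> 0 \<le> modular h c t a"
  unfolding modular_def by (intro sum_nonneg mult_nonneg_nonneg) auto

text \<open>Domination for bounded controls: \<open>psi_add_le\<close> separates h from the
  exponential at the price of doubling the scale, and \<open>\<bar>gr a e\<bar> \<le> 2 * B\<close>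
  bounds the exponential part by a constant.\<close>

lemma modular_le:
  assumes r: "\<forall>e\<in>E. 0 \<le> r t e \<and> r t e \<le> C" and a: "norm a \<le> B" and c: "1 \<le> c"
  shows "modular h c t a \<le> modular h (2 * c) t 0 + card E * (C * psi (2 * (c * (exp (2 * B) + 1))))"
proof -
  have "r t e * psi (c * (h (t, e) - (exp (gr a e) - 1))) \<le>
      r t e * psi (2 * c * (h (t, e) - (exp (gr 0 e) - 1))) + C * psi (2 * (c * (exp (2 * B) + 1)))"
    if e: "e \<in> E" for e
  proof -
    have "\<bar>gr a e\<bar> \<le> 2 * B" using gr_bound[of a e] a by simp
    then have "exp (gr a e) \<le> exp (2 * B)" by simp
    then have "\<bar>- (exp (gr a e) - 1)\<bar> \<le> \<bar>exp (2 * B) + 1\<bar>"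
      using exp_gt_zero[of "gr a e"] by linarith
    then have "\<bar>c * - (exp (gr a e) - 1)\<bar> \<le> \<bar>c * (exp (2 * B) + 1)\<bar>"
      unfolding abs_mult by (rule mult_left_mono) simp
    then have *: "psi (2 * (c * - (exp (gr a e) - 1))) \<le> psi (2 * (c * (exp (2 * B) + 1)))"
      by (intro psi_mono) (simp add: abs_mult)
    have "psi (c * (h (t, e) - (exp (gr a e) - 1))) =
        psi (c * h (t, e) + c * - (exp (gr a e) - 1))" by (simp add: algebra_simps)
    also have "\<dots> \<le> psi (2 * (c * h (t, e))) + psi (2 * (c * - (exp (gr a e) - 1)))" by (rule psi_add_le)
    also have "\<dots> \<le> psi (2 * c * h (t, e)) + psi (2 * (c * (exp (2 * B) + 1)))" using * by (simp add: mult.assoc)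
    finally have "r t e * psi (c * (h (t, e) - (exp (gr a e) - 1))) \<le>
        r t e * (psi (2 * c * h (t, e)) + psi (2 * (c * (exp (2 * B) + 1))))"
      using r e by (intro mult_left_mono) auto
    moreover have "r t e * psi (2 * (c * (exp (2 * B) + 1))) \<le> C * psi (2 * (c * (exp (2 * B) + 1)))"
      using r e by (intro mult_right_mono) auto
    ultimately show ?thesis by (simp add: distrib_left)
  qed
  then have "modular h c t a \<le> (\<Sum>e\<in>E. r t e * psi (2 * c * (h (t, e) - (exp (gr 0 e) - 1))) +
      C * psi (2 * (c * (exp (2 * B) + 1))))"
    unfolding modular_def by (rule sum_mono)
  then show ?thesis by (simp add: modular_def sum.distrib)
qed

lemma modular_tendsto:
  assumes "f \<longlonglongrightarrow> a"
  shows "(\<lambda>n. modular h c t (f n)) \<longlonglongrightarrow> modular h c t a"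
  unfolding modular_def by (intro tendsto_intros assms)

lemma flow_optimum:
  assumes v [measurable]: "v \<in> borel_measurable L"
    and fin: "J v < \<infinity>"
  obtains h where "h \<in> H_closure T M" "\<And>e. e \<in> E \<Longrightarrow> (\<lambda>t. h (t, e)) \<in> borel_measurable L"
    "AE t in L. \<forall>\<beta>. \<beta> \<bullet> v t = (\<Sum>e\<in>E. r t e * (1 + h (t, e)) * gr \<beta> e)"
    "J v = (\<integral>\<^sup>+ t. (\<Sum>e\<in>E. e2ennreal (tau_star (h (t, e))) * ennreal (r t e)) \<partial>L)"
proof -
  note r_meas [measurable]
  obtain \<alpha> where \<alpha>: "\<And>N. bounded_measurable T (\<alpha> N)"
    "\<And>t. incseq (\<lambda>N. obj E (r t) (v t) (\<alpha> N t))"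
    "\<And>t. (SUP a. ereal (obj E (r t) (v t) a)) = (SUP N. ereal (obj E (r t) (v t) (\<alpha> N t)))"
    "\<And>N t. 0 \<le> obj E (r t) (v t) (\<alpha> N t)"
    by (rule maximizing_paths[OF v]) blast
  have [measurable]: "\<alpha> N \<in> borel_measurable L" for N using \<alpha>(1) by (simp add: bounded_measurable_def)
  define SE where "SE t = (SUP N. ereal (obj E (r t) (v t) (\<alpha> N t)))" for t
  have SE: "(SUP a. ereal (obj E (r t) (v t) a)) = SE t" for t unfolding SE_def by (rule \<alpha>(3))
  have SE_nonneg: "0 \<le> SE t" for t using SUP_obj_nonneg[of E "r t" "v t"] by (simp add: SE)
  have SE_meas [measurable]: "SE \<in> borel_measurable L"
    unfolding SE_def obj_def by measurable
  define S where "S t = real_of_ereal (SE t)" for t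
  have S_meas [measurable]: "S \<in> borel_measurable L" unfolding S_def by measurable
  \<comment> \<open>The \<open>w - 1\<close> of the fixed-time problem, written as an explicit limit
    so that measurability in t can be read off; edges without rate get the value 0.\<close>
  define h where "h s = (if 0 < r (fst s) (snd s) then lim (\<lambda>n. exp (gr (\<alpha> n (fst s)) (snd s))) else 1) - 1" for s
  define good where "good t \<longleftrightarrow> (\<forall>e\<in>E. 0 \<le> r t e \<and> r t e \<le> C) \<and> SE t < \<infinity>" for t
  have "AE t in L. e2ennreal (SE t) \<noteq> \<infinity>"
    using fin unfolding J_def SE by (intro nn_integral_PInf_AE) auto
  then have good: "AE t in L. good t"
    using r_bounds
  proof eventually_elim
    case (elim t)
    then have "SE t \<noteq> \<infinity>" by auto
    with elim show ?case by (auto simp: good_def)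
  qed
  have S: "SE t = ereal (S t)" if "good t" for t
    using that SE_nonneg[of t] by (cases "SE t") (auto simp: S_def good_def)
  have S_nonneg: "0 \<le> S t" for t using SE_nonneg[of t] by (simp add: S_def real_of_ereal_pos)
  have ms: "maximizing_sequence E (r t) (v t) (S t) (\<lambda>n. \<alpha> n t)" if g: "good t" for t
  proof
    show "0 \<le> r t e" if "e \<in> E" for e using g that by (auto simp: good_def)
    show "obj E (r t) (v t) a \<le> S t" for a
      using SUP_upper[of a UNIV "\<lambda>a. ereal (obj E (r t) (v t) a)"] S[OF g] SE[of t] by simp
    have "(\<lambda>N. ereal (obj E (r t) (v t) (\<alpha> N t))) \<longlonglongrightarrow> SE t"
      unfolding SE_def using \<alpha>(2)[of t] by (intro LIMSEQ_SUP) (auto simp: incseq_def)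
    then show "(\<lambda>N. obj E (r t) (v t) (\<alpha> N t)) \<longlonglongrightarrow> S t" by (simp add: S[OF g])
  qed
  have hw: "1 + h (t, e) = maximizing_sequence.w (r t) (\<lambda>n. \<alpha> n t) e" if "good t" for t e
    by (simp add: h_def maximizing_sequence.w_def[OF ms[OF that]])
  have h_meas: "(\<lambda>t. h (t, e)) \<in> borel_measurable L" if [measurable]: "e \<in> E" for e
    unfolding h_def fst_conv snd_conv using that by measurable
  note [measurable] = h_meas
  have h_ge: "-1 \<le> h (t, e)" if "good t" "e \<in> E" for t e
    using maximizing_sequence.w_nonneg[OF ms[OF that(1)] that(2)] hw[OF that(1), of e] by simp
  have EL: "\<beta> \<bullet> v t = (\<Sum>e\<in>E. r t e * (1 + h (t, e)) * gr \<beta> e)" if "good t" for t \<beta>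
    using maximizing_sequence.Euler_Lagrange[OF ms[OF that]] by (simp add: hw[OF that])
  have S_eq: "S t = (\<Sum>e\<in>E. r t e * ent (1 + h (t, e)))" if "good t" for t
    using maximizing_sequence.S_eq[OF ms[OF that]] by (simp add: hw[OF that])

  have S_int: "integrable L S"
  proof (rule integrableI_nonneg)
    have "(\<integral>\<^sup>+ t. ennreal (S t) \<partial>L) = (\<integral>\<^sup>+ t. e2ennreal (SE t) \<partial>L)"
      by (rule nn_integral_cong_AE, rule AE_mp[OF good], rule AE_I2) (simp add: S e2ennreal_ereal)
    then show "(\<integral>\<^sup>+ t. ennreal (S t) \<partial>L) < \<infinity>" using fin by (simp add: J_def SE)
  qed (use S_nonneg in auto)

  \<comment> \<open>\<open>psi_scale\<close> removes the factor c and \<open>psi_le_ent\<close>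
    compares with the entropy cost, whose edge sum is \<open>S t\<close>; its additive 1, weighted
    by rates of at most C, produces \<open>card E * C\<close>. So h has an integrable modular at
    every scale.\<close>
  have mod0: "modular h c t 0 \<le> c\<^sup>2 * (S t + card E * C)" if c: "1 \<le> c" and g: "good t" for c t
  proof -
    have "r t e * psi (c * (h (t, e) - (exp (gr 0 e) - 1))) \<le> c\<^sup>2 * (r t e * ent (1 + h (t, e)) + C)"
      if e: "e \<in> E" for e
    proof -
      have re: "0 \<le> r t e" "r t e \<le> C" using g e by (auto simp: good_def)
      have "psi (c * h (t, e)) \<le> c\<^sup>2 * psi (h (t, e))" by (rule psi_scale[OF c])
      also have "\<dots> \<le> c\<^sup>2 * (ent (1 + h (t, e)) + 1)"
        by (intro mult_left_mono psi_le_ent h_ge g e) auto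
      finally have "r t e * psi (c * h (t, e)) \<le> r t e * (c\<^sup>2 * (ent (1 + h (t, e)) + 1))"
        using re by (intro mult_left_mono)
      also have "\<dots> = c\<^sup>2 * (r t e * ent (1 + h (t, e)) + r t e)" by (simp add: algebra_simps)
      also have "\<dots> \<le> c\<^sup>2 * (r t e * ent (1 + h (t, e)) + C)" using re by (intro mult_left_mono) auto
      finally show ?thesis by simp
    qed
    then have "modular h c t 0 \<le> (\<Sum>e\<in>E. c\<^sup>2 * (r t e * ent (1 + h (t, e)) + C))"
      unfolding modular_def by (rule sum_mono)
    also have "\<dots> = c\<^sup>2 * (S t + card E * C)"
      by (simp add: S_eq[OF g] sum.distrib sum_distrib_left[symmetric])
    finally show ?thesis .
  qed
  have mod0_int: "integrable L (\<lambda>t. modular h c t 0)" if c: "1 \<le> c" for c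
  proof (rule Bochner_Integration.integrable_bound)
    show "integrable L (\<lambda>t. c\<^sup>2 * (S t + card E * C))"
      by (intro integrable_mult_right Bochner_Integration.integrable_add S_int integrable_const_L)
    show "(\<lambda>t. modular h c t 0) \<in> borel_measurable L" by (rule modular_measurable) auto
    show "AE t in L. norm (modular h c t 0) \<le> norm (c\<^sup>2 * (S t + card E * C))"
      using good
    proof eventually_elim
      case (elim t)
      have "0 \<le> modular h c t 0" by (rule modular_nonneg) (use elim in \<open>simp add: good_def\<close>)
      then show ?case using mod0[OF c elim] by simp
    qed
  qed

  \<comment> \<open>The zero control is the first candidate, so the modular of the best one is dominated by the integrable
    function \<open>modular h c t 0\<close>.\<close>
  have approx: "\<exists>p. C1_on {0..T} p \<and> integrable L (\<lambda>t. modular h c t (p t)) \<and> (LINT t|L. modular h c t (p t)) < 1"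
    if c: "1 \<le> c" for c
  proof -
    define cand where "cand k t = (case k of 0 \<Rightarrow> 0 | Suc n \<Rightarrow> \<alpha> n t)" for k t
    have cand_bm: "bounded_measurable T (cand k)" for k
      by (cases k) (auto simp: cand_def[abs_def] \<alpha>(1), auto simp: bounded_measurable_def image_constant_conv)
    then have cand_meas [measurable]: "cand k \<in> borel_measurable L" for k
      by (simp add: bounded_measurable_def)
    \<comment> \<open>Negated, since \<open>best_index\<close> maximises and the modular is to be
      small. The criterion is closeness to h, not the value of the objective.\<close>
    define \<Phi> where "\<Phi> k t = - modular h c t (cand k t)" for k t
    have \<Phi>_meas [measurable]: "\<Phi> k \<in> borel_measurable L" for k
      unfolding \<Phi>_def by (intro borel_measurable_uminus modular_measurable) auto
    define \<beta> where "\<beta> N t = cand (best_index \<Phi> N t) t" for N t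
    have \<beta>_le: "modular h c t (\<beta> N t) \<le> modular h c t (cand k t)" if "k \<le> N" for k N t
      using best_index_max[OF that, of \<Phi> t] by (simp add: \<Phi>_def \<beta>_def)
    have \<beta>_meas [measurable]: "\<beta> N \<in> borel_measurable L" for N
      unfolding \<beta>_def
      by (rule measurable_compose_countable[where f = cand, OF cand_meas best_index_measurable[OF \<Phi>_meas]])
    have \<beta>_bm: "bounded_measurable T (\<beta> N)" for N
    proof -
      have "\<beta> N ` {0..T} \<subseteq> (\<Union>k\<in>{..N}. cand k ` {0..T})"
        by (intro image_subsetI UN_I[of "best_index \<Phi> N _"]) (auto simp: \<beta>_def best_index_le)
      moreover have "bounded (\<Union>k\<in>{..N}. cand k ` {0..T})"
        using cand_bm by (intro bounded_UN) (auto simp: bounded_measurable_def)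
      ultimately have "bounded (\<beta> N ` {0..T})" by (rule bounded_subset[rotated])
      then show ?thesis by (simp add: bounded_measurable_def)
    qed
    have \<beta>0: "AE t in L. (\<lambda>N. modular h c t (\<beta> N t)) \<longlonglongrightarrow> 0"
      using good
    proof eventually_elim
      case (elim t)
      interpret m: maximizing_sequence E "r t" "v t" "S t" "\<lambda>n. \<alpha> n t" by (rule ms[OF elim])
      have "(\<lambda>n. r t e * psi (c * (h (t, e) - (exp (gr (\<alpha> n t) e) - 1)))) \<longlonglongrightarrow> 0" if e: "e \<in> E" for e
      proof (cases "r t e = 0")
        case False
        with e elim have "0 < r t e" by (auto simp: good_def less_eq_real_def)
        from m.w_tendsto[OF e this] have "(\<lambda>n. exp (gr (\<alpha> n t) e)) \<longlonglongrightarrow> 1 + h (t, e)"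
          by (simp add: hw[OF elim])
        then have "(\<lambda>n. r t e * psi (c * (h (t, e) - (exp (gr (\<alpha> n t) e) - 1)))) \<longlonglongrightarrow>
            r t e * psi (c * (h (t, e) - (1 + h (t, e) - 1)))" by (intro tendsto_intros)
        then show ?thesis by simp
      qed simp
      then have "(\<lambda>n. modular h c t (\<alpha> n t)) \<longlonglongrightarrow> 0"
        unfolding modular_def by (rule tendsto_null_sum)
      then have "(\<lambda>n. modular h c t (cand (Suc n) t)) \<longlonglongrightarrow> 0" by (simp add: cand_def)
      then have "(\<lambda>n. modular h c t (cand n t)) \<longlonglongrightarrow> 0"
        by (subst (asm) filterlim_sequentially_Suc)
      then show ?case
      proof (rule Lim_null_comparison[rotated])
        show "\<forall>\<^sub>F n in sequentially. norm (modular h c t (\<beta> n t)) \<le> modular h c t (cand n t)"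
          using \<beta>_le elim modular_nonneg[of t h c] by (intro always_eventually) (simp add: good_def)
      qed
    qed
    have "(\<lambda>N. LINT t|L. modular h c t (\<beta> N t)) \<longlonglongrightarrow> (LINT t|L. 0)"
    proof (rule integral_dominated_convergence)
      show "integrable L (\<lambda>t. modular h c t 0)" by (rule mod0_int[OF c])
      show "AE t in L. norm (modular h c t (\<beta> N t)) \<le> modular h c t 0" for N
        using good
      proof eventually_elim
        case (elim t)
        then show ?case using \<beta>_le[of 0 N t] modular_nonneg[of t h c] by (simp add: good_def cand_def)
      qed
      show "(\<lambda>t. modular h c t (\<beta> N t)) \<in> borel_measurable L" for N by (rule modular_measurable) auto
    qed (use \<beta>0 in auto)
    then have "\<forall>\<^sub>F N in sequentially. (LINT t|L. modular h c t (\<beta> N t)) < 1"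
      by (intro order_tendstoD(2)) auto
    then obtain N where N: "(LINT t|L. modular h c t (\<beta> N t)) < 1" by (auto simp: eventually_sequentially)
    obtain p B where p: "\<And>n. C1_on {0..T} (p n)" "\<And>n t. t \<in> {0..T} \<Longrightarrow> norm (p n t) \<le> B"
      "AE t in L. (\<lambda>n. p n t) \<longlonglongrightarrow> \<beta> N t"
      by (rule bounded_measurable_C1_approx[OF \<beta>_bm[of N]]) blast
    have p_meas [measurable]: "p n \<in> borel_measurable L" for n by (rule C1_measurable[OF p(1)])
    \<comment> \<open>N is fixed by now, so B bounds all approximants at once and W dominates their
      modulars; the scale \<open>2 * c\<close> comes from \<open>modular_le\<close>.\<close>
    define W where "W t = modular h (2 * c) t 0 + card E * (C * psi (2 * (c * (exp (2 * B) + 1))))" for t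
    have W: "integrable L W"
      unfolding W_def using c by (intro Bochner_Integration.integrable_add integrable_const_L mod0_int) auto
    have bd: "AE t in L. norm (modular h c t (p n t)) \<le> W t" for n
      using good AE_space
    proof eventually_elim
      case (elim t)
      then have rt: "\<forall>e\<in>E. 0 \<le> r t e \<and> r t e \<le> C" and t: "t \<in> {0..T}"
        by (auto simp: good_def space_restrict_space)
      show ?case using modular_nonneg[OF rt] modular_le[OF rt p(2)[OF t] c] by (simp add: W_def)
    qed
    have lim: "AE t in L. (\<lambda>n. modular h c t (p n t)) \<longlonglongrightarrow> modular h c t (\<beta> N t)"
      using p(3) by eventually_elim (rule modular_tendsto)
    have ms: "(\<lambda>t. modular h c t (\<beta> N t)) \<in> borel_measurable L" "(\<lambda>t. modular h c t (p n t)) \<in> borel_measurable L" for n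
      by (rule modular_measurable; simp)+
    have "(\<lambda>n. LINT t|L. modular h c t (p n t)) \<longlonglongrightarrow> (LINT t|L. modular h c t (\<beta> N t))"
      by (rule integral_dominated_convergence[OF ms W lim bd])
    then have "\<forall>\<^sub>F n in sequentially. (LINT t|L. modular h c t (p n t)) < 1"
      using N by (rule order_tendstoD(2))
    then obtain n where "(LINT t|L. modular h c t (p n t)) < 1" by (auto simp: eventually_sequentially)
    moreover have "integrable L (\<lambda>t. modular h c t (p n t))"
      using bd[of n] by (intro Bochner_Integration.integrable_bound[OF W ms(2)]) (auto elim!: eventually_mono)
    ultimately show ?thesis using p(1) by blast
  qed

  have h_orlicz: "h \<in> orlicz_space M young_tau"
    unfolding orlicz_space_def
  proof (intro CollectI conjI exI[of _ 1])
    show "h \<in> borel_measurable M" by (rule measurable_M) (rule h_meas)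
    have "(\<integral>\<^sup>+ s. e2ennreal (young_tau (1 * h s)) \<partial>M) = (\<integral>\<^sup>+ s. ennreal (psi (h s)) \<partial>M)"
      using young_tau_psi by (simp add: e2ennreal_ereal)
    also have "\<dots> = (\<integral>\<^sup>+ t. (\<Sum>e\<in>E. ennreal (r t e) * ennreal (psi (h (t, e)))) \<partial>L)"
      by (rule nn_integral_M) measurable
    also have "\<dots> = (\<integral>\<^sup>+ t. ennreal (modular h 1 t 0) \<partial>L)"
      by (rule nn_integral_cong_AE, rule AE_mp[OF good], rule AE_I2)
        (auto simp: modular_def good_def ennreal_mult[symmetric] intro!: sum_ennreal)
    also have "\<dots> = ennreal (LINT t|L. modular h 1 t 0)"
      by (rule nn_integral_eq_integral[OF mod0_int], simp, rule AE_mp[OF good], rule AE_I2)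
        (simp add: good_def modular_nonneg)
    finally show "(\<integral>\<^sup>+ s. e2ennreal (young_tau (1 * h s)) \<partial>M) < \<infinity>" by simp
  qed simp
  have h_closure: "h \<in> H_closure T M"
    unfolding H_closure_def
  proof (intro CollectI conjI h_orlicz allI impI)
    fix \<epsilon> :: real assume "0 < \<epsilon>"
    \<comment> \<open>\<open>4 / \<epsilon>\<close> leaves a factor 2 to spare in the bound
      \<open>2 / c\<close> of \<open>orlicz_norm_le\<close>; the maximum with 1 meets the condition
      of \<open>approx\<close>.\<close>
    define c where "c = max 1 (4 / \<epsilon>)"
    have c: "1 \<le> c" "2 / c < \<epsilon>" using \<open>0 < \<epsilon>\<close> by (auto simp: c_def field_simps max_def)
    obtain p where p: "C1_on {0..T} p" "integrable L (\<lambda>t. modular h c t (p t))"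
      "(LINT t|L. modular h c t (p t)) < 1" using approx[OF c(1)] by blast
    have p_meas [measurable]: "p \<in> borel_measurable L" by (rule C1_measurable[OF p(1)])
    define f where "f s = h s - (exp (gr (p (fst s)) (snd s)) - 1)" for s
    have f_meas: "(\<lambda>t. f (t, e)) \<in> borel_measurable L" if [measurable]: "e \<in> E" for e
      unfolding f_def fst_conv snd_conv by measurable
    note [measurable] = f_meas
    have "(\<integral>\<^sup>+ s. ennreal (psi (c * f s)) \<partial>M) = (\<integral>\<^sup>+ t. (\<Sum>e\<in>E. ennreal (r t e) * ennreal (psi (c * f (t, e)))) \<partial>L)"
      by (rule nn_integral_M) measurable
    also have "\<dots> = (\<integral>\<^sup>+ t. ennreal (modular h c t (p t)) \<partial>L)"
      by (rule nn_integral_cong_AE, rule AE_mp[OF good], rule AE_I2)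
        (auto simp: modular_def good_def f_def ennreal_mult[symmetric] intro!: sum_ennreal)
    also have "\<dots> = ennreal (LINT t|L. modular h c t (p t))"
      by (rule nn_integral_eq_integral[OF p(2)], rule AE_mp[OF good], rule AE_I2)
        (simp add: good_def modular_nonneg)
    also have "\<dots> \<le> 1" using p(3) by (simp add: ennreal_le_1)
    finally have "(\<integral>\<^sup>+ s. ennreal (psi (c * f s)) \<partial>M) \<le> 1" .
    then have "orlicz_norm M young_tau f \<le> ennreal (2 / c)"
      using c by (intro orlicz_norm_le measurable_M f_meas) auto
    also have "\<dots> < ennreal \<epsilon>" using c \<open>0 < \<epsilon>\<close> by (intro ennreal_lessI) auto
    finally have "orlicz_norm M young_tau (\<lambda>(t, x, x'). h (t, x, x') - (exp (p t $ x' - p t $ x) - 1)) < ennreal \<epsilon>"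
      by (simp add: f_def[abs_def] gr_def case_prod_beta')
    with p(1) show "\<exists>\<alpha>. C1_on {0..T} \<alpha> \<and> orlicz_norm M young_tau
        (\<lambda>(t, x, x'). h (t, x, x') - (exp (\<alpha> t $ x' - \<alpha> t $ x) - 1)) < ennreal \<epsilon>" by blast
  qed
  show ?thesis
  proof (rule that[OF h_closure h_meas])
    show "AE t in L. \<forall>\<beta>. \<beta> \<bullet> v t = (\<Sum>e\<in>E. r t e * (1 + h (t, e)) * gr \<beta> e)"
      using good by eventually_elim (simp add: EL)
    show "J v = (\<integral>\<^sup>+ t. (\<Sum>e\<in>E. e2ennreal (tau_star (h (t, e))) * ennreal (r t e)) \<partial>L)"
      unfolding J_def
    proof (rule nn_integral_cong_AE)
      show "AE t in L. e2ennreal (SUP a. ereal (obj E (r t) (v t) a)) =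
          (\<Sum>e\<in>E. e2ennreal (tau_star (h (t, e))) * ennreal (r t e))"
        using good
      proof eventually_elim
        case (elim t)
        have e: "e2ennreal (tau_star (h (t, e))) * ennreal (r t e) = ennreal (r t e * ent (1 + h (t, e)))"
          "0 \<le> r t e * ent (1 + h (t, e))" if "e \<in> E" for e
        proof -
          have "0 \<le> r t e" "0 \<le> 1 + h (t, e)" using elim h_ge[OF elim that] that by (auto simp: good_def)
          then show "e2ennreal (tau_star (h (t, e))) * ennreal (r t e) = ennreal (r t e * ent (1 + h (t, e)))"
            "0 \<le> r t e * ent (1 + h (t, e))"
            using tau_star_ent[of "1 + h (t, e)"] ent_nonneg[of "1 + h (t, e)"]
            by (simp_all add: ennreal_mult mult.commute)
        qed
        then show ?case by (simp add: SE S[OF elim] S_eq[OF elim])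
      qed
    qed
  qed
qed

end

section \<open>Integrability on uniform grids\<close>

text \<open>A subsequence converges almost everywhere, and its limit is a measurable function;
  Fatou's lemma along that subsequence gives convergence in the mean of the whole sequence.\<close>

lemma L1_complete:
  fixes s :: "nat \<Rightarrow> 'a \<Rightarrow> real"
  assumes int: "\<And>n. integrable M (s n)"
    and cauchy: "\<And>e. e > 0 \<Longrightarrow> \<exists>N. \<forall>i\<ge>N. \<forall>j\<ge>N. (LINT x|M. norm (s i x - s j x)) < e"
  obtains R where "integrable M R" "(\<lambda>n. LINT x|M. norm (s n x - R x)) \<longlonglongrightarrow> 0"
proof -
  obtain k where k: "strict_mono k" "AE x in M. Cauchy (\<lambda>i. s (k i) x)"
    using cauchy_L1_AE_cauchy_subseq[OF int cauchy] by blast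
  define R where "R x = lim (\<lambda>i. s (k i) x)" for x
  have [measurable]: "s n \<in> borel_measurable M" for n using int by auto
  have [measurable]: "R \<in> borel_measurable M" unfolding R_def by measurable
  have lim: "AE x in M. (\<lambda>i. s (k i) x) \<longlonglongrightarrow> R x"
    using k(2) by eventually_elim (simp add: R_def convergent_LIMSEQ_iff[symmetric] Cauchy_convergent)
  have fatou: "(\<integral>\<^sup>+ x. ennreal (norm (s n x - R x)) \<partial>M) \<le> ennreal e"
    if N: "\<And>j. j \<ge> N \<Longrightarrow> (LINT x|M. norm (s n x - s j x)) < e" for n N e
  proof -
    have "(\<integral>\<^sup>+ x. ennreal (norm (s n x - R x)) \<partial>M) =
        (\<integral>\<^sup>+ x. liminf (\<lambda>i. ennreal (norm (s n x - s (k i) x))) \<partial>M)"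
    proof (rule nn_integral_cong_AE)
      show "AE x in M. ennreal (norm (s n x - R x)) = liminf (\<lambda>i. ennreal (norm (s n x - s (k i) x)))"
        using lim
      proof eventually_elim
        case (elim x)
        then have "(\<lambda>i. ennreal (norm (s n x - s (k i) x))) \<longlonglongrightarrow> ennreal (norm (s n x - R x))"
          by (intro tendsto_ennrealI tendsto_intros)
        then show ?case by (rule lim_imp_Liminf[OF sequentially_bot, symmetric])
      qed
    qed
    also have "\<dots> \<le> liminf (\<lambda>i. \<integral>\<^sup>+ x. ennreal (norm (s n x - s (k i) x)) \<partial>M)"
      by (rule nn_integral_liminf) measurable
    also have "\<dots> \<le> ennreal e"
    proof (rule Liminf_le)
      show "\<forall>\<^sub>F i in sequentially. (\<integral>\<^sup>+ x. ennreal (norm (s n x - s (k i) x)) \<partial>M) \<le> ennreal e"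
        using eventually_ge_at_top[of N]
      proof eventually_elim
        case (elim i)
        then have "N \<le> k i" using seq_suble[OF k(1), of i] by simp
        then have "(LINT x|M. norm (s n x - s (k i) x)) < e" by (rule N)
        moreover have "integrable M (\<lambda>x. norm (s n x - s (k i) x))"
          by (intro integrable_norm Bochner_Integration.integrable_diff int)
        ultimately show ?case by (subst nn_integral_eq_integral) (auto intro: ennreal_leI)
      qed
    qed simp
    finally show ?thesis .
  qed
  obtain N1 where N1: "\<And>i j. i \<ge> N1 \<Longrightarrow> j \<ge> N1 \<Longrightarrow> (LINT x|M. norm (s i x - s j x)) < 1"
    using cauchy[of 1] by auto
  have "(\<integral>\<^sup>+ x. ennreal (norm (s N1 x - R x)) \<partial>M) < \<infinity>"
    using fatou[of N1 N1 1, OF N1] by (simp add: le_less_trans)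
  then have "integrable M (\<lambda>x. s N1 x - R x)" by (intro integrableI_bounded) auto
  from Bochner_Integration.integrable_diff[OF int[of N1] this] have R: "integrable M R" by simp
  have "(\<lambda>n. LINT x|M. norm (s n x - R x)) \<longlonglongrightarrow> 0"
  proof (rule LIMSEQ_I)
    fix e :: real assume "0 < e"
    then obtain N where N: "\<And>i j. i \<ge> N \<Longrightarrow> j \<ge> N \<Longrightarrow> (LINT x|M. norm (s i x - s j x)) < e / 2"
      using cauchy[of "e / 2"] by auto
    show "\<exists>no. \<forall>n\<ge>no. norm ((LINT x|M. norm (s n x - R x)) - 0) < e"
    proof (intro exI allI impI)
      fix n assume n: "N \<le> n"
      have "ennreal (LINT x|M. norm (s n x - R x)) = (\<integral>\<^sup>+ x. ennreal (norm (s n x - R x)) \<partial>M)"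
        by (intro nn_integral_eq_integral[symmetric] integrable_norm Bochner_Integration.integrable_diff int R) auto
      also have "\<dots> \<le> ennreal (e / 2)" by (rule fatou[of N]) (rule N[OF n])
      finally have "(LINT x|M. norm (s n x - R x)) \<le> e / 2" using \<open>0 < e\<close> by (simp add: ennreal_le_iff)
      then show "norm ((LINT x|M. norm (s n x - R x)) - 0) < e" using \<open>0 < e\<close> by simp
    qed
  qed
  with R that show ?thesis by blast
qed

lemma exp_le_quadratic: "exp x \<le> 1 + x + x\<^sup>2" if "x \<le> 1" for x :: real
proof (cases "0 \<le> x")
  case True
  then show ?thesis using exp_bound[of x] that by simp
next
  case False
  define y where "y = - x"
  have y: "0 < y" using False by (simp add: y_def)
  \<comment> \<open>The product is \<open>1 + y ^ 3\<close>.\<close>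
  have "1 \<le> (1 - y + y\<^sup>2) * (1 + y)" using y by (simp add: algebra_simps power2_eq_square)
  also have "\<dots> \<le> (1 - y + y\<^sup>2) * exp y"
  proof (rule mult_left_mono)
    have "0 \<le> (1 - y)\<^sup>2 + y" using y by simp
    then show "0 \<le> 1 - y + y\<^sup>2" by (simp add: power2_eq_square algebra_simps)
  qed simp
  finally have "exp x * 1 \<le> exp x * ((1 - y + y\<^sup>2) * exp y)" by (intro mult_left_mono) auto
  also have "\<dots> = 1 - y + y\<^sup>2" by (simp add: y_def exp_minus)
  finally show ?thesis by (simp add: y_def)
qed

text \<open>Stands in for differentiating an integral at \<open>s = 0\<close>: a one-sided
  inequality with quadratic remainder, valid for both signs of s, kills the linear term.\<close>

lemma linear_le_quadratic_imp_zero: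
  fixes x :: real
  assumes s0: "0 < s0" and le: "\<And>s. \<bar>s\<bar> \<le> s0 \<Longrightarrow> s * x \<le> s\<^sup>2 * Q"
  shows "x = 0"
proof (rule ccontr)
  assume "x \<noteq> 0"
  \<comment> \<open>Small enough that \<open>u * \<bar>Q\<bar>\<close> stays below
    \<open>\<bar>x\<bar> / 2\<close>; adding 1 avoids division by zero.\<close>
  define u where "u = min s0 (\<bar>x\<bar> / (2 * (\<bar>Q\<bar> + 1)))"
  have q: "0 < 2 * (\<bar>Q\<bar> + 1)" by simp
  have "u \<le> \<bar>x\<bar> / (2 * (\<bar>Q\<bar> + 1))" by (simp add: u_def)
  then have "u * (2 * (\<bar>Q\<bar> + 1)) \<le> \<bar>x\<bar>" unfolding pos_le_divide_eq[OF q] .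
  moreover have "0 < u" "u \<le> s0" using s0 \<open>x \<noteq> 0\<close> q by (auto simp: u_def)
  ultimately have u: "0 < u" "u \<le> s0" "u * (2 * (\<bar>Q\<bar> + 1)) \<le> \<bar>x\<bar>" by auto
  have "sgn x * u * x \<le> (sgn x * u)\<^sup>2 * Q"
    by (rule le) (use u in \<open>simp add: abs_mult abs_sgn_eq\<close>)
  then have "u * \<bar>x\<bar> \<le> u * (u * Q)"
    using \<open>x \<noteq> 0\<close> by (simp add: power2_eq_square abs_sgn[of x] sgn_mult_self_eq algebra_simps sgn_if split: if_splits)
  then have "\<bar>x\<bar> \<le> u * Q" using u(1) by simp
  also have "\<dots> \<le> u * \<bar>Q\<bar>" using u(1) by (intro mult_left_mono) auto
  finally show False using u mult_nonneg_nonneg[of u "\<bar>Q\<bar>"] by (simp add: algebra_simps)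
qed

section \<open>Nested grids and controls sampled on them\<close>

lemma grid_at_nodes:
  assumes "0 < T" "0 < N" "0 < k"
  shows "grid T N (real j * T / real (N * k)) = real (j div k) * T / real N"
proof -
  have "real j * T / real (N * k) * real N / T = real j / real k"
    using assms by (simp add: field_simps)
  then show ?thesis by (simp add: grid_def floor_divide_of_nat_eq)
qed

text \<open>After rescaling this is the law of nested floors:
  \<open>floor (floor x / k) = floor (x / k)\<close> for a positive integer k.\<close>

lemma grid_grid:
  assumes "0 < T" "0 < N" "0 < k"
  shows "grid T N (grid T (N * k) t) = grid T N t"
proof -
  define x where "x = t * real (N * k) / T"
  have 1: "grid T (N * k) t * real N / T = of_int \<lfloor>x\<rfloor> / of_int (int k)"
    using assms by (simp add: grid_def x_def field_simps)
  have 2: "t * real N / T = x / of_int (int k)" using assms by (simp add: x_def field_simps)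
  have "\<lfloor>grid T (N * k) t * real N / T\<rfloor> = \<lfloor>t * real N / T\<rfloor>"
    unfolding 1 2 floor_divide_of_int_eq using floor_divide_real_eq_div[of "int k" x] by simp
  then show ?thesis by (simp only: grid_def)
qed

lemma grid_value:
  assumes "0 < T" "0 < N" "t \<in> {0..T}"
  shows "grid T N t \<in> (\<lambda>i. real i * T / real N) ` {..N}"
proof -
  have 0: "0 \<le> t * real N / T" and 1: "t * real N / T \<le> real N" using assms by (auto simp: field_simps)
  have "\<lfloor>t * real N / T\<rfloor> \<le> int N" using 1 by (simp add: floor_le_iff)
  then have "nat \<lfloor>t * real N / T\<rfloor> \<in> {..N}" using 0 by simp
  moreover have "grid T N t = real (nat \<lfloor>t * real N / T\<rfloor>) * T / real N"
    using 0 by (simp add: grid_def)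
  ultimately show ?thesis by blast
qed

text \<open>Holds for an arbitrary \<alpha>, since only finitely many nodes are ever
  sampled.\<close>

lemma bounded_measurable_grid:
  assumes "0 < T" "0 < N"
  shows "bounded_measurable T (\<lambda>t. \<alpha> (grid T N t) :: real^'a::finite)"
  unfolding bounded_measurable_def
proof
  have "(\<lambda>t. \<alpha> (grid T N t)) \<in> borel_measurable lborel" by simp
  then have "(\<lambda>t. \<alpha> (grid T N t)) \<in> borel_measurable lebesgue" by (rule measurable_completion)
  then show "(\<lambda>t. \<alpha> (grid T N t)) \<in> borel_measurable (lebesgue_on {0..T})"
    by (rule measurable_restrict_space1)
  have "(\<lambda>t. \<alpha> (grid T N t)) ` {0..T} \<subseteq> \<alpha> ` (\<lambda>i. real i * T / real N) ` {..N}"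
    using grid_value[OF assms] by blast
  then show "bounded ((\<lambda>t. \<alpha> (grid T N t)) ` {0..T})" by (rule finite_imp_bounded[OF finite_subset]) simp
qed

lemma bounded_measurable_bound:
  assumes "bounded_measurable T f" obtains B where "0 < B" "\<And>t. t \<in> {0..T} \<Longrightarrow> norm (f t) \<le> B"
  using assms unfolding bounded_measurable_def bounded_pos by auto

context flow_rates
begin

lemma integrable_bounded:
  fixes g :: "real \<Rightarrow> real"
  assumes "g \<in> borel_measurable L" "AE t in L. \<bar>g t\<bar> \<le> B"
  shows "integrable L g"
  by (rule Bochner_Integration.integrable_bound[OF integrable_const_L[of B] assms(1)])
    (use assms(2) in \<open>auto elim!: eventually_mono\<close>)

lemma integrable_rate_function:
  assumes f: "bounded_measurable T f" and e: "e \<in> E" and \<phi>: "continuous_on UNIV (\<phi> :: real \<Rightarrow> real)"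
  shows "integrable L (\<lambda>t. r t e * \<phi> (gr (f t) e))"
proof -
  note [measurable] = r_meas[OF e] borel_measurable_continuous_onI[OF \<phi>]
  have [measurable]: "f \<in> borel_measurable L" using f by (simp add: bounded_measurable_def)
  obtain B where B: "\<And>t. t \<in> {0..T} \<Longrightarrow> norm (f t) \<le> B" using bounded_measurable_bound[OF f] by blast
  have "bounded (\<phi> ` {- (2 * B)..2 * B})"
    by (intro compact_imp_bounded compact_continuous_image continuous_on_subset[OF \<phi>]) auto
  then obtain Q where "\<forall>y\<in>\<phi> ` {- (2 * B)..2 * B}. norm y \<le> Q" unfolding bounded_iff by blast
  then have Q: "\<bar>\<phi> x\<bar> \<le> Q" if "x \<in> {- (2 * B)..2 * B}" for x using that by simp
  show ?thesis
  proof (rule integrable_bounded)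
    show "AE t in L. \<bar>r t e * \<phi> (gr (f t) e)\<bar> \<le> C * Q"
      using r_bounds AE_space
    proof eventually_elim
      case (elim t)
      then have "\<bar>\<phi> (gr (f t) e)\<bar> \<le> Q"
        using gr_bound[of "f t" e] B[of t] by (intro Q) (simp add: space_restrict_space abs_le_iff)
      then show ?case using elim e unfolding abs_mult by (intro mult_mono) auto
    qed
  qed measurable
qed

lemma integrable_cost:
  "bounded_measurable T f \<Longrightarrow> integrable L (\<lambda>t. \<Sum>e\<in>E. r t e * (exp (gr (f t) e) - 1))"
  by (intro Bochner_Integration.integrable_sum integrable_rate_function continuous_intros)

lemma integrable_linear:
  "bounded_measurable T f \<Longrightarrow> integrable L (\<lambda>t. \<Sum>e\<in>E. r t e * gr (f t) e)"
  by (intro Bochner_Integration.integrable_sum integrable_rate_function[where \<phi> = "\<lambda>x. x"] continuous_intros)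

end

section \<open>Existence of a limiting flux\<close>

context flow_rates
begin

text \<open>Riemann--Stieltjes sum of \<alpha> against \<mu> with left end points; it makes sense
  for any path.\<close>

definition increments :: "(real \<Rightarrow> real^'a) \<Rightarrow> nat \<Rightarrow> (real \<Rightarrow> real^'a) \<Rightarrow> real" where
  "increments \<mu> N \<alpha> = (\<Sum>i<N. \<alpha> (real i * T / real N) \<bullet> (\<mu> (real (i + 1) * T / real N) - \<mu> (real i * T / real N)))"

definition grid_action :: "(real \<Rightarrow> real^'a) \<Rightarrow> nat \<Rightarrow> (real \<Rightarrow> real^'a) \<Rightarrow> real" where
  "grid_action \<mu> N \<alpha> = increments \<mu> N \<alpha> - (LINT t|L. (\<Sum>e\<in>E. r t e * (exp (gr (\<alpha> (grid T N t)) e) - 1)))"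

text \<open>Inside a coarse cell the refined control is constant, so the fine increments
  telescope.\<close>

lemma increments_refine:
  assumes "0 < N" "0 < k"
  shows "increments \<mu> (N * k) (\<lambda>t. \<alpha> (grid T N t)) = increments \<mu> N \<alpha>"
proof -
  define f where "f j = \<mu> (real j * T / real (N * k))" for j
  have "increments \<mu> (N * k) (\<lambda>t. \<alpha> (grid T N t)) =
      (\<Sum>j<N * k. \<alpha> (real (j div k) * T / real N) \<bullet> (f (Suc j) - f j))"
    unfolding increments_def grid_at_nodes[OF T_pos assms] f_def by simp
  also have "\<dots> = (\<Sum>i<N. \<Sum>j = i * k..<i * k + k. \<alpha> (real (j div k) * T / real N) \<bullet> (f (Suc j) - f j))"
    by (rule sum.nat_group[symmetric])
  also have "\<dots> = (\<Sum>i<N. \<alpha> (real i * T / real N) \<bullet> (\<mu> (real (i + 1) * T / real N) - \<mu> (real i * T / real N)))"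
  proof (rule sum.cong[OF refl])
    fix i
    have "(\<Sum>j = i * k..<i * k + k. \<alpha> (real (j div k) * T / real N) \<bullet> (f (Suc j) - f j)) =
        (\<Sum>j = i * k..<i * k + k. \<alpha> (real i * T / real N) \<bullet> (f (Suc j) - f j))"
    proof (rule sum.cong[OF refl])
      fix j assume "j \<in> {i * k..<i * k + k}"
      then have "j div k = i" using assms by (intro div_nat_eqI) (auto simp: algebra_simps)
      then show "\<alpha> (real (j div k) * T / real N) \<bullet> (f (Suc j) - f j) =
          \<alpha> (real i * T / real N) \<bullet> (f (Suc j) - f j)" by simp
    qed
    also have "\<dots> = \<alpha> (real i * T / real N) \<bullet> (f (i * k + k) - f (i * k))"
      by (simp add: inner_sum_right[symmetric] sum_Suc_diff')
    also have "f (i * k + k) = \<mu> (real (i + 1) * T / real N)"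
    proof -
      have "real (i * k + k) * T / real (N * k) = (real (i + 1) * T * real k) / (real N * real k)"
        by (simp add: algebra_simps)
      then show ?thesis using assms by (simp add: f_def del: of_nat_add)
    qed
    also have "f (i * k) = \<mu> (real i * T / real N)" using assms by (simp add: f_def)
    finally show "(\<Sum>j = i * k..<i * k + k. \<alpha> (real (j div k) * T / real N) \<bullet> (f (Suc j) - f j)) =
        \<alpha> (real i * T / real N) \<bullet> (\<mu> (real (i + 1) * T / real N) - \<mu> (real i * T / real N))" .
  qed
  finally show ?thesis by (simp add: increments_def)
qed

lemma grid_action_refine:
  assumes "0 < N" "0 < k"
  shows "grid_action \<mu> (N * k) (\<lambda>t. \<alpha> (grid T N t)) = grid_action \<mu> N \<alpha>"
  unfolding grid_action_def increments_refine[OF assms] grid_grid[OF T_pos assms] ..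

text \<open>The product grid refines both grids, so controls from different grids can be averaged or
  added without changing the action of either.\<close>

lemma grid_action_common:
  assumes "0 < N" "0 < N'"
  obtains K \<alpha>' \<beta>' where "0 < K" "grid_action \<mu> K \<alpha>' = grid_action \<mu> N \<alpha>"
    "\<And>t. \<alpha>' (grid T K t) = \<alpha> (grid T N t)" "increments \<mu> K \<beta>' = increments \<mu> N' \<beta>"
    "grid_action \<mu> K \<beta>' = grid_action \<mu> N' \<beta>" "\<And>t. \<beta>' (grid T K t) = \<beta> (grid T N' t)"
proof
  show "0 < N * N'" using assms by simp
  show "grid_action \<mu> (N * N') (\<lambda>t. \<alpha> (grid T N t)) = grid_action \<mu> N \<alpha>" by (rule grid_action_refine[OF assms])
  show "\<alpha> (grid T N (grid T (N * N') t)) = \<alpha> (grid T N t)" for t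
    by (simp only: grid_grid[OF T_pos assms])
  show "grid_action \<mu> (N * N') (\<lambda>t. \<beta> (grid T N' t)) = grid_action \<mu> N' \<beta>"
    using grid_action_refine[OF assms(2,1)] by (simp add: mult.commute)
  show "increments \<mu> (N * N') (\<lambda>t. \<beta> (grid T N' t)) = increments \<mu> N' \<beta>"
    using increments_refine[OF assms(2,1)] by (simp add: mult.commute)
  show "\<beta> (grid T N' (grid T (N * N') t)) = \<beta> (grid T N' t)" for t
    using grid_grid[OF T_pos assms(2,1)] by (simp add: mult.commute)
qed

lemma grid_action_midpoint:
  assumes N: "0 < N"
  shows "grid_action \<mu> N (\<lambda>t. midpoint (\<alpha> t) (\<beta> t)) = (grid_action \<mu> N \<alpha> + grid_action \<mu> N \<beta>) / 2 +
    (LINT t|L. (\<Sum>e\<in>E. r t e * (exp (gr (\<alpha> (grid T N t)) e / 2) - exp (gr (\<beta> (grid T N t)) e / 2))\<^sup>2 / 2))"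
proof -
  define D where "D t = (\<Sum>e\<in>E. r t e * (exp (gr (\<alpha> (grid T N t)) e / 2) - exp (gr (\<beta> (grid T N t)) e / 2))\<^sup>2 / 2)" for t
  define c where "c \<alpha> t = (\<Sum>e\<in>E. r t e * (exp (gr (\<alpha> (grid T N t)) e) - 1))" for \<alpha> t
  have cint: "integrable L (c \<alpha>)" for \<alpha>
    unfolding c_def by (rule integrable_cost[OF bounded_measurable_grid[OF T_pos N]])
  have mid: "c (\<lambda>t. midpoint (\<alpha> t) (\<beta> t)) t = (c \<alpha> t + c \<beta> t) / 2 - D t" for t
    unfolding c_def D_def by (rule sum_exp_midpoint)
  then have "D = (\<lambda>t. (c \<alpha> t + c \<beta> t) / 2 - c (\<lambda>t. midpoint (\<alpha> t) (\<beta> t)) t)" by (simp add: fun_eq_iff)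
  then have "integrable L D" using cint by simp
  then have "(LINT t|L. c (\<lambda>t. midpoint (\<alpha> t) (\<beta> t)) t) = ((LINT t|L. c \<alpha> t) + (LINT t|L. c \<beta> t)) / 2 - (LINT t|L. D t)"
    unfolding mid using cint by simp
  moreover have "increments \<mu> N (\<lambda>t. midpoint (\<alpha> t) (\<beta> t)) = (increments \<mu> N \<alpha> + increments \<mu> N \<beta>) / 2"
    unfolding increments_def
    by (simp add: midpoint_def inner_add_left sum.distrib sum_divide_distrib add_divide_distrib)
  ultimately show ?thesis
    by (simp add: grid_action_def D_def c_def add_divide_distrib diff_divide_distrib)
qed

lemma grid_action_add:
  assumes N: "0 < N"
  shows "grid_action \<mu> N (\<lambda>t. \<alpha> t + s *\<^sub>R \<beta> t) = grid_action \<mu> N \<alpha> + s * increments \<mu> N \<beta> -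
    (LINT t|L. (\<Sum>e\<in>E. r t e * exp (gr (\<alpha> (grid T N t)) e) * (exp (s * gr (\<beta> (grid T N t)) e) - 1)))"
proof -
  define c where "c \<alpha> t = (\<Sum>e\<in>E. r t e * (exp (gr (\<alpha> (grid T N t)) e) - 1))" for \<alpha> t
  have cint: "integrable L (c \<alpha>)" for \<alpha>
    unfolding c_def by (rule integrable_cost[OF bounded_measurable_grid[OF T_pos N]])
  have "(\<Sum>e\<in>E. r t e * exp (gr (\<alpha> (grid T N t)) e) * (exp (s * gr (\<beta> (grid T N t)) e) - 1)) =
      c (\<lambda>t. \<alpha> t + s *\<^sub>R \<beta> t) t - c \<alpha> t" for t
    unfolding c_def sum_subtractf[symmetric] by (rule sum.cong) (auto simp: exp_add algebra_simps)
  then have "(LINT t|L. (\<Sum>e\<in>E. r t e * exp (gr (\<alpha> (grid T N t)) e) * (exp (s * gr (\<beta> (grid T N t)) e) - 1))) =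
      (LINT t|L. c (\<lambda>t. \<alpha> t + s *\<^sub>R \<beta> t) t) - (LINT t|L. c \<alpha> t)"
    using cint by simp
  moreover have "increments \<mu> N (\<lambda>t. \<alpha> t + s *\<^sub>R \<beta> t) = increments \<mu> N \<alpha> + s * increments \<mu> N \<beta>"
    unfolding increments_def by (simp add: inner_add_left sum.distrib sum_distrib_left)
  ultimately show ?thesis by (simp add: grid_action_def c_def)
qed

text \<open>The flux plays the part of a Radon--Nikodym density of \<open>\<mu>\<close>: by the midpoint identity the functions
  \<open>r t e * exp (gr (\<alpha>\<^sub>n t) e)\<close> of a maximising sequence are Cauchy in \<open>L\<^sup>1\<close>, so no prior absolute
  continuity of \<open>\<mu>\<close> is required.\<close>

lemma grid_flux_exists:
  assumes bound: "\<And>N \<alpha>. 0 < N \<Longrightarrow> grid_action \<mu> N \<alpha> \<le> K"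
  obtains R :: "'a \<times> 'a \<Rightarrow> real \<Rightarrow> real" where "\<And>e. e \<in> E \<Longrightarrow> integrable L (R e)"
    "\<And>N \<beta>. 0 < N \<Longrightarrow> increments \<mu> N \<beta> = (LINT t|L. (\<Sum>e\<in>E. R e t * gr (\<beta> (grid T N t)) e))"
proof -
  define V where "V = {grid_action \<mu> N \<alpha> | N \<alpha>. 0 < N}"
  have Vne: "V \<noteq> {}" unfolding V_def by (auto intro!: exI[of _ "1::nat"])
  have Vbdd: "bdd_above V" using bound by (auto simp: V_def intro!: bdd_aboveI)
  define S where "S = Sup V"
  have le_S: "grid_action \<mu> N \<alpha> \<le> S" if "0 < N" for N \<alpha>
    unfolding S_def using that Vbdd by (intro cSup_upper) (auto simp: V_def)
  have "\<exists>N \<alpha>. 0 < N \<and> S - 1 / Suc n < grid_action \<mu> N \<alpha>" for n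
  proof -
    have "S - 1 / Suc n < Sup V" by (simp add: S_def)
    then obtain x where "x \<in> V" "S - 1 / Suc n < x" using less_cSup_iff[OF Vne Vbdd] by blast
    then show ?thesis by (auto simp: V_def)
  qed
  then obtain Nn an where Nn: "\<And>n. 0 < Nn n" and U: "\<And>n. S - 1 / Suc n < grid_action \<mu> (Nn n) (an n)" by metis
  define gap where "gap n = S - grid_action \<mu> (Nn n) (an n)" for n
  have gap: "0 \<le> gap n" "gap n < 1 / Suc n" for n using le_S[OF Nn] U[of n] by (auto simp: gap_def algebra_simps)
  have gap_lim: "gap \<longlonglongrightarrow> 0"
    using gap by (intro LIMSEQ_of_inverse_Suc_bound) (auto intro: less_imp_le)
  define f where "f n t = an n (grid T (Nn n) t)" for n t
  have f_bm: "bounded_measurable T (f n)" for n unfolding f_def by (rule bounded_measurable_grid[OF T_pos Nn])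
  define s where "s e n t = r t e * exp (gr (f n t) e)" for e n t
  have s_int: "integrable L (s e n)" if "e \<in> E" for e n
    unfolding s_def by (intro integrable_rate_function f_bm that continuous_intros)
  \<comment> \<open>Twice the midpoint defect on one edge, a squared Hellinger density; its
    expansion \<open>d_eq\<close> yields integrability.\<close>
  define d where "d e n k t = r t e * (exp (gr (f n t) e / 2) - exp (gr (f k t) e / 2))\<^sup>2" for e n k t
  have d_eq: "d e n k t = s e n t + s e k t - 2 * (r t e * exp (gr (midpoint (f n t) (f k t)) e))" for e n k t
    using exp_square_half[of "gr (f n t) e"] exp_square_half[of "gr (f k t) e"]
    by (simp add: d_def s_def midpoint_def exp_add[symmetric] power2_diff algebra_simps add_divide_distrib)
  have mid_bm: "bounded_measurable T (\<lambda>t. midpoint (f n t) (f k t))" for n k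
  proof -
    have [measurable]: "f n \<in> borel_measurable L" for n using f_bm by (simp add: bounded_measurable_def)
    obtain B B' where B: "\<And>t. t \<in> {0..T} \<Longrightarrow> norm (f n t) \<le> B" "\<And>t. t \<in> {0..T} \<Longrightarrow> norm (f k t) \<le> B'"
      using bounded_measurable_bound[OF f_bm] by metis
    have "norm (midpoint (f n t) (f k t)) \<le> (B + B') / 2" if "t \<in> {0..T}" for t
      using norm_triangle_le[OF add_mono[OF B(1)[OF that] B(2)[OF that]]] by (simp add: midpoint_def)
    then have "bounded ((\<lambda>t. midpoint (f n t) (f k t)) ` {0..T})" unfolding bounded_iff
      by (intro exI[of _ "(B + B') / 2"]) auto
    then show ?thesis unfolding bounded_measurable_def midpoint_def by auto
  qed
  have d_int: "integrable L (d e n k)" if "e \<in> E" for e n k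
    unfolding d_eq[abs_def]
    by (intro Bochner_Integration.integrable_add Bochner_Integration.integrable_diff integrable_mult_right
        s_int that integrable_rate_function mid_bm continuous_intros)
  have d_nonneg: "AE t in L. \<forall>e\<in>E. 0 \<le> d e n k t" for n k
    using r_bounds by eventually_elim (auto simp: d_def)
  \<comment> \<open>On a common grid the midpoint is again a grid control, hence bounded by S;
    nonnegativity isolates one edge from the integrated defect.\<close>
  have d_small: "(LINT t|L. d e n k t) \<le> gap n + gap k" if e: "e \<in> E" for e n k
  proof -
    obtain K \<alpha>' \<beta>' where K: "0 < K" "grid_action \<mu> K \<alpha>' = grid_action \<mu> (Nn n) (an n)"
      "\<And>t. \<alpha>' (grid T K t) = an n (grid T (Nn n) t)" "increments \<mu> K \<beta>' = increments \<mu> (Nn k) (an k)"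
      "grid_action \<mu> K \<beta>' = grid_action \<mu> (Nn k) (an k)" "\<And>t. \<beta>' (grid T K t) = an k (grid T (Nn k) t)"
      by (rule grid_action_common[where \<mu> = \<mu> and \<alpha> = "an n" and \<beta> = "an k", OF Nn[of n] Nn[of k]]) blast
    have "(LINT t|L. d e n k t / 2) \<le> (LINT t|L. (\<Sum>e\<in>E. d e n k t / 2))"
    proof (rule integral_mono_AE)
      show "AE t in L. d e n k t / 2 \<le> (\<Sum>e\<in>E. d e n k t / 2)"
        using d_nonneg[of n k] by eventually_elim (rule member_le_sum[OF e], auto)
    qed (use e in \<open>auto intro!: d_int Bochner_Integration.integrable_sum\<close>)
    also have "\<dots> = grid_action \<mu> K (\<lambda>t. midpoint (\<alpha>' t) (\<beta>' t)) - (grid_action \<mu> K \<alpha>' + grid_action \<mu> K \<beta>') / 2"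
      unfolding grid_action_midpoint[OF K(1)] K(3,6) d_def f_def by simp
    also have "\<dots> \<le> S - (grid_action \<mu> K \<alpha>' + grid_action \<mu> K \<beta>') / 2" using le_S[OF K(1)] by simp
    finally have "(LINT t|L. d e n k t) / 2 \<le> S - (grid_action \<mu> (Nn n) (an n) + grid_action \<mu> (Nn k) (an k)) / 2"
      by (simp only: K(2,5)) simp
    moreover have "x \<le> (S - a) + (S - b)" if "x / 2 \<le> S - (a + b) / 2" for x a b using that by argo
    ultimately show ?thesis unfolding gap_def by blast
  qed
  have s_nonneg: "AE t in L. \<forall>e\<in>E. \<forall>n. 0 \<le> s e n t"
    using r_bounds by eventually_elim (auto simp: s_def)
  \<comment> \<open>Every flux is compared with the one of index 0 through
    \<open>x\<^sup>2 \<le> 2 * y\<^sup>2 + 2 * (x - y)\<^sup>2\<close>. The gaps are at most 1,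
    which gives the 4; the final 1 keeps the bound positive, as it is divided by below.\<close>
  have "\<exists>A>0. \<forall>n. (LINT t|L. s e n t) \<le> A" if e: "e \<in> E" for e
  proof (intro exI conjI allI)
    show "0 < 2 * \<bar>LINT t|L. s e 0 t\<bar> + 4 + 1" by simp
    fix n
    have "(LINT t|L. s e n t) \<le> (LINT t|L. 2 * s e 0 t + 2 * d e n 0 t)"
    proof (rule integral_mono_AE)
      show "AE t in L. s e n t \<le> 2 * s e 0 t + 2 * d e n 0 t"
        using r_bounds
      proof eventually_elim
        case (elim t)
        define x y where "x = exp (gr (f n t) e / 2)" and "y = exp (gr (f 0 t) e / 2)"
        have "x\<^sup>2 \<le> 2 * y\<^sup>2 + 2 * (x - y)\<^sup>2"
          using zero_le_power2[of "x - 2 * y"] by (simp add: power2_eq_square algebra_simps)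
        then have "r t e * x\<^sup>2 \<le> r t e * (2 * y\<^sup>2 + 2 * (x - y)\<^sup>2)" using elim e by (intro mult_left_mono) auto
        then show ?case
          using exp_square_half[of "gr (f n t) e"] exp_square_half[of "gr (f 0 t) e"]
          by (simp add: s_def d_def x_def y_def algebra_simps)
      qed
    qed (use e s_int d_int in auto)
    also have "\<dots> = 2 * (LINT t|L. s e 0 t) + 2 * (LINT t|L. d e n 0 t)" using e s_int d_int by simp
    also have "(LINT t|L. d e n 0 t) \<le> 2"
    proof -
      have "1 / real (Suc n) \<le> 1" by simp
      then have "gap n \<le> 1" using gap(2)[of n] by linarith
      moreover have "gap 0 \<le> 1" using gap(2)[of 0] by simp
      ultimately show ?thesis using d_small[OF e, of n 0] by simp
    qed
    finally show "(LINT t|L. s e n t) \<le> 2 * \<bar>LINT t|L. s e 0 t\<bar> + 4 + 1" by simp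
  qed
  then obtain A where A: "\<And>e. e \<in> E \<Longrightarrow> 0 < A e" "\<And>e n. e \<in> E \<Longrightarrow> (LINT t|L. s e n t) \<le> A e" by metis
  \<comment> \<open>Cauchy--Schwarz in weighted form: \<open>\<bar>x\<^sup>2 - y\<^sup>2\<bar> =
    \<bar>x - y\<bar> * (x + y)\<close> is split with a weight \<eta>, so Hellinger closeness
    together with the common bound \<open>A e\<close> gives closeness in the mean.\<close>
  have diff_le: "(LINT t|L. norm (s e n t - s e k t)) \<le> (gap n + gap k) / (2 * \<eta>) + 2 * \<eta> * A e"
    if e: "e \<in> E" and \<eta>: "0 < \<eta>" for e n k \<eta>
  proof -
    have "(LINT t|L. norm (s e n t - s e k t)) \<le> (LINT t|L. d e n k t / (2 * \<eta>) + \<eta> * (s e n t + s e k t))"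
    proof (rule integral_mono_AE)
      show "AE t in L. norm (s e n t - s e k t) \<le> d e n k t / (2 * \<eta>) + \<eta> * (s e n t + s e k t)"
        using r_bounds
      proof eventually_elim
        case (elim t)
        define x y where "x = exp (gr (f n t) e / 2)" and "y = exp (gr (f k t) e / 2)"
        have xy: "0 < x" "0 < y" by (auto simp: x_def y_def)
        have "\<bar>x\<^sup>2 - y\<^sup>2\<bar> = \<bar>x - y\<bar> * (x + y)"
          using xy by (simp add: power2_eq_square square_diff_square_factored abs_mult mult.commute)
        also have "\<dots> \<le> (x - y)\<^sup>2 / (2 * \<eta>) + \<eta> * (x + y)\<^sup>2 / 2"
        proof -
          have "(\<bar>x - y\<bar> - \<eta> * (x + y))\<^sup>2 =
              (x - y)\<^sup>2 + \<eta>\<^sup>2 * (x + y)\<^sup>2 - 2 * \<eta> * (\<bar>x - y\<bar> * (x + y))"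
            unfolding power2_diff[of "\<bar>x - y\<bar>"] power_mult_distrib power2_abs by (simp add: mult_ac)
          then have "2 * \<eta> * (\<bar>x - y\<bar> * (x + y)) \<le> (x - y)\<^sup>2 + \<eta>\<^sup>2 * (x + y)\<^sup>2"
            using zero_le_power2[of "\<bar>x - y\<bar> - \<eta> * (x + y)"] by linarith
          then have "\<bar>x - y\<bar> * (x + y) \<le> ((x - y)\<^sup>2 + \<eta>\<^sup>2 * (x + y)\<^sup>2) / (2 * \<eta>)"
            using \<eta> by (simp add: pos_le_divide_eq mult.commute)
          also have "\<dots> = (x - y)\<^sup>2 / (2 * \<eta>) + \<eta> * (x + y)\<^sup>2 / 2"
            using \<eta> by (simp add: add_divide_distrib power2_eq_square)
          finally show ?thesis .
        qed
        also have "(x + y)\<^sup>2 \<le> 2 * (x\<^sup>2 + y\<^sup>2)"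
          using zero_le_power2[of "x - y"] by (simp add: power2_eq_square algebra_simps)
        then have "\<eta> * (x + y)\<^sup>2 / 2 \<le> \<eta> * (x\<^sup>2 + y\<^sup>2)" using \<eta> by simp
        finally have "r t e * \<bar>x\<^sup>2 - y\<^sup>2\<bar> \<le> r t e * ((x - y)\<^sup>2 / (2 * \<eta>) + \<eta> * (x\<^sup>2 + y\<^sup>2))"
          using elim e by (intro mult_left_mono) auto
        moreover have "norm (s e n t - s e k t) = r t e * \<bar>x\<^sup>2 - y\<^sup>2\<bar>"
          using elim e exp_square_half[of "gr (f n t) e"] exp_square_half[of "gr (f k t) e"]
          by (simp add: s_def x_def y_def abs_mult right_diff_distrib[symmetric])
        moreover have "r t e * ((x - y)\<^sup>2 / (2 * \<eta>) + \<eta> * (x\<^sup>2 + y\<^sup>2)) = d e n k t / (2 * \<eta>) + \<eta> * (s e n t + s e k t)"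
          using exp_square_half[of "gr (f n t) e"] exp_square_half[of "gr (f k t) e"]
          by (simp add: s_def d_def x_def y_def algebra_simps)
        ultimately show ?case by simp
      qed
    qed (use e s_int d_int in auto)
    also have "\<dots> = (LINT t|L. d e n k t) / (2 * \<eta>) + \<eta> * ((LINT t|L. s e n t) + (LINT t|L. s e k t))"
      using e s_int d_int by simp
    also have "\<dots> \<le> (gap n + gap k) / (2 * \<eta>) + \<eta> * (A e + A e)"
      using e \<eta> by (intro add_mono divide_right_mono mult_left_mono d_small A) auto
    finally show ?thesis by (simp add: algebra_simps)
  qed
  have "\<exists>R. integrable L R \<and> (\<lambda>n. LINT t|L. norm (s e n t - R t)) \<longlonglongrightarrow> 0" if e: "e \<in> E" for e
  proof -
    have "\<exists>N. \<forall>i\<ge>N. \<forall>j\<ge>N. (LINT t|L. norm (s e i t - s e j t)) < \<epsilon>" if "0 < \<epsilon>" for \<epsilon>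
    proof -
      \<comment> \<open>Makes the term with \<open>A e\<close> equal to
        \<open>\<epsilon> / 4\<close>; gaps below \<open>\<epsilon> * \<eta> / 2\<close> then keep
        the other term below \<open>\<epsilon> / 2\<close>.\<close>
      define \<eta> where "\<eta> = \<epsilon> / (8 * A e)"
      have \<eta>: "0 < \<eta>" using that A(1)[OF e] by (simp add: \<eta>_def)
      have A4: "2 * \<eta> * A e = \<epsilon> / 4" using A(1)[OF e] by (simp add: \<eta>_def)
      have "0 < \<epsilon> * \<eta> / 2" using that \<eta> by simp
      from order_tendstoD(2)[OF gap_lim this] obtain N where N: "\<And>n. N \<le> n \<Longrightarrow> gap n < \<epsilon> * \<eta> / 2"
        by (auto simp: eventually_sequentially)
      have gN: "(gap i + gap j) / (2 * \<eta>) < \<epsilon> / 2" if "N \<le> i" "N \<le> j" for i j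
      proof -
        have "gap i + gap j < \<epsilon> / 2 * (2 * \<eta>)" using N[OF that(1)] N[OF that(2)] by simp
        then show ?thesis using \<eta> by (simp add: pos_divide_less_eq)
      qed
      have "(LINT t|L. norm (s e i t - s e j t)) < \<epsilon>" if ij: "N \<le> i" "N \<le> j" for i j
      proof (rule le_less_trans[OF diff_le[OF e \<eta>]])
        show "(gap i + gap j) / (2 * \<eta>) + 2 * \<eta> * A e < \<epsilon>"
          unfolding A4 using gN[OF ij] \<open>0 < \<epsilon>\<close> by linarith
      qed
      then show ?thesis by blast
    qed
    then show ?thesis by (rule L1_complete[of L "s e", OF s_int[OF e]]) blast+
  qed
  then have "\<forall>e\<in>E. \<exists>R. integrable L R \<and> (\<lambda>n. LINT t|L. norm (s e n t - R t)) \<longlonglongrightarrow> 0" by simp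
  from bchoice[OF this] obtain R where R: "\<forall>e\<in>E. integrable L (R e) \<and>
    (\<lambda>n. LINT t|L. norm (s e n t - R e t)) \<longlonglongrightarrow> 0" ..
  then have R_int: "\<And>e. e \<in> E \<Longrightarrow> integrable L (R e)"
    and R_lim: "\<And>e. e \<in> E \<Longrightarrow> (\<lambda>n. LINT t|L. norm (s e n t - R e t)) \<longlonglongrightarrow> 0" by simp_all
  show ?thesis
  proof (rule that[OF R_int])
    fix N :: nat and \<beta> :: "real \<Rightarrow> real^'a" assume N: "0 < N"
    define b where "b t = \<beta> (grid T N t)" for t
    have b_bm: "bounded_measurable T b" unfolding b_def by (rule bounded_measurable_grid[OF T_pos N])
    have [measurable]: "b \<in> borel_measurable L" using b_bm by (simp add: bounded_measurable_def)
    obtain B where B: "0 < B" "\<And>t. t \<in> {0..T} \<Longrightarrow> norm (b t) \<le> B" using bounded_measurable_bound[OF b_bm] by blast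
    define G where "G = 2 * B"
    have G0: "0 < G" using B(1) by (simp add: G_def)
    have G: "\<bar>gr (b t) e\<bar> \<le> G" if "t \<in> {0..T}" for t e
      using B(1) B(2)[OF that] gr_bound[of "b t" e] by (auto simp: G_def)
    have mult_int: "integrable L (\<lambda>t. g t * \<phi> (gr (b t) e))"
      if "integrable L g" and [measurable]: "\<phi> \<in> borel_measurable borel"
        and bd: "\<And>x. \<bar>x\<bar> \<le> G \<Longrightarrow> \<bar>\<phi> x\<bar> \<le> Q"
      for g \<phi> :: "real \<Rightarrow> real" and Q e
    proof (rule Bochner_Integration.integrable_bound)
      show "integrable L (\<lambda>t. Q * g t)" using that by simp
      have [measurable]: "g \<in> borel_measurable L" using that(1) by simp
      show "(\<lambda>t. g t * \<phi> (gr (b t) e)) \<in> borel_measurable L" by measurable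
      show "AE t in L. norm (g t * \<phi> (gr (b t) e)) \<le> norm (Q * g t)"
        using AE_space
      proof eventually_elim
        case (elim t)
        then have "\<bar>\<phi> (gr (b t) e)\<bar> \<le> Q" using bd[OF G] by (simp add: space_restrict_space)
        then have "\<bar>g t\<bar> * \<bar>\<phi> (gr (b t) e)\<bar> \<le> \<bar>g t\<bar> * \<bar>Q\<bar>" by (intro mult_left_mono) auto
        then show ?case by (simp add: abs_mult mult.commute)
      qed
    qed
    have \<phi>_bound: "\<bar>exp (c * x) - 1\<bar> \<le> exp (\<bar>c\<bar> * G) + 1" if "\<bar>x\<bar> \<le> G" for c x :: real
    proof -
      have "c * x \<le> \<bar>c\<bar> * \<bar>x\<bar>" by (simp flip: abs_mult)
      also have "\<dots> \<le> \<bar>c\<bar> * G" using that by (intro mult_left_mono) auto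
      finally have "c * x \<le> \<bar>c\<bar> * G" .
      then have "exp (c * x) \<le> exp (\<bar>c\<bar> * G)" by simp
      then show ?thesis using exp_gt_zero[of "c * x"] by linarith
    qed
    define I where "I c = (LINT t|L. (\<Sum>e\<in>E. R e t * (exp (c * gr (b t) e) - 1)))" for c
    \<comment> \<open>The Euler--Lagrange argument over time: adding c times \<beta> to the n-th
      control gains at most \<open>gap n\<close>, and since b is bounded, convergence of the fluxes
      in the mean carries the inequality to the limit.\<close>
    have ineq: "c * increments \<mu> N \<beta> \<le> I c" for c
    proof -
      define In where "In n = (LINT t|L. (\<Sum>e\<in>E. s e n t * (exp (c * gr (b t) e) - 1)))" for n
      have "c * increments \<mu> N \<beta> - In n \<le> gap n" for n
      proof -
        obtain K \<alpha>' \<beta>' where K: "0 < K" "grid_action \<mu> K \<alpha>' = grid_action \<mu> (Nn n) (an n)"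
          "\<And>t. \<alpha>' (grid T K t) = an n (grid T (Nn n) t)" "increments \<mu> K \<beta>' = increments \<mu> N \<beta>"
          "grid_action \<mu> K \<beta>' = grid_action \<mu> N \<beta>" "\<And>t. \<beta>' (grid T K t) = \<beta> (grid T N t)"
          by (rule grid_action_common[where \<mu> = \<mu> and \<alpha> = "an n" and \<beta> = \<beta>, OF Nn[of n] N]) blast
        have "grid_action \<mu> K (\<lambda>t. \<alpha>' t + c *\<^sub>R \<beta>' t) \<le> S" by (rule le_S[OF K(1)])
        then show ?thesis unfolding grid_action_add[OF K(1)] K by (simp add: gap_def In_def s_def f_def b_def)
      qed
      moreover have "In \<longlonglongrightarrow> I c"
      proof -
        have sm: "integrable L (\<lambda>t. g t * (exp (c * gr (b t) e) - 1))" if "integrable L g" for g e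
          by (rule mult_int[OF that _ \<phi>_bound]) auto
        have "(\<lambda>n. LINT t|L. s e n t * (exp (c * gr (b t) e) - 1)) \<longlonglongrightarrow> (LINT t|L. R e t * (exp (c * gr (b t) e) - 1))"
          if e: "e \<in> E" for e
        proof -
          have "(\<lambda>n. (LINT t|L. s e n t * (exp (c * gr (b t) e) - 1)) - (LINT t|L. R e t * (exp (c * gr (b t) e) - 1))) \<longlonglongrightarrow> 0"
          proof (rule Lim_null_comparison)
            show "\<forall>\<^sub>F n in sequentially. norm ((LINT t|L. s e n t * (exp (c * gr (b t) e) - 1)) -
                (LINT t|L. R e t * (exp (c * gr (b t) e) - 1))) \<le>
                (exp (\<bar>c\<bar> * G) + 1) * (LINT t|L. norm (s e n t - R e t))"
            proof (intro always_eventually allI)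
              fix n
              have i: "integrable L (\<lambda>t. s e n t - R e t)" using s_int[OF e] R_int[OF e] by simp
              have "(LINT t|L. s e n t * (exp (c * gr (b t) e) - 1)) - (LINT t|L. R e t * (exp (c * gr (b t) e) - 1)) =
                  (LINT t|L. (s e n t - R e t) * (exp (c * gr (b t) e) - 1))"
                using sm[OF s_int[OF e]] sm[OF R_int[OF e]] by (simp add: left_diff_distrib)
              also have "norm \<dots> \<le> (LINT t|L. norm ((s e n t - R e t) * (exp (c * gr (b t) e) - 1)))"
                by (rule integral_norm_bound)
              also have "\<dots> \<le> (LINT t|L. (exp (\<bar>c\<bar> * G) + 1) * norm (s e n t - R e t))"
              proof (rule integral_mono_AE)
                show "AE t in L. norm ((s e n t - R e t) * (exp (c * gr (b t) e) - 1)) \<le>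
                    (exp (\<bar>c\<bar> * G) + 1) * norm (s e n t - R e t)"
                  using AE_space
                proof eventually_elim
                  case (elim t)
                  then have "\<bar>exp (c * gr (b t) e) - 1\<bar> \<le> exp (\<bar>c\<bar> * G) + 1"
                    by (intro \<phi>_bound G) (simp add: space_restrict_space)
                  from mult_right_mono[OF this, of "\<bar>s e n t - R e t\<bar>"] show ?case
                    by (simp add: abs_mult mult.commute)
                qed
              qed (use i sm[OF i] in auto)
              also have "\<dots> = (exp (\<bar>c\<bar> * G) + 1) * (LINT t|L. norm (s e n t - R e t))" by simp
              finally show "norm ((LINT t|L. s e n t * (exp (c * gr (b t) e) - 1)) -
                (LINT t|L. R e t * (exp (c * gr (b t) e) - 1))) \<le>
                (exp (\<bar>c\<bar> * G) + 1) * (LINT t|L. norm (s e n t - R e t))" .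
            qed
            show "(\<lambda>n. (exp (\<bar>c\<bar> * G) + 1) * (LINT t|L. norm (s e n t - R e t))) \<longlonglongrightarrow> 0"
              using tendsto_mult_left[OF R_lim[OF e]] by simp
          qed
          then show ?thesis by (rule LIM_zero_cancel)
        qed
        then have "(\<lambda>n. \<Sum>e\<in>E. LINT t|L. s e n t * (exp (c * gr (b t) e) - 1)) \<longlonglongrightarrow>
            (\<Sum>e\<in>E. LINT t|L. R e t * (exp (c * gr (b t) e) - 1))" by (rule tendsto_sum)
        then show ?thesis
          unfolding In_def I_def using sm[OF s_int] sm[OF R_int] by (simp add: Bochner_Integration.integral_sum)
      qed
      ultimately have "c * increments \<mu> N \<beta> - I c \<le> 0"
        by (intro LIMSEQ_le[OF tendsto_diff[OF tendsto_const] gap_lim]) auto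
      then show ?thesis by simp
    qed
    define J where "J = (LINT t|L. (\<Sum>e\<in>E. R e t * gr (b t) e))"
    define Q where "Q = (LINT t|L. (\<Sum>e\<in>E. \<bar>R e t\<bar> * G\<^sup>2))"
    \<comment> \<open>\<open>ineq\<close> is expanded to second order in c. For
      \<open>\<bar>c\<bar> \<le> 1 / G\<close> the exponents stay between -1 and 1, where
      \<open>exp_le_quadratic\<close> holds; both signs of c then force the first-order coefficient
      to vanish.\<close>
    have "increments \<mu> N \<beta> - J = 0"
    proof (rule linear_le_quadratic_imp_zero)
      show "0 < 1 / G" using G0 by simp
      fix c assume c: "\<bar>c\<bar> \<le> 1 / G"
      have "I c \<le> (LINT t|L. c * (\<Sum>e\<in>E. R e t * gr (b t) e) + c\<^sup>2 * (\<Sum>e\<in>E. \<bar>R e t\<bar> * G\<^sup>2))"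
        unfolding I_def
      proof (rule integral_mono_AE)
        show "integrable L (\<lambda>t. \<Sum>e\<in>E. R e t * (exp (c * gr (b t) e) - 1))"
          by (intro Bochner_Integration.integrable_sum mult_int[OF R_int _ \<phi>_bound]) auto
        have "integrable L (\<lambda>t. R e t * gr (b t) e)" if "e \<in> E" for e
          by (rule mult_int[OF R_int[OF that], where \<phi> = "\<lambda>x. x" and Q = G]) auto
        then show "integrable L (\<lambda>t. c * (\<Sum>e\<in>E. R e t * gr (b t) e) + c\<^sup>2 * (\<Sum>e\<in>E. \<bar>R e t\<bar> * G\<^sup>2))"
          using R_int by (intro Bochner_Integration.integrable_add integrable_mult_right Bochner_Integration.integrable_sum) auto
        show "AE t in L. (\<Sum>e\<in>E. R e t * (exp (c * gr (b t) e) - 1)) \<le>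
            c * (\<Sum>e\<in>E. R e t * gr (b t) e) + c\<^sup>2 * (\<Sum>e\<in>E. \<bar>R e t\<bar> * G\<^sup>2)"
          using AE_space
        proof eventually_elim
          case (elim t)
          then have t: "t \<in> {0..T}" by (simp add: space_restrict_space)
          have "R e t * (exp (c * gr (b t) e) - 1) \<le> c * (R e t * gr (b t) e) + c\<^sup>2 * (\<bar>R e t\<bar> * G\<^sup>2)" for e
          proof -
            define x where "x = c * gr (b t) e"
            have "\<bar>x\<bar> \<le> (1 / G) * G" unfolding x_def abs_mult using c G[OF t, of e] G0
              by (intro mult_mono) auto
            then have x1: "\<bar>x\<bar> \<le> 1" using G0 by simp
            have "0 \<le> exp x - 1 - x" "exp x - 1 - x \<le> x\<^sup>2"
              using exp_ge_add_one_self[of x] exp_le_quadratic[OF abs_le_D1[OF x1]] by linarith+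
            then have "R e t * (exp x - 1 - x) \<le> \<bar>R e t\<bar> * x\<^sup>2"
              by (intro mult_mono) auto
            also have "\<dots> \<le> \<bar>R e t\<bar> * (c\<^sup>2 * G\<^sup>2)"
            proof (rule mult_left_mono)
              have "(gr (b t) e)\<^sup>2 \<le> G\<^sup>2" using G[OF t, of e] G0 by (simp add: abs_le_square_iff[symmetric])
              then show "x\<^sup>2 \<le> c\<^sup>2 * G\<^sup>2" unfolding x_def power_mult_distrib by (intro mult_left_mono) auto
            qed simp
            finally show ?thesis by (simp add: x_def algebra_simps)
          qed
          then have "(\<Sum>e\<in>E. R e t * (exp (c * gr (b t) e) - 1)) \<le>
              (\<Sum>e\<in>E. c * (R e t * gr (b t) e) + c\<^sup>2 * (\<bar>R e t\<bar> * G\<^sup>2))" by (intro sum_mono)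
          then show ?case by (simp add: sum.distrib sum_distrib_left)
        qed
      qed
      also have "\<dots> = c * J + c\<^sup>2 * Q"
      proof -
        have "integrable L (\<lambda>t. R e t * gr (b t) e)" if "e \<in> E" for e
          by (rule mult_int[OF R_int[OF that], where \<phi> = "\<lambda>x. x" and Q = G]) auto
        then show ?thesis unfolding J_def Q_def using R_int by simp
      qed
      finally show "c * (increments \<mu> N \<beta> - J) \<le> c\<^sup>2 * Q" using ineq[of c] by (simp add: algebra_simps)
    qed
    then show "increments \<mu> N \<beta> = (LINT t|L. (\<Sum>e\<in>E. R e t * gr (\<beta> (grid T N t)) e))"
      by (simp add: J_def b_def)
  qed
qed

end

section \<open>Density of the path and time-integrated suprema\<close>

lemma AE_lebesgue_on_negligible:
  assumes "negligible N" "S \<in> sets lebesgue" "\<And>t. t \<in> S \<Longrightarrow> t \<notin> N \<Longrightarrow> P t"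
  shows "AE t in lebesgue_on S. P t"
proof -
  have "AE t in lebesgue. t \<notin> N" using assms(1) by (simp add: negligible_iff_null_sets AE_not_in)
  then have "AE t in lebesgue. t \<in> S \<longrightarrow> P t" by eventually_elim (use assms(3) in blast)
  then show ?thesis using assms(2) by (subst AE_restrict_space_iff) auto
qed

text \<open>Completeness of Lebesgue measure. It serves for \<open>vector_derivative \<mu>\<close>,
  which equals the integrable density only almost everywhere.\<close>

lemma borel_measurable_lebesgue_on_AE:
  fixes f g :: "real \<Rightarrow> 'b::euclidean_space"
  assumes f: "f \<in> borel_measurable (lebesgue_on S)" and S: "S \<in> sets lebesgue"
    and ae: "AE t in lebesgue_on S. f t = g t"
  shows "g \<in> borel_measurable (lebesgue_on S)"
proof -
  have "(\<lambda>t. if t \<in> S then f t else 0) \<in> borel_measurable lebesgue"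
    using f S by (simp add: borel_measurable_if)
  moreover have "AE t in lebesgue. (if t \<in> S then f t else 0) = (if t \<in> S then g t else 0)"
    using ae S by (subst (asm) AE_restrict_space_iff) (auto elim!: eventually_mono)
  ultimately have "(\<lambda>t. if t \<in> S then g t else 0) \<in> borel_measurable lebesgue"
    by (rule borel_measurable_AE)
  then show ?thesis using S by (simp add: borel_measurable_if)
qed

lemma indefinite_integral_derivative_AE:
  fixes v :: "real \<Rightarrow> 'b::euclidean_space"
  assumes v: "v integrable_on {0..T}" and \<mu>: "\<And>t. t \<in> {0..T} \<Longrightarrow> \<mu> t = c + integral {0..t} v"
  shows "AE t in lebesgue_on {0..T}. (\<mu> has_vector_derivative v t) (at t)"
proof (rule AE_lebesgue_on_negligible)
  show "negligible ({t \<in> {0<..<T}. \<not> ((\<lambda>x. integral {0..x} v) has_vector_derivative v t) (at t)} \<union> {0, T})"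
    using Lebesgue_differentiation_real[OF v] by (simp add: negligible_Un_eq)
  fix t assume t: "t \<in> {0..T}"
    "t \<notin> {t \<in> {0<..<T}. \<not> ((\<lambda>x. integral {0..x} v) has_vector_derivative v t) (at t)} \<union> {0, T}"
  then have "((\<lambda>x. integral {0..x} v) has_vector_derivative v t) (at t)" by auto
  then have "((\<lambda>x. c + integral {0..x} v) has_vector_derivative v t) (at t)"
    by (auto intro!: derivative_eq_intros)
  then show "(\<mu> has_vector_derivative v t) (at t)"
    by (rule has_vector_derivative_transform_within_open[of _ _ _ "{0<..<T}"]) (use t \<mu> in auto)
qed simp

lemma integrable_lebesgue_on_subset:
  fixes f :: "real \<Rightarrow> 'b::euclidean_space"
  assumes "integrable (lebesgue_on S) f" "S \<in> sets lebesgue" "A \<in> sets lebesgue" "A \<subseteq> S"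
  shows "integrable (lebesgue_on A) f"
proof -
  have "set_integrable lebesgue S f"
    using assms by (simp add: set_integrable_def integrable_restrict_space)
  then have "set_integrable lebesgue A f" by (rule set_integrable_subset) (use assms in auto)
  then show ?thesis using assms by (simp add: set_integrable_def integrable_restrict_space)
qed

lemma prob_vecs_norm: "\<xi> \<in> prob_vecs \<Longrightarrow> norm (\<xi> :: real^'a::finite) \<le> 1"
  using norm_le_l1_cart[of \<xi>] by (simp add: prob_vecs_def)

text \<open>The coordinates of \<theta> are indefinite integrals of those of m, so both densities
  are a.e. derivatives of the same functions. This links a given density to the one that
  \<open>I_star\<close> selects by \<open>SOME\<close>.\<close>

lemma time_density_unique:
  fixes m m' :: "real \<Rightarrow> real^'y::finite"
  assumes m: "time_density T \<theta> m" and m': "time_density T \<theta> m'"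
  shows "AE t in lebesgue_on {0..T}. m t = m' t"
proof -
  have int: "integrable (lebesgue_on {0..T}) m" if "time_density T \<theta> m" for m
  proof (rule Bochner_Integration.integrable_bound)
    show "integrable (lebesgue_on {0..T}) (\<lambda>_. 1::real)"
      by (rule finite_measure.integrable_const[OF finite_measure_lebesgue_on]) simp
    show "m \<in> borel_measurable (lebesgue_on {0..T})" using that by (simp add: time_density_def)
    have "AE t in lebesgue_on {0..T}. m t \<in> prob_vecs" using that by (simp add: time_density_def)
    then show "AE t in lebesgue_on {0..T}. norm (m t) \<le> norm (1::real)"
      by eventually_elim (simp add: prob_vecs_norm)
  qed
  have deriv: "AE t in lebesgue_on {0..T}. ((\<lambda>t. \<theta> t $ y) has_vector_derivative m t $ y) (at t)"
    if td: "time_density T \<theta> m" for m y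
  proof (rule indefinite_integral_derivative_AE[where c = 0])
    have i: "integrable (lebesgue_on {0..T}) (\<lambda>t. m t $ y)"
      by (rule integrable_bounded_linear[OF bounded_linear_vec_nth int[OF td]])
    then show "(\<lambda>t. m t $ y) integrable_on {0..T}" by (rule integrable_on_lebesgue_on) simp
    fix t assume t: "t \<in> {0..T}"
    then have "(\<Sum>y\<in>{y}. \<theta> t $ y) = (LINT s|lebesgue_on {0..t}. (\<Sum>y\<in>{y}. m s $ y))"
      using td unfolding time_density_def by blast
    then have "\<theta> t $ y = (LINT s|lebesgue_on {0..t}. m s $ y)" by simp
    also have "\<dots> = integral {0..t} (\<lambda>s. m s $ y)"
      by (rule lebesgue_integral_eq_integral, rule integrable_lebesgue_on_subset[OF i]) (use t in auto)
    finally show "\<theta> t $ y = 0 + integral {0..t} (\<lambda>s. m s $ y)" by simp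
  qed
  have "AE t in lebesgue_on {0..T}. \<forall>y. ((\<lambda>t. \<theta> t $ y) has_vector_derivative m t $ y) (at t)"
    "AE t in lebesgue_on {0..T}. \<forall>y. ((\<lambda>t. \<theta> t $ y) has_vector_derivative m' t $ y) (at t)"
    using deriv[OF m] deriv[OF m'] by (simp_all add: AE_all_countable)
  then show ?thesis
    by eventually_elim (auto simp: vec_eq_iff intro: vector_derivative_unique_at)
qed

text \<open>Nodes become integers after rescaling, and the floor of a real is below an integer iff
  the real is. A step function that switches at a node is therefore unaffected by rounding its
  argument.\<close>

lemma grid_less_node:
  assumes "0 < T" "0 < N"
  shows "grid T N t < real i * T / real N \<longleftrightarrow> t < real i * T / real N"
proof -
  have "grid T N t < real i * T / real N \<longleftrightarrow> real_of_int \<lfloor>t * real N / T\<rfloor> < real i"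
    using assms by (simp add: grid_def divide_less_cancel)
  also have "\<dots> \<longleftrightarrow> \<lfloor>t * real N / T\<rfloor> < int i" by linarith
  also have "\<dots> \<longleftrightarrow> t * real N / T < real i" by (simp add: floor_less_iff)
  also have "\<dots> \<longleftrightarrow> t < real i * T / real N" using assms by (simp add: field_simps)
  finally show ?thesis .
qed

context flow_rates
begin

text \<open>Connects the Bochner integral used for controls with the gauge integral used for
  differentiation; the point q, where \<open>t < q\<close> and \<open>t \<le> q\<close> differ, is
  null.\<close>

lemma LINT_before:
  fixes f :: "real \<Rightarrow> real"
  assumes f: "integrable L f" and q: "q \<in> {0..T}"
  shows "integrable L (\<lambda>t. if t < q then f t else 0)"
    "(LINT t|L. (if t < q then f t else 0)) = integral {0..q} f"
proof -
  have [measurable]: "f \<in> borel_measurable L" using f by simp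
  have "(\<lambda>t::real. t) \<in> borel_measurable L"
    by (intro continuous_imp_measurable_on_sets_lebesgue continuous_on_id) auto
  from borel_measurable_less[OF this borel_measurable_const[of q]]
  have less: "{t \<in> space L. t < q} \<in> sets L" .
  show i: "integrable L (\<lambda>t. if t < q then f t else 0)"
  proof (rule Bochner_Integration.integrable_bound[OF f])
    show "(\<lambda>t. if t < q then f t else 0) \<in> borel_measurable L"
      by (rule measurable_If[OF _ _ less]) (use f in simp_all)
    show "AE t in L. norm (if t < q then f t else 0) \<le> norm (f t)" by (rule AE_I2) simp
  qed
  have "(LINT t|L. (if t < q then f t else 0)) = integral {0..T} (\<lambda>t. if t < q then f t else 0)"
    by (rule lebesgue_integral_eq_integral[OF i]) simp
  also have "\<dots> = integral {0..T} (\<lambda>t. if t \<in> {..q} then f t else 0)"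
    by (rule integral_spike[of "{q}"]) auto
  also have "\<dots> = integral ({0..T} \<inter> {..q}) f" using Henstock_Kurzweil_Integration.integral_restrict_Int[of "{0..T}" "{..q}" f] by (simp add: Int_commute)
  also have "{0..T} \<inter> {..q} = {0..q}" using q by auto
  finally show "(LINT t|L. (if t < q then f t else 0)) = integral {0..q} f" .
qed

lemma LINT_inner_before:
  fixes v :: "real \<Rightarrow> 'b::euclidean_space"
  assumes v: "integrable L v" and q: "q \<in> {0..T}"
  shows "integrable L (\<lambda>t. if t < q then c \<bullet> v t else 0)"
    "(LINT t|L. (if t < q then c \<bullet> v t else 0)) = c \<bullet> integral {0..q} v"
proof -
  have i: "integrable L (\<lambda>t. c \<bullet> v t)" using v by simp
  show "integrable L (\<lambda>t. if t < q then c \<bullet> v t else 0)" by (rule LINT_before[OF i q])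
  have "v integrable_on {0..q}"
    by (rule integrable_on_lebesgue_on[OF integrable_lebesgue_on_subset[OF v]]) (use q in auto)
  then have "integral {0..q} (\<lambda>t. c \<bullet> v t) = c \<bullet> integral {0..q} v"
    using integral_linear[OF _ bounded_linear_inner_right[of c]] by (simp add: o_def)
  then show "(LINT t|L. (if t < q then c \<bullet> v t else 0)) = c \<bullet> integral {0..q} v"
    by (simp add: LINT_before(2)[OF i q])
qed

lemma grid_density_exists:
  assumes bound: "\<And>N \<alpha>. 0 < N \<Longrightarrow> grid_action \<mu> N \<alpha> \<le> K"
    and right: "\<And>t. t \<in> {0..<T} \<Longrightarrow> (\<mu> \<longlongrightarrow> \<mu> t) (at_right t)"
  obtains v where "integrable L v" "\<And>t. t \<in> {0..T} \<Longrightarrow> \<mu> t = \<mu> 0 + integral {0..t} v"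
    "\<And>N \<beta>. 0 < N \<Longrightarrow> increments \<mu> N \<beta> = (LINT t|L. \<beta> (grid T N t) \<bullet> v t)"
proof -
  obtain R where R: "\<And>e. e \<in> E \<Longrightarrow> integrable L (R e)"
    and inc: "\<And>N \<beta>. 0 < N \<Longrightarrow> increments \<mu> N \<beta> = (LINT t|L. (\<Sum>e\<in>E. R e t * gr (\<beta> (grid T N t)) e))"
    using grid_flux_exists[OF bound] by blast
  \<comment> \<open>The divergence of the flux: each edge adds \<open>R e t\<close> at its head and
    removes it at its tail, which makes \<open>c \<bullet> v t\<close> the sum of
    \<open>R e t\<close> against the gradients of c.\<close>
  define v where "v t = (\<Sum>e\<in>E. R e t *\<^sub>R (axis (snd e) 1 - axis (fst e) 1 :: real^'a))" for t
  have v_int: "integrable L v"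
    unfolding v_def using R by (intro Bochner_Integration.integrable_sum integrable_scaleR_left) auto
  have cv: "c \<bullet> v t = (\<Sum>e\<in>E. R e t * gr c e)" for c t
    by (simp add: v_def inner_sum_right inner_diff_right inner_axis gr_def)
  have inc': "increments \<mu> N \<beta> = (LINT t|L. \<beta> (grid T N t) \<bullet> v t)" if "0 < N" for N \<beta>
    unfolding inc[OF that] cv ..
  have v_on: "v integrable_on {0..T}" by (rule integrable_on_lebesgue_on[OF v_int]) simp
  have node: "\<mu> (real i * T / real N) - \<mu> 0 = integral {0..real i * T / real N} v"
    if N: "0 < N" and i: "i \<le> N" for i N
  proof -
    define q where "q = real i * T / real N"
    have "real i * T \<le> real N * T" using i T_pos by (intro mult_right_mono) auto
    then have q: "q \<in> {0..T}" using T_pos N by (simp add: q_def field_simps)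
    have "c \<bullet> (\<mu> q - \<mu> 0) = c \<bullet> integral {0..q} v" for c
    proof -
      \<comment> \<open>A control that switches off at the node q makes the increments telescope to
        \<open>c \<bullet> (\<mu> q - \<mu> 0)\<close>.\<close>
      define \<beta> where "\<beta> \<tau> = (if \<tau> < q then c else 0)" for \<tau>
      have "increments \<mu> N \<beta> = (\<Sum>j<i. c \<bullet> (\<mu> (real (Suc j) * T / real N) - \<mu> (real j * T / real N)))"
        unfolding increments_def
      proof (rule sum.mono_neutral_cong_right)
        show "\<forall>j\<in>{..<N} - {..<i}. \<beta> (real j * T / real N) \<bullet>
            (\<mu> (real (j + 1) * T / real N) - \<mu> (real j * T / real N)) = 0"
          using N T_pos by (auto simp: \<beta>_def q_def divide_less_cancel)
        show "\<beta> (real j * T / real N) \<bullet> (\<mu> (real (j + 1) * T / real N) - \<mu> (real j * T / real N)) =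
            c \<bullet> (\<mu> (real (Suc j) * T / real N) - \<mu> (real j * T / real N))" if "j \<in> {..<i}" for j
          using N T_pos that by (simp add: \<beta>_def q_def divide_less_cancel)
      qed (use i in auto)
      also have "\<dots> = c \<bullet> (\<Sum>j<i. \<mu> (real (Suc j) * T / real N) - \<mu> (real j * T / real N))"
        by (simp add: inner_sum_right)
      also have "\<dots> = c \<bullet> (\<mu> q - \<mu> 0)"
        by (subst sum_lessThan_telescope) (simp add: q_def)
      finally have "c \<bullet> (\<mu> q - \<mu> 0) = (LINT t|L. \<beta> (grid T N t) \<bullet> v t)" by (simp add: inc'[OF N])
      also have "\<dots> = (LINT t|L. (if t < q then c \<bullet> v t else 0))"
        unfolding \<beta>_def q_def grid_less_node[OF T_pos N] by (rule Bochner_Integration.integral_cong) auto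
      also have "\<dots> = c \<bullet> integral {0..q} v" by (rule LINT_inner_before[OF v_int q])
      finally show ?thesis .
    qed
    then have "\<mu> q - \<mu> 0 = integral {0..q} v" by (metis vector_eq_rdot inner_commute)
    then show ?thesis by (simp add: q_def)
  qed
  \<comment> \<open>Right-continuity extends the formula from nodes to all times. T is a node itself
    and is treated apart; for \<open>t < T\<close> the index of the next node, one above the floor,
    does not exceed \<open>Suc N\<close>.\<close>
  have "\<mu> t = \<mu> 0 + integral {0..t} v" if t: "t \<in> {0..T}" for t
  proof (cases "t = T")
    case True
    then show ?thesis using node[of 1 1] by (simp add: algebra_simps)
  next
    case False
    with t have t: "t \<in> {0..<T}" by auto
    define q where "q N = grid T (Suc N) t + T / real (Suc N)" for N
    have q_node: "\<exists>i\<le>Suc N. q N = real i * T / real (Suc N)" for N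
    proof (intro exI conjI)
      have 0: "0 \<le> t * real (Suc N) / T" using t T_pos by simp
      have "t * real (Suc N) < T * real (Suc N)" using t by (intro mult_strict_right_mono) auto
      then have 1: "t * real (Suc N) / T < real (Suc N)" using T_pos by (simp add: pos_divide_less_eq mult.commute)
      then have "\<lfloor>t * real (Suc N) / T\<rfloor> < int (Suc N)" by (simp only: floor_less_iff of_int_of_nat_eq)
      then show "nat \<lfloor>t * real (Suc N) / T\<rfloor> + 1 \<le> Suc N" by linarith
      show "q N = real (nat \<lfloor>t * real (Suc N) / T\<rfloor> + 1) * T / real (Suc N)"
        using 0 by (simp add: q_def grid_def add_divide_distrib distrib_right)
    qed
    have q_right: "filterlim q (at_right t) sequentially"
      unfolding q_def by (rule grid_next_at_right[OF T_pos])
    then have q_lim: "q \<longlonglongrightarrow> t" unfolding filterlim_at by blast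
    have q_gt: "t < q N" for N using grid_bounds(2)[OF T_pos, of "Suc N" t] by (simp add: q_def)
    have q_le: "q N \<le> T" for N
    proof -
      obtain i where i: "i \<le> Suc N" "q N = real i * T / real (Suc N)" using q_node by blast
      have "real i * T \<le> real (Suc N) * T" using i T_pos by (intro mult_right_mono) auto
      then show ?thesis unfolding i(2) by (simp add: pos_divide_le_eq mult.commute del: of_nat_Suc)
    qed
    have "(\<lambda>N. \<mu> (q N)) \<longlonglongrightarrow> \<mu> t" by (rule filterlim_compose[OF right[OF t] q_right])
    moreover have "(\<lambda>N. \<mu> (q N)) \<longlonglongrightarrow> \<mu> 0 + integral {0..t} v"
    proof -
      have eq: "\<mu> (q N) = \<mu> 0 + integral {0..q N} v" for N
      proof -
        obtain i where i: "i \<le> Suc N" "q N = real i * T / real (Suc N)" using q_node by blast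
        show ?thesis using node[OF _ i(1)] unfolding i(2) by (simp add: algebra_simps)
      qed
      have "continuous_on {0..T} (\<lambda>x. integral {0..x} v)" by (rule indefinite_integral_continuous_1[OF v_on])
      then have "(\<lambda>N. integral {0..q N} v) \<longlonglongrightarrow> integral {0..t} v"
        using q_lim
      proof (rule continuous_on_tendsto_compose)
        have "q N \<in> {0..T}" for N using t q_gt[of N] q_le[of N] by simp
        then show "\<forall>\<^sub>F N in sequentially. q N \<in> {0..T}" by (intro always_eventually allI)
      qed (use t in simp)
      then show ?thesis unfolding eq by (intro tendsto_intros)
    qed
    ultimately show ?thesis by (rule LIMSEQ_unique)
  qed
  with v_int inc' that show ?thesis by blast
qed

section \<open>Integrated objectives against integrated suprema\<close>

lemma integrable_inner_bounded:
  fixes f v :: "real \<Rightarrow> real^'a"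
  assumes f: "bounded_measurable T f" and v: "integrable L v"
  shows "integrable L (\<lambda>t. f t \<bullet> v t)"
proof -
  obtain B where B: "0 < B" "\<And>t. t \<in> {0..T} \<Longrightarrow> norm (f t) \<le> B"
    using bounded_measurable_bound[OF f] by blast
  have [measurable]: "f \<in> borel_measurable L" "v \<in> borel_measurable L"
    using f v by (auto simp: bounded_measurable_def)
  show ?thesis
  proof (rule Bochner_Integration.integrable_bound)
    show "integrable L (\<lambda>t. B * norm (v t))" using v by simp
    show "AE t in L. norm (f t \<bullet> v t) \<le> norm (B * norm (v t))"
    proof (rule AE_I2)
      fix t assume "t \<in> space L"
      then have "norm (f t) * norm (v t) \<le> B * norm (v t)"
        using B by (intro mult_right_mono) (auto simp: space_restrict_space)
      then show "norm (f t \<bullet> v t) \<le> norm (B * norm (v t))"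
        using Cauchy_Schwarz_ineq2[of "f t" "v t"] B by simp
    qed
  qed measurable
qed

lemma integrable_obj:
  assumes f: "bounded_measurable T f" and v: "integrable L v"
  shows "integrable L (\<lambda>t. obj E (r t) (v t) (f t))"
  unfolding obj_def
  by (rule Bochner_Integration.integrable_diff[OF integrable_inner_bounded[OF f v] integrable_cost[OF f]])

lemma LINT_obj:
  assumes f: "bounded_measurable T f" and v: "integrable L v"
  shows "(LINT t|L. obj E (r t) (v t) (f t)) =
    (LINT t|L. f t \<bullet> v t) - (LINT t|L. (\<Sum>e\<in>E. r t e * (exp (gr (f t) e) - 1)))"
  unfolding obj_def
  by (rule Bochner_Integration.integral_diff[OF integrable_inner_bounded[OF f v] integrable_cost[OF f]])

lemma LINT_obj_le_J:
  assumes f: "bounded_measurable T f" and v: "integrable L v"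
  shows "ereal (LINT t|L. obj E (r t) (v t) (f t)) \<le> enn2ereal (J v)"
proof -
  let ?f = "\<lambda>t. obj E (r t) (v t) (f t)"
  have i: "integrable L ?f" by (rule integrable_obj[OF f v])
  \<comment> \<open>\<open>J\<close> lives in \<open>ennreal\<close>, so the integrand is first
    replaced by its positive part; the pointwise supremum, being nonnegative, dominates that
    too.\<close>
  have "(LINT t|L. ?f t) \<le> (LINT t|L. max 0 (?f t))"
    by (rule integral_mono) (use i in auto)
  then have "ereal (LINT t|L. ?f t) \<le> enn2ereal (ennreal (LINT t|L. max 0 (?f t)))"
    by (simp add: enn2ereal_ennreal)
  also have "ennreal (LINT t|L. max 0 (?f t)) = (\<integral>\<^sup>+ t. ennreal (max 0 (?f t)) \<partial>L)"
    using i by (intro nn_integral_eq_integral[symmetric]) auto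
  also have "\<dots> \<le> J v"
    unfolding J_def
  proof (rule nn_integral_mono)
    fix t
    have "ereal (max 0 (?f t)) \<le> (SUP a. ereal (obj E (r t) (v t) a))"
      using SUP_obj_nonneg[of E "r t" "v t"] SUP_upper[of "f t" UNIV "\<lambda>a. ereal (obj E (r t) (v t) a)"]
      by (simp add: max_def flip: zero_ereal_def)
    then have "e2ennreal (ereal (max 0 (?f t))) \<le> e2ennreal (SUP a. ereal (obj E (r t) (v t) a))"
      by (rule e2ennreal_mono)
    then show "ennreal (max 0 (?f t)) \<le> e2ennreal (SUP a. ereal (obj E (r t) (v t) a))"
      by (simp only: e2ennreal_ereal)
  qed
  finally show ?thesis by (simp add: less_eq_ennreal.rep_eq)
qed

text \<open>The maximising paths have nonnegative values that increase pointwise, so monotone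
  convergence applies, also when \<open>J v\<close> is infinite.\<close>

lemma J_approx:
  assumes v: "integrable L v"
  obtains \<alpha> where "\<And>N. bounded_measurable T (\<alpha> N)"
    "incseq (\<lambda>N. ennreal (LINT t|L. obj E (r t) (v t) (\<alpha> N t)))"
    "\<And>N. 0 \<le> (LINT t|L. obj E (r t) (v t) (\<alpha> N t))"
    "J v = (SUP N. ennreal (LINT t|L. obj E (r t) (v t) (\<alpha> N t)))"
proof -
  have v_meas: "v \<in> borel_measurable L" using v by simp
  obtain \<alpha> where \<alpha>: "\<And>N. bounded_measurable T (\<alpha> N)"
    "\<And>t. incseq (\<lambda>N. obj E (r t) (v t) (\<alpha> N t))"
    "\<And>t. (SUP a. ereal (obj E (r t) (v t) a)) = (SUP N. ereal (obj E (r t) (v t) (\<alpha> N t)))"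
    "\<And>N t. 0 \<le> obj E (r t) (v t) (\<alpha> N t)"
    by (rule maximizing_paths[OF v_meas]) blast
  let ?f = "\<lambda>N t. obj E (r t) (v t) (\<alpha> N t)"
  have i: "integrable L (?f N)" for N by (rule integrable_obj[OF \<alpha>(1) v])
  have [measurable]: "?f N \<in> borel_measurable L" for N using i[of N] by simp
  have eq: "(\<integral>\<^sup>+ t. ennreal (?f N t) \<partial>L) = ennreal (LINT t|L. ?f N t)" for N
    using i \<alpha>(4) by (intro nn_integral_eq_integral) auto
  have "e2ennreal (SUP a. ereal (obj E (r t) (v t) a)) = (SUP N. ennreal (?f N t))" for t
  proof -
    have "(\<lambda>N. ereal (?f N t)) \<longlonglongrightarrow> (SUP N. ereal (?f N t))"
      using \<alpha>(2)[of t] by (intro LIMSEQ_SUP) (auto simp: incseq_def)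
    then have "(\<lambda>N. e2ennreal (ereal (?f N t))) \<longlonglongrightarrow> e2ennreal (SUP N. ereal (?f N t))"
      by (rule tendsto_e2ennrealI)
    then have "(\<lambda>N. ennreal (?f N t)) \<longlonglongrightarrow> e2ennreal (SUP N. ereal (?f N t))"
      by (simp add: e2ennreal_ereal)
    moreover have "(\<lambda>N. ennreal (?f N t)) \<longlonglongrightarrow> (SUP N. ennreal (?f N t))"
      using \<alpha>(2)[of t] by (intro LIMSEQ_SUP) (auto simp: incseq_def intro!: ennreal_leI)
    ultimately show ?thesis unfolding \<alpha>(3) by (rule LIMSEQ_unique)
  qed
  then have "J v = (\<integral>\<^sup>+ t. (SUP N. ennreal (?f N t)) \<partial>L)" by (simp add: J_def)
  also have "\<dots> = (SUP N. \<integral>\<^sup>+ t. ennreal (?f N t) \<partial>L)"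
  proof (rule nn_integral_monotone_convergence_SUP)
    show "incseq (\<lambda>N t. ennreal (?f N t))"
      using \<alpha>(2) by (auto simp: incseq_def le_fun_def intro!: ennreal_leI)
  qed measurable
  finally have "J v = (SUP N. ennreal (LINT t|L. ?f N t))" by (simp add: eq)
  moreover have "incseq (\<lambda>N. ennreal (LINT t|L. ?f N t))"
    using i \<alpha>(2) by (auto simp: incseq_def intro!: ennreal_leI integral_mono)
  moreover have "0 \<le> (LINT t|L. ?f N t)" for N using \<alpha>(4) by (intro integral_nonneg_AE) auto
  ultimately show ?thesis using that \<alpha>(1) by blast
qed

lemma LINT_obj_tendsto:
  assumes f: "bounded_measurable T f" and v: "integrable L v"
    and fn: "\<And>n. bounded_measurable T (fn n)" "\<And>n t. t \<in> {0..T} \<Longrightarrow> norm (fn n t) \<le> B"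
      "AE t in L. (\<lambda>n. fn n t) \<longlonglongrightarrow> f t"
  shows "(\<lambda>n. LINT t|L. obj E (r t) (v t) (fn n t)) \<longlonglongrightarrow> (LINT t|L. obj E (r t) (v t) (f t))"
proof (rule integral_dominated_convergence)
  let ?W = "\<lambda>t. B * norm (v t) + card E * (C * (exp (2 * B) + 1))"
  show "(\<lambda>t. obj E (r t) (v t) (f t)) \<in> borel_measurable L"
    using integrable_obj[OF f v] by (rule borel_measurable_integrable)
  show "(\<lambda>t. obj E (r t) (v t) (fn n t)) \<in> borel_measurable L" for n
    using integrable_obj[OF fn(1) v] by (rule borel_measurable_integrable)
  show "integrable L ?W"
    using v by (intro Bochner_Integration.integrable_add integrable_mult_right integrable_norm integrable_const_L)
  show "AE t in L. (\<lambda>n. obj E (r t) (v t) (fn n t)) \<longlonglongrightarrow> obj E (r t) (v t) (f t)"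
    using fn(3) by eventually_elim (auto simp: obj_def intro!: tendsto_intros)
  show "AE t in L. norm (obj E (r t) (v t) (fn n t)) \<le> ?W t" for n
    using r_bounds AE_space
  proof eventually_elim
    case (elim t)
    then have t: "t \<in> {0..T}" by (simp add: space_restrict_space)
    have "\<bar>fn n t \<bullet> v t\<bar> \<le> norm (fn n t) * norm (v t)" by (rule Cauchy_Schwarz_ineq2)
    also have "\<dots> \<le> B * norm (v t)" using fn(2)[OF t] by (intro mult_right_mono) auto
    finally have 1: "\<bar>fn n t \<bullet> v t\<bar> \<le> B * norm (v t)" .
    have "\<bar>\<Sum>e\<in>E. r t e * (exp (gr (fn n t) e) - 1)\<bar> \<le> (\<Sum>e\<in>E. \<bar>r t e * (exp (gr (fn n t) e) - 1)\<bar>)"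
      by (rule sum_abs)
    also have "\<dots> \<le> (\<Sum>e\<in>E. C * (exp (2 * B) + 1))"
    proof (rule sum_mono)
      fix e assume e: "e \<in> E"
      have "gr (fn n t) e \<le> 2 * B" using gr_bound[of "fn n t" e] fn(2)[OF t, of n] by simp
      then have "exp (gr (fn n t) e) \<le> exp (2 * B)" by simp
      then have "\<bar>exp (gr (fn n t) e) - 1\<bar> \<le> exp (2 * B) + 1"
        using exp_gt_zero[of "gr (fn n t) e"] by linarith
      then show "\<bar>r t e * (exp (gr (fn n t) e) - 1)\<bar> \<le> C * (exp (2 * B) + 1)"
        unfolding abs_mult using elim e by (intro mult_mono) auto
    qed
    finally have "\<bar>\<Sum>e\<in>E. r t e * (exp (gr (fn n t) e) - 1)\<bar> \<le> card E * (C * (exp (2 * B) + 1))" by simp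
    with 1 show ?case unfolding obj_def real_norm_def by linarith
  qed
qed

end

section \<open>Jump rates of the two chains\<close>

lemma compact_prob_vecs: "compact (prob_vecs :: (real^'a::finite) set)"
proof -
  have "closed (prob_vecs :: (real^'a) set)"
    unfolding prob_vecs_def
    by (intro closed_Collect_conj closed_Collect_all closed_Collect_le closed_Collect_eq continuous_intros)
  moreover have "bounded (prob_vecs :: (real^'a) set)"
    using prob_vecs_norm by (auto simp: bounded_iff)
  ultimately show ?thesis by (simp add: compact_eq_bounded_closed)
qed

lemma prob_vecs_component: "\<xi> \<in> prob_vecs \<Longrightarrow> 0 \<le> \<xi> $ x \<and> \<xi> $ x \<le> 1"
  for \<xi> :: "real^'a::finite"
  using member_le_sum[of x UNIV "\<lambda>x. \<xi> $ x"] by (auto simp: prob_vecs_def)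

lemma sum_over_edges:
  fixes f :: "'a::finite \<Rightarrow> 'a \<Rightarrow> real"
  shows "(\<Sum>x\<in>UNIV. \<Sum>x' | (x, x') \<in> E. f x x') = (\<Sum>e\<in>E. f (fst e) (snd e))"
    and "(\<Sum>x'\<in>UNIV. \<Sum>x | (x, x') \<in> E. f x x') = (\<Sum>e\<in>E. f (fst e) (snd e))"
proof -
  have 1: "(\<Sum>x\<in>UNIV. \<Sum>x' | (x, x') \<in> E. f x x') = (\<Sum>e\<in>E. f (fst e) (snd e))"
    by (subst sum.Sigma) (auto intro!: sum.cong simp: Sigma_def split_beta)
  then show "(\<Sum>x\<in>UNIV. \<Sum>x' | (x, x') \<in> E. f x x') = (\<Sum>e\<in>E. f (fst e) (snd e))" .
  have "(\<Sum>x'\<in>UNIV. \<Sum>x | (x, x') \<in> E. f x x') = (\<Sum>x\<in>UNIV. \<Sum>x' | (x, x') \<in> E. f x x')"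
    using sum.swap_restrict[of UNIV UNIV "\<lambda>x' x. f x x'" "\<lambda>x' x. (x, x') \<in> E"] by simp
  with 1 show "(\<Sum>x'\<in>UNIV. \<Sum>x | (x, x') \<in> E. f x x') = (\<Sum>e\<in>E. f (fst e) (snd e))" by simp
qed

definition rate_X where "rate_X lam \<xi> m e = lam_bar lam (fst e) (snd e) \<xi> m * \<xi> $ fst e"

definition rate_Y where "rate_Y gam \<xi> m e = gam (fst e) (snd e) \<xi> * m $ fst e"

lemma inner_Lambda_star: "\<alpha> \<bullet> Lambda_star E lam \<xi> m = (\<Sum>e\<in>E. rate_X lam \<xi> m e * gr \<alpha> e)"
proof -
  have "\<alpha> \<bullet> Lambda_star E lam \<xi> m =
      (\<Sum>x\<in>UNIV. \<Sum>x0 | (x0, x) \<in> E. \<alpha> $ x * (\<xi> $ x0 * lam_bar lam x0 x \<xi> m)) -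
      (\<Sum>x\<in>UNIV. \<Sum>x' | (x, x') \<in> E. \<alpha> $ x * (\<xi> $ x * lam_bar lam x x' \<xi> m))"
    by (simp add: inner_vec_def Lambda_star_def right_diff_distrib sum_subtractf sum_distrib_left)
  also have "\<dots> = (\<Sum>e\<in>E. rate_X lam \<xi> m e * gr \<alpha> e)"
    unfolding sum_over_edges sum_subtractf[symmetric]
    by (intro sum.cong refl) (simp add: rate_X_def gr_def algebra_simps)
  finally show ?thesis .
qed

lemma objective_X_eq: "objective_X E lam \<xi> m v \<alpha> = obj E (rate_X lam \<xi> m) v \<alpha>"
proof -
  have "(\<Sum>(x, x')\<in>E. tau (\<alpha> $ x' - \<alpha> $ x) * lam_bar lam x x' \<xi> m * \<xi> $ x) =
      (\<Sum>e\<in>E. rate_X lam \<xi> m e * (exp (gr \<alpha> e) - 1)) - (\<Sum>e\<in>E. rate_X lam \<xi> m e * gr \<alpha> e)"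
    unfolding sum_subtractf[symmetric]
    by (intro sum.cong refl) (simp add: rate_X_def gr_def tau_def split_beta algebra_simps)
  then show ?thesis
    unfolding objective_X_def obj_def inner_diff_right inner_Lambda_star by simp
qed

text \<open>The generator contributes exactly the linear term that \<open>tau\<close> subtracts,
  leaving \<open>exp u - 1\<close> on each edge.\<close>

lemma generator_tau_sum:
  "(\<Sum>y\<in>UNIV. (generator E gam \<xi> g y + (\<Sum>y' | (y, y') \<in> E. tau (g $ y' - g $ y) * gam y y' \<xi>)) * m $ y) =
    (\<Sum>e\<in>E. rate_Y gam \<xi> m e * (exp (gr g e) - 1))"
proof -
  have "(generator E gam \<xi> g y + (\<Sum>y' | (y, y') \<in> E. tau (g $ y' - g $ y) * gam y y' \<xi>)) * m $ y =
      (\<Sum>y' | (y, y') \<in> E. gam y y' \<xi> * m $ y * (exp (g $ y' - g $ y) - 1))" for y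
    unfolding generator_def sum.distrib[symmetric] sum_distrib_right
    by (intro sum.cong refl) (simp add: tau_def algebra_simps)
  then show ?thesis by (simp add: sum_over_edges rate_Y_def gr_def)
qed

lemma objective_Y_eq: "objective_Y E gam \<xi> m g = obj E (rate_Y gam \<xi> m) 0 g"
proof -
  have "objective_Y E gam \<xi> m g = - (\<Sum>y\<in>UNIV. (generator E gam \<xi> g y +
      (\<Sum>y' | (y, y') \<in> E. tau (g $ y' - g $ y) * gam y y' \<xi>)) * m $ y)"
    unfolding objective_Y_def sum_negf[symmetric] by (intro sum.cong refl) (simp add: algebra_simps)
  then show ?thesis unfolding generator_tau_sum by (simp add: obj_def)
qed

lemma borel_measurable_lebesgue_onI:
  "f \<in> borel_measurable borel \<Longrightarrow> f \<in> borel_measurable (lebesgue_on S)"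
  by (intro measurable_restrict_space1 measurable_completion) simp

text \<open>Sampling at the next node gives measurable functions, and they converge by
  right-continuity. At T the next node lies beyond the interval, so the value there is kept
  separately.\<close>

lemma cadlag_measurable:
  fixes f :: "real \<Rightarrow> 'b::{metric_space, second_countable_topology}"
  assumes f: "f \<in> cadlag T S" and T: "0 < T"
  shows "f \<in> borel_measurable (lebesgue_on {0..T})"
proof (rule borel_measurable_LIMSEQ_metric)
  define q where "q N t = grid T (Suc N) t + T / real (Suc N)" for N t
  have "(\<lambda>t. f (q N t)) \<in> borel_measurable borel" for N
    unfolding q_def by (rule grid_measurable[of "\<lambda>g. f (g + T / real (Suc N))"])
  then show "(\<lambda>t. if t < T then f (q N t) else f T) \<in> borel_measurable (lebesgue_on {0..T})" for N
    by (intro borel_measurable_lebesgue_onI measurable_If) auto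
  fix t assume "t \<in> space (lebesgue_on {0..T})"
  then have t: "t \<in> {0..T}" by (simp add: space_restrict_space)
  show "(\<lambda>N. if t < T then f (q N t) else f T) \<longlonglongrightarrow> f t"
  proof (cases "t < T")
    case True
    then have "(f \<longlongrightarrow> f t) (at_right t)" using f t by (auto simp: cadlag_def)
    then show ?thesis
      using True filterlim_compose[OF _ grid_next_at_right[OF T]] by (simp add: q_def)
  qed (use t in simp)
qed

lemma continuous_bounded_family:
  fixes F :: "'i \<Rightarrow> real^'a::finite \<Rightarrow> real"
  assumes "finite I" "\<And>i. i \<in> I \<Longrightarrow> continuous_on prob_vecs (F i)"
  obtains C where "0 < C" "\<And>i \<xi>. i \<in> I \<Longrightarrow> \<xi> \<in> prob_vecs \<Longrightarrow> F i \<xi> \<le> C"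
proof -
  have "bounded (\<Union>i\<in>I. F i ` prob_vecs)"
    using assms by (intro bounded_UN ballI compact_imp_bounded compact_continuous_image compact_prob_vecs) auto
  then obtain C where "0 < C" "\<And>x. x \<in> (\<Union>i\<in>I. F i ` prob_vecs) \<Longrightarrow> norm x \<le> C"
    unfolding bounded_pos by blast
  with that show ?thesis by force
qed

lemma lam_bar_bounds:
  assumes m: "m \<in> prob_vecs" and pos: "\<And>y. 0 < lam x x' \<xi> y"
  shows "0 < lam_bar lam x x' \<xi> m" "(\<And>y. lam x x' \<xi> y \<le> C) \<Longrightarrow> lam_bar lam x x' \<xi> m \<le> C"
proof -
  have m0: "\<And>y. 0 \<le> m $ y" "(\<Sum>y\<in>UNIV. m $ y) = 1" using m by (auto simp: prob_vecs_def)
  then have "\<exists>y. m $ y \<noteq> 0" by (metis sum.neutral zero_neq_one)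
  then obtain y where "0 < m $ y" using m0(1) by (metis less_eq_real_def)
  then show "0 < lam_bar lam x x' \<xi> m"
    unfolding lam_bar_def using pos m0(1) by (intro sum_pos2[of UNIV y])
      (auto intro!: mult_nonneg_nonneg mult_pos_pos intro: less_imp_le)
  assume "\<And>y. lam x x' \<xi> y \<le> C"
  then have "lam_bar lam x x' \<xi> m \<le> (\<Sum>y\<in>UNIV. C * m $ y)"
    unfolding lam_bar_def using m0(1) by (intro sum_mono mult_right_mono)
  then show "lam_bar lam x x' \<xi> m \<le> C" by (simp add: sum_distrib_left[symmetric] m0)
qed

text \<open>m is a parameter and \<theta> does not occur, so the given density and the one selected
  by \<open>SOME\<close> inside \<open>I_star\<close> are both instances; \<open>I_star_eq\<close>
  compares them.\<close>

locale mean_field_path =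
  fixes T :: real and E\<^sub>X :: "('x::finite \<times> 'x) set" and E\<^sub>Y :: "('y::finite \<times> 'y) set"
    and lam :: "'x \<Rightarrow> 'x \<Rightarrow> real^'x \<Rightarrow> 'y \<Rightarrow> real"
    and gam :: "'y \<Rightarrow> 'y \<Rightarrow> real^'x \<Rightarrow> real"
    and \<mu> :: "real \<Rightarrow> real^'x" and m :: "real \<Rightarrow> real^'y"
  assumes T_pos: "0 < T"
    and lam_cont: "\<And>x x' y. (x, x') \<in> E\<^sub>X \<Longrightarrow> continuous_on prob_vecs (\<lambda>\<xi>. lam x x' \<xi> y)"
    and lam_pos: "\<And>x x' \<xi> y. (x, x') \<in> E\<^sub>X \<Longrightarrow> \<xi> \<in> prob_vecs \<Longrightarrow> 0 < lam x x' \<xi> y"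
    and gam_cont: "\<And>y y'. (y, y') \<in> E\<^sub>Y \<Longrightarrow> continuous_on prob_vecs (gam y y')"
    and gam_pos: "\<And>y y' \<xi>. (y, y') \<in> E\<^sub>Y \<Longrightarrow> \<xi> \<in> prob_vecs \<Longrightarrow> 0 < gam y y' \<xi>"
    and \<mu>_cadlag: "\<mu> \<in> cadlag T prob_vecs"
    and m_meas: "m \<in> borel_measurable (lebesgue_on {0..T})"
    and m_prob: "AE t in lebesgue_on {0..T}. m t \<in> prob_vecs"
begin

lemma \<mu>_prob: "t \<in> {0..T} \<Longrightarrow> \<mu> t \<in> prob_vecs"
  using \<mu>_cadlag by (simp add: cadlag_def)

lemma \<mu>_meas: "\<mu> \<in> borel_measurable (lebesgue_on {0..T})"
  by (rule cadlag_measurable[OF \<mu>_cadlag T_pos])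

lemma compose_meas:
  assumes "continuous_on prob_vecs F"
  shows "(\<lambda>t. F (\<mu> t) :: real) \<in> borel_measurable (lebesgue_on {0..T})"
proof (rule measurable_compose[OF _ borel_measurable_continuous_on_restrict[OF assms]])
  show "\<mu> \<in> measurable (lebesgue_on {0..T}) (restrict_space borel prob_vecs)"
    by (rule measurable_restrict_space2[OF _ \<mu>_meas]) (use \<mu>_prob in \<open>auto simp: space_restrict_space\<close>)
qed

lemma flow_rates_X: "\<exists>C. flow_rates T E\<^sub>X (\<lambda>t. rate_X lam (\<mu> t) (m t)) C"
proof -
  obtain C where C: "0 < C" "\<And>i \<xi>. i \<in> E\<^sub>X \<times> (UNIV :: 'y set) \<Longrightarrow> \<xi> \<in> prob_vecs \<Longrightarrow>
      lam (fst (fst i)) (snd (fst i)) \<xi> (snd i) \<le> C"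
    by (rule continuous_bounded_family[of "E\<^sub>X \<times> (UNIV :: 'y set)"
          "\<lambda>i \<xi>. lam (fst (fst i)) (snd (fst i)) \<xi> (snd i)"]) (auto intro: lam_cont)
  note \<mu>_meas [measurable] m_meas [measurable]
  have "flow_rates T E\<^sub>X (\<lambda>t. rate_X lam (\<mu> t) (m t)) C"
  proof
    show "0 < T" by (rule T_pos)
    show "(\<lambda>t. rate_X lam (\<mu> t) (m t) e) \<in> borel_measurable (lebesgue_on {0..T})" if e: "e \<in> E\<^sub>X" for e
      unfolding rate_X_def lam_bar_def using e
      by (intro borel_measurable_times borel_measurable_sum compose_meas lam_cont
          borel_measurable_vec_nth' \<mu>_meas m_meas) auto
    show "AE t in lebesgue_on {0..T}. \<forall>e\<in>E\<^sub>X. 0 \<le> rate_X lam (\<mu> t) (m t) e \<and> rate_X lam (\<mu> t) (m t) e \<le> C"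
      using m_prob AE_space
    proof eventually_elim
      case (elim t)
      then have \<mu>t: "\<mu> t \<in> prob_vecs" by (intro \<mu>_prob) (simp add: space_restrict_space)
      show ?case
      proof
        fix e assume e: "e \<in> E\<^sub>X"
        have "0 < lam (fst e) (snd e) (\<mu> t) y" for y using e by (intro lam_pos \<mu>t) auto
        note * = lam_bar_bounds[where lam = lam and m = "m t", OF elim(1) this]
        have 1: "0 \<le> lam_bar lam (fst e) (snd e) (\<mu> t) (m t)" using *(1) by simp
        have 2: "lam_bar lam (fst e) (snd e) (\<mu> t) (m t) \<le> C"
          using C(2)[of "(e, _)"] e \<mu>t by (intro *(2)) auto
        show "0 \<le> rate_X lam (\<mu> t) (m t) e \<and> rate_X lam (\<mu> t) (m t) e \<le> C"
          using mult_mono[OF 2, of "\<mu> t $ fst e" 1] prob_vecs_component[OF \<mu>t, of "fst e"] 1 C(1)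
          by (simp add: rate_X_def)
      qed
    qed
  qed
  then show ?thesis ..
qed

lemma flow_rates_Y: "\<exists>C. flow_rates T E\<^sub>Y (\<lambda>t. rate_Y gam (\<mu> t) (m t)) C"
proof -
  obtain C where C: "0 < C" "\<And>e \<xi>. e \<in> E\<^sub>Y \<Longrightarrow> \<xi> \<in> prob_vecs \<Longrightarrow> gam (fst e) (snd e) \<xi> \<le> C"
    by (rule continuous_bounded_family[of E\<^sub>Y "\<lambda>e. gam (fst e) (snd e)"]) (auto intro: gam_cont)
  have "flow_rates T E\<^sub>Y (\<lambda>t. rate_Y gam (\<mu> t) (m t)) C"
  proof
    show "0 < T" by (rule T_pos)
    show "(\<lambda>t. rate_Y gam (\<mu> t) (m t) e) \<in> borel_measurable (lebesgue_on {0..T})" if e: "e \<in> E\<^sub>Y" for e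
      unfolding rate_Y_def using e
      by (intro borel_measurable_times compose_meas gam_cont borel_measurable_vec_nth' m_meas) auto
    show "AE t in lebesgue_on {0..T}. \<forall>e\<in>E\<^sub>Y. 0 \<le> rate_Y gam (\<mu> t) (m t) e \<and> rate_Y gam (\<mu> t) (m t) e \<le> C"
      using m_prob AE_space
    proof eventually_elim
      case (elim t)
      then have \<mu>t: "\<mu> t \<in> prob_vecs" by (intro \<mu>_prob) (simp add: space_restrict_space)
      show ?case
      proof
        fix e assume e: "e \<in> E\<^sub>Y"
        have "0 < gam (fst e) (snd e) (\<mu> t)" using e by (intro gam_pos \<mu>t) auto
        then show "0 \<le> rate_Y gam (\<mu> t) (m t) e \<and> rate_Y gam (\<mu> t) (m t) e \<le> C"
          using mult_mono[OF C(2)[OF e \<mu>t], of "m t $ fst e" 1] prob_vecs_component[OF elim(1), of "fst e"] C(1)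
          by (simp add: rate_Y_def)
      qed
    qed
  qed
  then show ?thesis ..
qed

end

lemma admissible_times:
  assumes "admissible T n tt A g" "i \<le> n + 1"
  shows "tt i \<in> {0..T}"
proof -
  have step: "tt i \<le> tt j" if "i \<le> j" "j \<le> n + 1" for i j
    using that
  proof (induction j rule: dec_induct)
    case (step j)
    then have "tt j < tt (j + 1)" using assms(1) by (auto simp: admissible_def)
    with step show ?case by simp
  qed simp
  show ?thesis using step[of 0 i] step[of i "n + 1"] assms by (auto simp: admissible_def)
qed

lemma bounded_measurable_step_path: "bounded_measurable T (step_path \<mu> n tt A)"
  unfolding bounded_measurable_def
proof
  show "step_path \<mu> n tt A \<in> borel_measurable (lebesgue_on {0..T})"
    unfolding step_path_def[abs_def] by (rule borel_measurable_lebesgue_onI) measurable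
  show "bounded (step_path \<mu> n tt A ` {0..T})"
    unfolding bounded_iff
  proof (intro exI ballI)
    fix a assume "a \<in> step_path \<mu> n tt A ` {0..T}"
    then obtain s where a: "a = step_path \<mu> n tt A s" by auto
    show "norm a \<le> (\<Sum>i=1..n+1. norm (A (i - 1) (\<mu> (tt (i - 1)))))"
      unfolding a step_path_def by (intro order_trans[OF norm_sum] sum_mono) (simp add: indicator_def)
  qed
qed

section \<open>The rate function\<close>

text \<open>Testing with a coordinate vector gives inflow minus outflow at x; this converts the
  Euler--Lagrange identity into balance equations at the vertices.\<close>

lemma sum_gr_axis:
  "(\<Sum>e\<in>E. f e * gr (axis x 1) e) = (\<Sum>x0 | (x0, x) \<in> E. f (x0, x)) - (\<Sum>x' | (x, x') \<in> E. f (x, x'))"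
proof -
  have "(\<Sum>e\<in>E. f e * gr (axis x 1) e) =
      (\<Sum>e\<in>E. f (fst e, snd e) * axis x 1 $ snd e) - (\<Sum>e\<in>E. f (fst e, snd e) * axis x 1 $ fst e)"
    unfolding sum_subtractf[symmetric] by (intro sum.cong refl) (simp add: gr_def right_diff_distrib)
  also have "(\<Sum>e\<in>E. f (fst e, snd e) * axis x 1 $ snd e) =
      (\<Sum>x'\<in>UNIV. \<Sum>x0 | (x0, x') \<in> E. f (x0, x') * axis x 1 $ x')"
    by (rule sum_over_edges(2)[symmetric])
  also have "\<dots> = (\<Sum>x'\<in>UNIV. if x' = x then (\<Sum>x0 | (x0, x') \<in> E. f (x0, x')) else 0)"
    by (intro sum.cong refl) (simp add: axis_def)
  also have "\<dots> = (\<Sum>x0 | (x0, x) \<in> E. f (x0, x))" by simp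
  also have "(\<Sum>e\<in>E. f (fst e, snd e) * axis x 1 $ fst e) =
      (\<Sum>y\<in>UNIV. \<Sum>x' | (y, x') \<in> E. f (y, x') * axis x 1 $ y)"
    by (rule sum_over_edges(1)[symmetric])
  also have "\<dots> = (\<Sum>y\<in>UNIV. if y = x then (\<Sum>x' | (y, x') \<in> E. f (y, x')) else 0)"
    by (intro sum.cong refl) (simp add: axis_def)
  also have "\<dots> = (\<Sum>x' | (x, x') \<in> E. f (x, x'))" by simp
  finally show ?thesis .
qed

context mean_field_path
begin

text \<open>A fixed choice, because the sublocale declaration needs a term for the bound.\<close>

definition C_X where "C_X = (SOME C. flow_rates T E\<^sub>X (\<lambda>t. rate_X lam (\<mu> t) (m t)) C)"
definition C_Y where "C_Y = (SOME C. flow_rates T E\<^sub>Y (\<lambda>t. rate_Y gam (\<mu> t) (m t)) C)"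

sublocale X: flow_rates T E\<^sub>X "\<lambda>t. rate_X lam (\<mu> t) (m t)" C_X
  unfolding C_X_def by (rule someI_ex[OF flow_rates_X])

sublocale Y: flow_rates T E\<^sub>Y "\<lambda>t. rate_Y gam (\<mu> t) (m t)" C_Y
  unfolding C_Y_def by (rule someI_ex[OF flow_rates_Y])

abbreviation cost_X :: "(real \<Rightarrow> real^'x) \<Rightarrow> real \<Rightarrow> real" where
  "cost_X f t \<equiv> \<Sum>e\<in>E\<^sub>X. rate_X lam (\<mu> t) (m t) e * (exp (gr (f t) e) - 1)"

abbreviation cost_Y :: "(real \<Rightarrow> real^'y) \<Rightarrow> real \<Rightarrow> real" where
  "cost_Y f t \<equiv> \<Sum>e\<in>E\<^sub>Y. rate_Y gam (\<mu> t) (m t) e * (exp (gr (f t) e) - 1)"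

lemma bounded_measurable_feedback:
  assumes g: "C1_on ({0..T} \<times> prob_vecs) (\<lambda>(t, u). g t u :: real^'y)"
  shows "bounded_measurable T (\<lambda>s. g s (\<mu> s))"
  unfolding bounded_measurable_def
proof
  have cont: "continuous_on ({0..T} \<times> prob_vecs) (\<lambda>(t, u). g t u)" by (rule C1_on_imp_continuous_on[OF g])
  have id: "(\<lambda>s::real. s) \<in> borel_measurable (lebesgue_on {0..T})"
    by (rule borel_measurable_lebesgue_onI) simp
  have "(\<lambda>s. (s, \<mu> s)) \<in> measurable (lebesgue_on {0..T}) (restrict_space borel ({0..T} \<times> prob_vecs))"
    by (rule measurable_restrict_space2[OF _ borel_measurable_Pair[OF id \<mu>_meas]])
      (use \<mu>_prob in \<open>auto simp: space_restrict_space\<close>)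
  from measurable_compose[OF this borel_measurable_continuous_on_restrict[OF cont]]
  show "(\<lambda>s. g s (\<mu> s)) \<in> borel_measurable (lebesgue_on {0..T})" by simp
  have "bounded ((\<lambda>(t, u). g t u) ` ({0..T} \<times> prob_vecs))"
    by (intro compact_imp_bounded compact_continuous_image[OF cont] compact_Times compact_prob_vecs) auto
  then show "bounded ((\<lambda>s. g s (\<mu> s)) ` {0..T})"
    by (rule bounded_subset) (use \<mu>_prob in force)
qed

text \<open>The drift cancels against the linear part of \<open>tau\<close>, but the two sit in
  separate integrals, so their common integrand \<open>lin\<close> must first be known to be
  integrable.\<close>

lemma U_functional_eq:
  assumes adm: "admissible T n tt A g"
  shows "U_functional T E\<^sub>X E\<^sub>Y lam gam \<mu> m n tt A g =
    (\<Sum>i=1..n+1. A (i - 1) (\<mu> (tt (i - 1))) \<bullet> (\<mu> (tt i) - \<mu> (tt (i - 1)))) -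
    (LINT t|lebesgue_on {0..T}. cost_X (step_path \<mu> n tt A) t) -
    (LINT t|lebesgue_on {0..T}. cost_Y (\<lambda>s. g s (\<mu> s)) t)"
proof -
  define a where "a = step_path \<mu> n tt A"
  have a: "bounded_measurable T a" unfolding a_def by (rule bounded_measurable_step_path)
  define lin where "lin t = (\<Sum>e\<in>E\<^sub>X. rate_X lam (\<mu> t) (m t) e * gr (a t) e)" for t
  have lin: "integrable (lebesgue_on {0..T}) lin" unfolding lin_def by (rule X.integrable_linear[OF a])
  have cost: "integrable (lebesgue_on {0..T}) (cost_X a)" by (rule X.integrable_cost[OF a])
  have 1: "(LINT s|lebesgue_on {0..T}. a s \<bullet> Lambda_star E\<^sub>X lam (\<mu> s) (m s)) = (LINT t|lebesgue_on {0..T}. lin t)"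
    unfolding inner_Lambda_star lin_def ..
  have "(\<Sum>(x, x')\<in>E\<^sub>X. tau (a s $ x' - a s $ x) * lam_bar lam x x' (\<mu> s) (m s) * \<mu> s $ x) = cost_X a s - lin s" for s
    unfolding lin_def sum_subtractf[symmetric]
    by (intro sum.cong refl) (simp add: rate_X_def gr_def tau_def split_beta algebra_simps)
  then have 2: "(LINT s|lebesgue_on {0..T}.
      (\<Sum>(x, x')\<in>E\<^sub>X. tau (a s $ x' - a s $ x) * lam_bar lam x x' (\<mu> s) (m s) * \<mu> s $ x)) =
      (LINT t|lebesgue_on {0..T}. cost_X a t) - (LINT t|lebesgue_on {0..T}. lin t)"
    using Bochner_Integration.integral_diff[OF cost lin] by simp
  show ?thesis
    unfolding U_functional_def Let_def a_def[symmetric] generator_tau_sum 1 2 by simp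
qed

lemma U_functional_cong:
  assumes m': "mean_field_path T E\<^sub>X E\<^sub>Y lam gam \<mu> m'" and eq: "AE t in lebesgue_on {0..T}. m' t = m t"
    and adm: "admissible T n tt A g"
  shows "U_functional T E\<^sub>X E\<^sub>Y lam gam \<mu> m' n tt A g = U_functional T E\<^sub>X E\<^sub>Y lam gam \<mu> m n tt A g"
proof -
  interpret M': mean_field_path T E\<^sub>X E\<^sub>Y lam gam \<mu> m' by (rule m')
  let ?a = "step_path \<mu> n tt A" and ?g = "\<lambda>s. g s (\<mu> s)"
  have g: "bounded_measurable T ?g"
    using adm by (intro bounded_measurable_feedback) (simp add: admissible_def)
  have "(LINT t|lebesgue_on {0..T}. M'.cost_X ?a t) = (LINT t|lebesgue_on {0..T}. cost_X ?a t)"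
  proof (rule integral_cong_AE)
    show "AE t in lebesgue_on {0..T}. M'.cost_X ?a t = cost_X ?a t"
      using eq by eventually_elim simp
  qed (rule borel_measurable_integrable[OF M'.X.integrable_cost[OF bounded_measurable_step_path]],
      rule borel_measurable_integrable[OF X.integrable_cost[OF bounded_measurable_step_path]])
  moreover have "(LINT t|lebesgue_on {0..T}. M'.cost_Y ?g t) = (LINT t|lebesgue_on {0..T}. cost_Y ?g t)"
  proof (rule integral_cong_AE)
    show "AE t in lebesgue_on {0..T}. M'.cost_Y ?g t = cost_Y ?g t"
      using eq by eventually_elim simp
  qed (rule borel_measurable_integrable[OF M'.Y.integrable_cost[OF g]],
      rule borel_measurable_integrable[OF Y.integrable_cost[OF g]])
  ultimately show ?thesis unfolding U_functional_eq[OF adm] M'.U_functional_eq[OF adm] by simp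
qed

lemma I_star_eq:
  assumes td: "time_density T \<theta> m"
  shows "I_star T E\<^sub>X E\<^sub>Y lam gam \<mu> \<theta> = (SUP (n, tt, A, g) \<in> {(n, tt, A, g). admissible T n tt A g}.
    ereal (U_functional T E\<^sub>X E\<^sub>Y lam gam \<mu> m n tt A g))"
proof -
  define m' where "m' = (SOME m. time_density T \<theta> m)"
  have td': "time_density T \<theta> m'" unfolding m'_def by (rule someI[of _ m]) (rule td)
  have "mean_field_path T E\<^sub>X E\<^sub>Y lam gam \<mu> m'"
    using td' by unfold_locales (auto simp: time_density_def intro: T_pos lam_cont lam_pos gam_cont gam_pos \<mu>_cadlag)
  note cong = U_functional_cong[OF this time_density_unique[OF td' td]]
  show ?thesis
    unfolding I_star_def m'_def[symmetric] by (rule SUP_cong[OF refl]) (auto simp: cong)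
qed

text \<open>N cells have \<open>N - 1\<close> interior nodes, which matches the n of an admissible
  pair. The maps ignore the state: the path is fixed, so constant maps already reach every step
  function on the grid.\<close>

lemma grid_admissible:
  assumes N: "0 < N" and p: "C1_on {0..T} p"
  shows "admissible T (N - 1) (\<lambda>i. real i * T / real N) (\<lambda>i _. \<alpha> (real i * T / real N)) (\<lambda>t _. p t)"
  unfolding admissible_def using N T_pos C1_on_fst[OF p]
  by (auto intro: divide_strict_right_mono)

text \<open>The cells are half-open, so at T the step path is 0 while rounding gives T itself; the
  discrepancy is confined to that null point.\<close>

lemma step_path_grid:
  assumes N: "0 < N" and s: "0 \<le> s" "s < T"
  shows "step_path \<mu> (N - 1) (\<lambda>i. real i * T / real N) (\<lambda>i _. \<alpha> (real i * T / real N)) s = \<alpha> (grid T N s)"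
proof -
  have N1: "N - 1 + 1 = N" using N by simp
  obtain k where k: "grid T N s = real k * T / real N"
    using grid_value[OF T_pos N, of s] s by auto
  have iff: "s < real j * T / real N \<longleftrightarrow> k < j" for j
    using grid_less_node[OF T_pos N, of s j] T_pos N by (simp add: k divide_less_cancel)
  have "k < N" using iff[of N] s N by simp
  have "step_path \<mu> (N - 1) (\<lambda>i. real i * T / real N) (\<lambda>i _. \<alpha> (real i * T / real N)) s =
      (\<Sum>j<N. indicator {real j * T / real N..<real (Suc j) * T / real N} s *\<^sub>R \<alpha> (real j * T / real N))"
    unfolding step_path_def N1 unfolding One_nat_def sum.atLeast1_atMost_eq by simp
  also have "\<dots> = (\<Sum>j<N. if j = k then \<alpha> (real j * T / real N) else 0)"
  proof (intro sum.cong refl)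
    fix j
    have "s \<in> {real j * T / real N..<real (Suc j) * T / real N} \<longleftrightarrow> j = k"
      using iff[of j] iff[of "Suc j"] by (auto simp del: of_nat_Suc simp: not_less[symmetric])
    then show "indicator {real j * T / real N..<real (Suc j) * T / real N} s *\<^sub>R \<alpha> (real j * T / real N) =
        (if j = k then \<alpha> (real j * T / real N) else 0)" by (simp add: indicator_def)
  qed
  also have "\<dots> = \<alpha> (grid T N s)" using \<open>k < N\<close> by (simp add: k)
  finally show ?thesis .
qed

lemma U_functional_grid:
  assumes N: "0 < N" and p: "C1_on {0..T} p"
  shows "U_functional T E\<^sub>X E\<^sub>Y lam gam \<mu> m (N - 1) (\<lambda>i. real i * T / real N)
      (\<lambda>i _. \<alpha> (real i * T / real N)) (\<lambda>t _. p t) =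
    X.grid_action \<mu> N \<alpha> - (LINT t|lebesgue_on {0..T}. cost_Y p t)"
proof -
  let ?a = "step_path \<mu> (N - 1) (\<lambda>i. real i * T / real N) (\<lambda>i _. \<alpha> (real i * T / real N))"
  have N1: "N - 1 + 1 = N" using N by simp
  have "(LINT t|lebesgue_on {0..T}. cost_X ?a t) = (LINT t|lebesgue_on {0..T}. cost_X (\<lambda>t. \<alpha> (grid T N t)) t)"
  proof (rule integral_cong_AE)
    show "AE t in lebesgue_on {0..T}. cost_X ?a t = cost_X (\<lambda>t. \<alpha> (grid T N t)) t"
    proof (rule AE_lebesgue_on_negligible[of "{T}"])
      fix t assume "t \<in> {0..T}" "t \<notin> {T}"
      then have "?a t = \<alpha> (grid T N t)" by (intro step_path_grid[OF N]) auto
      then show "cost_X ?a t = cost_X (\<lambda>t. \<alpha> (grid T N t)) t" by (simp only:)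
    qed simp_all
  qed (rule borel_measurable_integrable[OF X.integrable_cost[OF bounded_measurable_step_path]],
      rule borel_measurable_integrable[OF X.integrable_cost[OF bounded_measurable_grid[OF T_pos N]]])
  moreover have "(\<Sum>i=1..N - 1 + 1. \<alpha> (real (i - 1) * T / real N) \<bullet>
      (\<mu> (real i * T / real N) - \<mu> (real (i - 1) * T / real N))) = X.increments \<mu> N \<alpha>"
    unfolding N1 unfolding One_nat_def sum.atLeast1_atMost_eq X.increments_def by simp
  ultimately show ?thesis
    unfolding U_functional_eq[OF grid_admissible[OF N p]] X.grid_action_def by simp
qed

lemma grid_action_le_I_star:
  assumes td: "time_density T \<theta> m" and N: "0 < N" and p: "C1_on {0..T} p"
  shows "ereal (X.grid_action \<mu> N \<alpha> - (LINT t|lebesgue_on {0..T}. cost_Y p t)) \<le> I_star T E\<^sub>X E\<^sub>Y lam gam \<mu> \<theta>"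
  unfolding I_star_eq[OF td]
  by (rule SUP_upper2[of "(N - 1, \<lambda>i. real i * T / real N, \<lambda>i _. \<alpha> (real i * T / real N), \<lambda>t _. p t)"])
    (auto simp: grid_admissible[OF N p] U_functional_grid[OF N p] simp del: One_nat_def)

text \<open>With the control of the second chain equal to zero, finiteness of \<open>I_star\<close>
  bounds every grid action of the first, as the flux construction requires. The zero control gives
  \<open>0 \<le> K\<close>.\<close>

lemma I_star_finite:
  assumes td: "time_density T \<theta> m" and fin: "I_star T E\<^sub>X E\<^sub>Y lam gam \<mu> \<theta> < \<infinity>"
  obtains K where "0 \<le> K" "I_star T E\<^sub>X E\<^sub>Y lam gam \<mu> \<theta> = ereal K"
    "\<And>N \<alpha>. 0 < N \<Longrightarrow> X.grid_action \<mu> N \<alpha> \<le> K"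
proof -
  have C1: "C1_on {0..T} (\<lambda>t. 0 :: real^'y)" by (intro C1_on_polynomial) simp
  have le: "ereal (X.grid_action \<mu> N \<alpha>) \<le> I_star T E\<^sub>X E\<^sub>Y lam gam \<mu> \<theta>" if "0 < N" for N \<alpha>
    using grid_action_le_I_star[OF td that C1, of \<alpha>] by simp
  have "X.grid_action \<mu> 1 (\<lambda>_. 0) = 0" by (simp add: X.grid_action_def X.increments_def)
  with le[of 1 "\<lambda>_. 0"] have "0 \<le> I_star T E\<^sub>X E\<^sub>Y lam gam \<mu> \<theta>"
    by (simp add: zero_ereal_def)
  with fin obtain K where K: "I_star T E\<^sub>X E\<^sub>Y lam gam \<mu> \<theta> = ereal K" "0 \<le> K"
    by (cases "I_star T E\<^sub>X E\<^sub>Y lam gam \<mu> \<theta>") auto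
  show ?thesis by (rule that[OF K(2,1)]) (use le K in simp)
qed

lemma step_increments:
  assumes adm: "admissible T n tt A g" and v: "integrable (lebesgue_on {0..T}) v"
    and \<mu>: "\<And>t. t \<in> {0..T} \<Longrightarrow> \<mu> t = \<mu> 0 + integral {0..t} v"
  shows "(\<Sum>i=1..n+1. A (i - 1) (\<mu> (tt (i - 1))) \<bullet> (\<mu> (tt i) - \<mu> (tt (i - 1)))) =
    (LINT t|lebesgue_on {0..T}. step_path \<mu> n tt A t \<bullet> v t)"
proof -
  have before: "(LINT t|lebesgue_on {0..T}. (if t < q then c \<bullet> v t else 0)) = c \<bullet> (\<mu> q - \<mu> 0)"
    "integrable (lebesgue_on {0..T}) (\<lambda>t. if t < q then c \<bullet> v t else 0)" if q: "q \<in> {0..T}" for q c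
    using X.LINT_inner_before[OF v q, of c] \<mu>[OF q] by simp_all
  define c where "c i = A (i - 1) (\<mu> (tt (i - 1)))" for i
  let ?J = "\<lambda>i t. (if t < tt i then c i \<bullet> v t else 0) - (if t < tt (i - 1) then c i \<bullet> v t else 0)"
  have mem: "tt i \<in> {0..T}" "tt (i - 1) \<in> {0..T}" "tt (i - 1) \<le> tt i" if i: "i \<in> {1..n+1}" for i
  proof -
    show "tt i \<in> {0..T}" "tt (i - 1) \<in> {0..T}"
      using admissible_times[OF adm, of i] admissible_times[OF adm, of "i - 1"] i by auto
    obtain j where "i = Suc j" "j \<le> n" using i by (cases i) auto
    then show "tt (i - 1) \<le> tt i" using adm by (simp add: admissible_def less_imp_le)
  qed
  \<comment> \<open>The indicator of a half-open cell is a difference of two initial segments, the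
    form to which \<open>X.LINT_inner_before\<close> applies.\<close>
  have "step_path \<mu> n tt A t \<bullet> v t = (\<Sum>i=1..n+1. ?J i t)" for t
    unfolding step_path_def inner_sum_left c_def[symmetric]
    by (intro sum.cong refl) (use mem(3) in \<open>force simp: indicator_def\<close>)
  then have "(LINT t|lebesgue_on {0..T}. step_path \<mu> n tt A t \<bullet> v t) =
      (LINT t|lebesgue_on {0..T}. (\<Sum>i=1..n+1. ?J i t))" by simp
  also have "\<dots> = (\<Sum>i=1..n+1. LINT t|lebesgue_on {0..T}. ?J i t)"
    by (intro Bochner_Integration.integral_sum Bochner_Integration.integrable_diff before mem)
  also have "\<dots> = (\<Sum>i=1..n+1. c i \<bullet> (\<mu> (tt i) - \<mu> (tt (i - 1))))"
  proof (rule sum.cong[OF refl])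
    fix i assume i: "i \<in> {1..n+1}"
    have "(LINT t|lebesgue_on {0..T}. ?J i t) = c i \<bullet> (\<mu> (tt i) - \<mu> 0) - c i \<bullet> (\<mu> (tt (i - 1)) - \<mu> 0)"
      unfolding Bochner_Integration.integral_diff[OF before(2)[OF mem(1)[OF i]] before(2)[OF mem(2)[OF i]]]
        before(1)[OF mem(1)[OF i]] before(1)[OF mem(2)[OF i]] ..
    then show "(LINT t|lebesgue_on {0..T}. ?J i t) = c i \<bullet> (\<mu> (tt i) - \<mu> (tt (i - 1)))"
      by (simp add: inner_diff_right)
  qed
  finally show ?thesis by (simp add: c_def)
qed

text \<open>Along the fixed path every admissible pair is a pair of bounded measurable controls,
  which gives the upper bound by the pointwise suprema. Conversely bounded measurable pairs are
  boundedly approximated by grid controls and smooth time controls, so their values stay below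
  \<open>K\<close>.\<close>

lemma I_star_representation:
  assumes td: "time_density T \<theta> m" and fin: "I_star T E\<^sub>X E\<^sub>Y lam gam \<mu> \<theta> < \<infinity>"
  obtains v where "integrable (lebesgue_on {0..T}) v"
    "AE t in lebesgue_on {0..T}. (\<mu> has_vector_derivative v t) (at t)"
    "I_star T E\<^sub>X E\<^sub>Y lam gam \<mu> \<theta> = enn2ereal (X.J v + Y.J (\<lambda>_. 0))"
proof -
  obtain K where K: "0 \<le> K" "I_star T E\<^sub>X E\<^sub>Y lam gam \<mu> \<theta> = ereal K"
    "\<And>N \<alpha>. 0 < N \<Longrightarrow> X.grid_action \<mu> N \<alpha> \<le> K"
    by (rule I_star_finite[OF td fin]) blast
  have right: "(\<mu> \<longlongrightarrow> \<mu> t) (at_right t)" if "t \<in> {0..<T}" for t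
    using \<mu>_cadlag that by (simp add: cadlag_def)
  obtain v where v: "integrable (lebesgue_on {0..T}) v"
    and \<mu>: "\<And>t. t \<in> {0..T} \<Longrightarrow> \<mu> t = \<mu> 0 + integral {0..t} v"
    and inc: "\<And>N \<beta>. 0 < N \<Longrightarrow> X.increments \<mu> N \<beta> = (LINT t|lebesgue_on {0..T}. \<beta> (grid T N t) \<bullet> v t)"
    by (rule X.grid_density_exists[OF K(3) right]) blast+
  have zero: "integrable (lebesgue_on {0..T}) (\<lambda>_. 0 :: real^'y)" by simp
  let ?JX = "\<lambda>f. LINT t|lebesgue_on {0..T}. obj E\<^sub>X (rate_X lam (\<mu> t) (m t)) (v t) (f t)"
  let ?JY = "\<lambda>f. LINT t|lebesgue_on {0..T}. obj E\<^sub>Y (rate_Y gam (\<mu> t) (m t)) 0 (f t)"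
  have JY: "?JY f = - (LINT t|lebesgue_on {0..T}. cost_Y f t)" if "bounded_measurable T f" for f
    using Y.LINT_obj[OF that zero] by simp
  have upper: "I_star T E\<^sub>X E\<^sub>Y lam gam \<mu> \<theta> \<le> enn2ereal (X.J v + Y.J (\<lambda>_. 0))"
    unfolding I_star_eq[OF td]
  proof (rule SUP_least, clarify)
    fix n tt A and g :: "real \<Rightarrow> real^'x \<Rightarrow> real^'y" assume adm: "admissible T n tt A g"
    have g: "bounded_measurable T (\<lambda>s. g s (\<mu> s))"
      using adm by (intro bounded_measurable_feedback) (simp add: admissible_def)
    have "U_functional T E\<^sub>X E\<^sub>Y lam gam \<mu> m n tt A g = ?JX (step_path \<mu> n tt A) + ?JY (\<lambda>s. g s (\<mu> s))"
      using U_functional_eq[OF adm] step_increments[OF adm v \<mu>] JY[OF g]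
        X.LINT_obj[OF bounded_measurable_step_path v, of \<mu> n tt A] by linarith
    then have "ereal (U_functional T E\<^sub>X E\<^sub>Y lam gam \<mu> m n tt A g) =
        ereal (?JX (step_path \<mu> n tt A)) + ereal (?JY (\<lambda>s. g s (\<mu> s)))" by simp
    also have "\<dots> \<le> enn2ereal (X.J v) + enn2ereal (Y.J (\<lambda>_. 0))"
      by (intro add_mono X.LINT_obj_le_J[OF bounded_measurable_step_path v] Y.LINT_obj_le_J[OF g zero])
    finally show "ereal (U_functional T E\<^sub>X E\<^sub>Y lam gam \<mu> m n tt A g) \<le> enn2ereal (X.J v + Y.J (\<lambda>_. 0))"
      by (simp add: plus_ennreal.rep_eq)
  qed
  have lower: "?JX f + ?JY g \<le> K" if f: "bounded_measurable T f" and g: "bounded_measurable T g"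
    for f :: "real \<Rightarrow> real^'x" and g :: "real \<Rightarrow> real^'y"
  proof -
    obtain p N B where p: "\<And>n. 0 < N n" "\<And>n t. t \<in> {0..T} \<Longrightarrow> norm (p n (grid T (N n) t)) \<le> B"
      "AE t in lebesgue_on {0..T}. (\<lambda>n. p n (grid T (N n) t)) \<longlonglongrightarrow> f t"
      by (rule bounded_measurable_grid_approx[OF f T_pos]) blast
    obtain q B' where q: "\<And>n. C1_on {0..T} (q n)" "\<And>n t. t \<in> {0..T} \<Longrightarrow> norm (q n t) \<le> B'"
      "AE t in lebesgue_on {0..T}. (\<lambda>n. q n t) \<longlonglongrightarrow> g t"
      by (rule bounded_measurable_C1_approx[OF g]) blast
    have p_bm: "bounded_measurable T (\<lambda>t. p n (grid T (N n) t))" for n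
      by (rule bounded_measurable_grid[OF T_pos p(1)])
    have q_bm: "bounded_measurable T (q n)" for n
      unfolding bounded_measurable_def bounded_iff
      using X.C1_measurable[OF q(1)] q(2) by (intro conjI exI[of _ B']) auto
    have "(\<lambda>n. ?JX (\<lambda>t. p n (grid T (N n) t)) + ?JY (q n)) \<longlonglongrightarrow> ?JX f + ?JY g"
      by (intro tendsto_add X.LINT_obj_tendsto[OF f v p_bm p(2,3)] Y.LINT_obj_tendsto[OF g zero q_bm q(2,3)])
    moreover have "?JX (\<lambda>t. p n (grid T (N n) t)) + ?JY (q n) \<le> K" for n
    proof -
      have "?JX (\<lambda>t. p n (grid T (N n) t)) + ?JY (q n) =
          X.grid_action \<mu> (N n) (p n) - (LINT t|lebesgue_on {0..T}. cost_Y (q n) t)"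
        unfolding X.LINT_obj[OF p_bm v] JY[OF q_bm] X.grid_action_def inc[OF p(1)] by simp
      also have "\<dots> \<le> K" using grid_action_le_I_star[OF td p(1) q(1), of n "p n" n] K(2) by simp
      finally show ?thesis .
    qed
    ultimately show ?thesis by (intro LIMSEQ_le_const2) auto
  qed
  obtain \<alpha> where \<alpha>: "\<And>N. bounded_measurable T (\<alpha> N)" "incseq (\<lambda>N. ennreal (?JX (\<alpha> N)))"
    "\<And>N. 0 \<le> ?JX (\<alpha> N)" "X.J v = (SUP N. ennreal (?JX (\<alpha> N)))"
    by (rule X.J_approx[OF v]) blast
  obtain \<beta> where \<beta>: "\<And>N. bounded_measurable T (\<beta> N)" "incseq (\<lambda>N. ennreal (?JY (\<beta> N)))"
    "\<And>N. 0 \<le> ?JY (\<beta> N)" "Y.J (\<lambda>_. 0) = (SUP N. ennreal (?JY (\<beta> N)))"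
    by (rule Y.J_approx[OF zero]) blast
  \<comment> \<open>Both sequences of values increase, so a single index N exhausts the two suprema
    simultaneously.\<close>
  have "X.J v + Y.J (\<lambda>_. 0) = (SUP N. ennreal (?JX (\<alpha> N)) + ennreal (?JY (\<beta> N)))"
    unfolding \<alpha>(4) \<beta>(4) using \<alpha>(2) \<beta>(2) by (rule ennreal_SUP_add[symmetric])
  also have "\<dots> \<le> ennreal K"
  proof (rule SUP_least)
    fix N
    show "ennreal (?JX (\<alpha> N)) + ennreal (?JY (\<beta> N)) \<le> ennreal K"
      unfolding ennreal_plus[OF \<alpha>(3) \<beta>(3), symmetric] by (rule ennreal_leI[OF lower[OF \<alpha>(1) \<beta>(1)]])
  qed
  finally have "enn2ereal (X.J v + Y.J (\<lambda>_. 0)) \<le> enn2ereal (ennreal K)" unfolding less_eq_ennreal.rep_eq .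
  then have "enn2ereal (X.J v + Y.J (\<lambda>_. 0)) \<le> I_star T E\<^sub>X E\<^sub>Y lam gam \<mu> \<theta>"
    using K(1) by (simp add: K(2) enn2ereal_ennreal)
  with upper have "I_star T E\<^sub>X E\<^sub>Y lam gam \<mu> \<theta> = enn2ereal (X.J v + Y.J (\<lambda>_. 0))" by (rule antisym)
  moreover have "AE t in lebesgue_on {0..T}. (\<mu> has_vector_derivative v t) (at t)"
    by (rule indefinite_integral_derivative_AE[OF integrable_on_lebesgue_on[OF v] \<mu>]) simp_all
  ultimately show ?thesis using that v by blast
qed

end

section \<open>The representation theorem\<close>

lemma (in flow_rates) finite_SUP_AE:
  assumes v: "v \<in> borel_measurable L" and fin: "J v < \<infinity>"
  shows "AE t in L. (SUP a. ereal (obj E (r t) (v t) a)) < \<infinity>"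
proof -
  have [measurable]: "(\<lambda>t. SUP a. ereal (obj E (r t) (v t) a)) \<in> borel_measurable L"
    by (rule SUP_obj_measurable[OF v])
  have "AE t in L. e2ennreal (SUP a. ereal (obj E (r t) (v t) a)) \<noteq> \<infinity>"
    using fin unfolding J_def by (intro nn_integral_PInf_AE) auto
  then show ?thesis
  proof eventually_elim
    case (elim t)
    then show ?case by (cases "SUP a. ereal (obj E (r t) (v t) a)") auto
  qed
qed

text \<open>The optimal flow is \<open>r * (1 + h)\<close>; moving its part without h to the other
  side produces the drift term.\<close>

lemma (in flow_rates) LINT_Euler_Lagrange:
  assumes \<alpha>: "bounded_measurable T \<alpha>" and v: "v \<in> borel_measurable L"
    and h: "\<And>e. e \<in> E \<Longrightarrow> (\<lambda>t. h (t, e)) \<in> borel_measurable L"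
    and EL: "AE t in L. \<forall>\<beta>. \<beta> \<bullet> v t = (\<Sum>e\<in>E. r t e * (1 + h (t, e)) * gr \<beta> e)"
  shows "(LINT t|L. (\<Sum>e\<in>E. h (t, e) * gr (\<alpha> t) e * r t e)) =
    (LINT t|L. \<alpha> t \<bullet> v t - (\<Sum>e\<in>E. r t e * gr (\<alpha> t) e))"
proof (rule integral_cong_AE)
  have a: "\<alpha> \<in> borel_measurable L" using \<alpha> by (simp add: bounded_measurable_def)
  show "(\<lambda>t. \<Sum>e\<in>E. h (t, e) * gr (\<alpha> t) e * r t e) \<in> borel_measurable L"
    by (intro sum_meas borel_measurable_times h gr_measurable a r_meas)
  show "(\<lambda>t. \<alpha> t \<bullet> v t - (\<Sum>e\<in>E. r t e * gr (\<alpha> t) e)) \<in> borel_measurable L"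
    by (intro borel_measurable_diff borel_measurable_inner a v sum_meas borel_measurable_times gr_measurable r_meas)
  show "AE t in L. (\<Sum>e\<in>E. h (t, e) * gr (\<alpha> t) e * r t e) = \<alpha> t \<bullet> v t - (\<Sum>e\<in>E. r t e * gr (\<alpha> t) e)"
    using EL
  proof eventually_elim
    case (elim t)
    then have "\<alpha> t \<bullet> v t = (\<Sum>e\<in>E. r t e * (1 + h (t, e)) * gr (\<alpha> t) e)" by blast
    then show ?case by (simp add: algebra_simps sum.distrib)
  qed
qed

lemma AE_choice: "(AE t in N. \<exists>a. P t a) \<Longrightarrow> \<exists>f. AE t in N. P t (f t)"
  by (rule exI[of _ "\<lambda>t. SOME a. P t a"]) (auto elim!: eventually_mono intro: someI)

theorem theorem5p3:
  fixes E\<^sub>X :: "('x::finite \<times> 'x) set" and E\<^sub>Y :: "('y::finite \<times> 'y) set"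
    and lam :: "'x \<Rightarrow> 'x \<Rightarrow> real^'x \<Rightarrow> 'y \<Rightarrow> real"
    and gam :: "'y \<Rightarrow> 'y \<Rightarrow> real^'x \<Rightarrow> real"
    and T :: real
    and \<mu> :: "real \<Rightarrow> real^'x" and \<theta> m :: "real \<Rightarrow> real^'y"
  assumes "irrefl E\<^sub>X" "irrefl E\<^sub>Y"
    and "irreducible_digraph E\<^sub>X" "irreducible_digraph E\<^sub>Y"
    and "\<And>x x' y. (x, x') \<in> E\<^sub>X \<Longrightarrow> \<exists>L. L-lipschitz_on prob_vecs (\<lambda>\<xi>. lam x x' \<xi> y)"
    and "\<And>x x' y. (x, x') \<in> E\<^sub>X \<Longrightarrow> 0 < (INF \<xi>\<in>prob_vecs. ereal (lam x x' \<xi> y))"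
    and "\<And>y y'. (y, y') \<in> E\<^sub>Y \<Longrightarrow> continuous_on prob_vecs (gam y y')"
    and "\<And>y y'. (y, y') \<in> E\<^sub>Y \<Longrightarrow> 0 < (INF \<xi>\<in>prob_vecs. ereal (gam y y' \<xi>))"
    and "0 < T"
    and "\<mu> \<in> cadlag T prob_vecs" "\<theta> \<in> cadlag_up T"
    and "I_star T E\<^sub>X E\<^sub>Y lam gam \<mu> \<theta> < \<infinity>"
    and "time_density T \<theta> m"
  shows
    "(AE t in lebesgue_on {0..T}. \<mu> differentiable (at t)) \<and>
     integrable (lebesgue_on {0..T}) (\<lambda>t. vector_derivative \<mu> (at t)) \<and>
     I_star T E\<^sub>X E\<^sub>Y lam gam \<mu> \<theta> = enn2ereal (\<integral>\<^sup>+ t.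
        (e2ennreal (SUP \<alpha>. ereal (objective_X E\<^sub>X lam (\<mu> t) (m t) (vector_derivative \<mu> (at t)) \<alpha>)) +
         e2ennreal (SUP g. ereal (objective_Y E\<^sub>Y gam (\<mu> t) (m t) g))) \<partial>lebesgue_on {0..T}) \<and>
     (\<exists>hX hY.
       hX \<in> H_closure T (rho_X T E\<^sub>X lam \<mu> m) \<and> hY \<in> H_closure T (rho_Y T E\<^sub>Y gam \<mu> m) \<and>
       hX \<in> orlicz_space (rho_X T E\<^sub>X lam \<mu> m) young_tau \<and>
       hY \<in> orlicz_space (rho_Y T E\<^sub>Y gam \<mu> m) young_tau \<and>
       (\<forall>\<alpha>. bounded_measurable T \<alpha> \<longrightarrow>
          (LINT t|lebesgue_on {0..T}. (\<Sum>(x, x')\<in>E\<^sub>X.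
             hX (t, x, x') * (\<alpha> t $ x' - \<alpha> t $ x) * lam_bar lam x x' (\<mu> t) (m t) * \<mu> t $ x)) =
          (LINT t|lebesgue_on {0..T}.
             \<alpha> t \<bullet> (vector_derivative \<mu> (at t) - Lambda_star E\<^sub>X lam (\<mu> t) (m t)))) \<and>
       (\<forall>g. bounded_measurable T g \<longrightarrow>
          (LINT t|lebesgue_on {0..T}. (\<Sum>(y, y')\<in>E\<^sub>Y.
             hY (t, y, y') * (g t $ y' - g t $ y) * gam y y' (\<mu> t) * m t $ y)) =
          - (LINT t|lebesgue_on {0..T}. (\<Sum>(y, y')\<in>E\<^sub>Y.
             (g t $ y' - g t $ y) * gam y y' (\<mu> t) * m t $ y))) \<and>
       I_star T E\<^sub>X E\<^sub>Y lam gam \<mu> \<theta> = enn2ereal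
         ((\<integral>\<^sup>+ t. (\<Sum>(x, x')\<in>E\<^sub>X. e2ennreal (tau_star (hX (t, x, x'))) *
             ennreal (lam_bar lam x x' (\<mu> t) (m t) * \<mu> t $ x)) \<partial>lebesgue_on {0..T}) +
          (\<integral>\<^sup>+ t. (\<Sum>(y, y')\<in>E\<^sub>Y. e2ennreal (tau_star (hY (t, y, y'))) *
             ennreal (gam y y' (\<mu> t) * m t $ y)) \<partial>lebesgue_on {0..T}))) \<and>
     (0 < (INF t\<in>{0..T}. ereal (MIN x. \<mu> t $ x)) \<longrightarrow>
     0 < (INF t\<in>{0..T}. ereal (MIN y. m t $ y)) \<longrightarrow>
     (\<exists>(\<alpha>h :: real \<Rightarrow> real^'x) (gh :: real \<Rightarrow> real^'y). AE t in lebesgue_on {0..T}.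
       (SUP \<alpha>. ereal (objective_X E\<^sub>X lam (\<mu> t) (m t) (vector_derivative \<mu> (at t)) \<alpha>)) =
         ereal (objective_X E\<^sub>X lam (\<mu> t) (m t) (vector_derivative \<mu> (at t)) (\<alpha>h t)) \<and>
       (SUP g. ereal (objective_Y E\<^sub>Y gam (\<mu> t) (m t) g)) =
         ereal (objective_Y E\<^sub>Y gam (\<mu> t) (m t) (gh t)) \<and>
       (\<forall>x. vector_derivative \<mu> (at t) $ x - Lambda_star E\<^sub>X lam (\<mu> t) (m t) $ x
          + \<mu> t $ x * (\<Sum>x' | (x, x') \<in> E\<^sub>X.
              (exp (\<alpha>h t $ x' - \<alpha>h t $ x) - 1) * lam_bar lam x x' (\<mu> t) (m t))
          - (\<Sum>x0 | (x0, x) \<in> E\<^sub>X.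
              \<mu> t $ x0 * (exp (\<alpha>h t $ x - \<alpha>h t $ x0) - 1) * lam_bar lam x0 x (\<mu> t) (m t)) = 0) \<and>
       (\<forall>y. m t $ y * (\<Sum>y' | (y, y') \<in> E\<^sub>Y. exp (gh t $ y' - gh t $ y) * gam y y' (\<mu> t))
          - (\<Sum>y0 | (y0, y) \<in> E\<^sub>Y. m t $ y0 * exp (gh t $ y - gh t $ y0) * gam y0 y (\<mu> t)) = 0)))"
proof -
  have lam_pos: "0 < lam x x' \<xi> y" if "(x, x') \<in> E\<^sub>X" "\<xi> \<in> prob_vecs" for x x' \<xi> y
  proof -
    have "(INF \<xi>\<in>prob_vecs. ereal (lam x x' \<xi> y)) \<le> ereal (lam x x' \<xi> y)" using that by (intro INF_lower)
    with assms(6)[OF that(1), of y] have "0 < ereal (lam x x' \<xi> y)" by (rule less_le_trans)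
    then show ?thesis by simp
  qed
  have gam_pos: "0 < gam y y' \<xi>" if "(y, y') \<in> E\<^sub>Y" "\<xi> \<in> prob_vecs" for y y' \<xi>
  proof -
    have "(INF \<xi>\<in>prob_vecs. ereal (gam y y' \<xi>)) \<le> ereal (gam y y' \<xi>)" using that by (intro INF_lower)
    with assms(8)[OF that(1)] have "0 < ereal (gam y y' \<xi>)" by (rule less_le_trans)
    then show ?thesis by simp
  qed
  have lam_cont: "continuous_on prob_vecs (\<lambda>\<xi>. lam x x' \<xi> y)" if "(x, x') \<in> E\<^sub>X" for x x' y
    using assms(5)[OF that, of y] lipschitz_on_continuous_on by blast
  interpret mean_field_path T E\<^sub>X E\<^sub>Y lam gam \<mu> m
    using assms(13) by unfold_locales
      (auto simp: time_density_def intro: assms(9,7,10) lam_cont lam_pos gam_pos)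
  let ?L = "lebesgue_on {0..T}" and ?I = "I_star T E\<^sub>X E\<^sub>Y lam gam \<mu> \<theta>"
  obtain v where v: "integrable ?L v" and \<mu>': "AE t in ?L. (\<mu> has_vector_derivative v t) (at t)"
    and I: "?I = enn2ereal (X.J v + Y.J (\<lambda>_. 0))"
    by (rule I_star_representation[OF assms(13,12)]) blast
  have v_meas: "v \<in> borel_measurable ?L" using v by simp
  have zero_meas: "(\<lambda>_. 0 :: real^'y) \<in> borel_measurable ?L" by simp
  \<comment> \<open>In \<open>ennreal\<close> a finite sum has finite summands, so the two chains
    can be treated separately from here on.\<close>
  have J_fin: "X.J v < \<infinity>" "Y.J (\<lambda>_. 0) < \<infinity>"
  proof -
    have "X.J v + Y.J (\<lambda>_. 0) \<noteq> top"
      using assms(12) unfolding I by (metis enn2ereal_top less_irrefl top_ereal_def infinity_ereal_def)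
    then show "X.J v < \<infinity>" "Y.J (\<lambda>_. 0) < \<infinity>" by (auto simp: less_top)
  qed
  have v_eq: "AE t in ?L. v t = vector_derivative \<mu> (at t)"
    using \<mu>' by eventually_elim (simp add: vector_derivative_at)
  have v'_meas: "(\<lambda>t. vector_derivative \<mu> (at t)) \<in> borel_measurable ?L"
    by (rule borel_measurable_lebesgue_on_AE[OF v_meas _ v_eq]) simp
  have c1: "AE t in ?L. \<mu> differentiable (at t)"
    using \<mu>' by eventually_elim (rule differentiableI_vector)
  have c2: "integrable ?L (\<lambda>t. vector_derivative \<mu> (at t))"
    by (rule integrable_cong_AE_imp[OF v v'_meas]) (use v_eq in \<open>auto elim!: eventually_mono\<close>)
  have c3: "?I = enn2ereal (\<integral>\<^sup>+ t.
      (e2ennreal (SUP \<alpha>. ereal (objective_X E\<^sub>X lam (\<mu> t) (m t) (vector_derivative \<mu> (at t)) \<alpha>)) +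
       e2ennreal (SUP g. ereal (objective_Y E\<^sub>Y gam (\<mu> t) (m t) g))) \<partial>?L)"
  proof -
    \<comment> \<open>The supremum runs over uncountably many potentials; its measurability comes
      from the countable dense family behind \<open>X.SUP_obj_measurable\<close>.\<close>
    have mX: "(\<lambda>t. e2ennreal (SUP a. ereal (obj E\<^sub>X (rate_X lam (\<mu> t) (m t)) (v t) a))) \<in> borel_measurable ?L"
      by (rule measurable_compose[OF X.SUP_obj_measurable[OF v_meas] measurable_e2ennreal])
    have mY: "(\<lambda>t. e2ennreal (SUP a. ereal (obj E\<^sub>Y (rate_Y gam (\<mu> t) (m t)) 0 a))) \<in> borel_measurable ?L"
      by (rule measurable_compose[OF Y.SUP_obj_measurable[OF zero_meas] measurable_e2ennreal])
    have "X.J v + Y.J (\<lambda>_. 0) = (\<integral>\<^sup>+ t.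
        (e2ennreal (SUP a. ereal (obj E\<^sub>X (rate_X lam (\<mu> t) (m t)) (v t) a)) +
         e2ennreal (SUP a. ereal (obj E\<^sub>Y (rate_Y gam (\<mu> t) (m t)) 0 a))) \<partial>?L)"
      unfolding X.J_def Y.J_def by (rule nn_integral_add[OF mX mY, symmetric])
    also have "\<dots> = (\<integral>\<^sup>+ t.
      (e2ennreal (SUP \<alpha>. ereal (objective_X E\<^sub>X lam (\<mu> t) (m t) (vector_derivative \<mu> (at t)) \<alpha>)) +
       e2ennreal (SUP g. ereal (objective_Y E\<^sub>Y gam (\<mu> t) (m t) g))) \<partial>?L)"
      unfolding objective_X_eq objective_Y_eq
      by (rule nn_integral_cong_AE) (use v_eq in \<open>auto elim!: eventually_mono\<close>)
    finally show ?thesis unfolding I by simp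
  qed
  have rhoX: "rho_X T E\<^sub>X lam \<mu> m = X.M"
    by (simp add: rho_X_def X.M_def rate_X_def case_prod_beta')
  have rhoY: "rho_Y T E\<^sub>Y gam \<mu> m = Y.M"
    by (simp add: rho_Y_def Y.M_def rate_Y_def case_prod_beta')
  obtain hX where hX: "hX \<in> H_closure T X.M" "\<And>e. e \<in> E\<^sub>X \<Longrightarrow> (\<lambda>t. hX (t, e)) \<in> borel_measurable ?L"
    "AE t in ?L. \<forall>\<beta>. \<beta> \<bullet> v t = (\<Sum>e\<in>E\<^sub>X. rate_X lam (\<mu> t) (m t) e * (1 + hX (t, e)) * gr \<beta> e)"
    "X.J v = (\<integral>\<^sup>+ t. (\<Sum>e\<in>E\<^sub>X. e2ennreal (tau_star (hX (t, e))) * ennreal (rate_X lam (\<mu> t) (m t) e)) \<partial>?L)"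
    by (rule X.flow_optimum[OF v_meas J_fin(1)]) blast
  obtain hY where hY: "hY \<in> H_closure T Y.M" "\<And>e. e \<in> E\<^sub>Y \<Longrightarrow> (\<lambda>t. hY (t, e)) \<in> borel_measurable ?L"
    "AE t in ?L. \<forall>\<beta>. \<beta> \<bullet> 0 = (\<Sum>e\<in>E\<^sub>Y. rate_Y gam (\<mu> t) (m t) e * (1 + hY (t, e)) * gr \<beta> e)"
    "Y.J (\<lambda>_. 0) = (\<integral>\<^sup>+ t. (\<Sum>e\<in>E\<^sub>Y. e2ennreal (tau_star (hY (t, e))) * ennreal (rate_Y gam (\<mu> t) (m t) e)) \<partial>?L)"
    by (rule Y.flow_optimum[OF zero_meas J_fin(2)]) blast
  have orlicz: "hX \<in> orlicz_space X.M young_tau" "hY \<in> orlicz_space Y.M young_tau"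
    using hX(1) hY(1) by (auto simp: H_closure_def)
  have dX: "(LINT t|?L. (\<Sum>(x, x')\<in>E\<^sub>X.
        hX (t, x, x') * (\<alpha> t $ x' - \<alpha> t $ x) * lam_bar lam x x' (\<mu> t) (m t) * \<mu> t $ x)) =
      (LINT t|?L. \<alpha> t \<bullet> (vector_derivative \<mu> (at t) - Lambda_star E\<^sub>X lam (\<mu> t) (m t)))"
    if \<alpha>: "bounded_measurable T \<alpha>" for \<alpha>
  proof -
    have a: "\<alpha> \<in> borel_measurable ?L" using \<alpha> by (simp add: bounded_measurable_def)
    have "(\<Sum>(x, x')\<in>E\<^sub>X. hX (t, x, x') * (\<alpha> t $ x' - \<alpha> t $ x) * lam_bar lam x x' (\<mu> t) (m t) * \<mu> t $ x) =
        (\<Sum>e\<in>E\<^sub>X. hX (t, e) * gr (\<alpha> t) e * rate_X lam (\<mu> t) (m t) e)" for t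
      by (intro sum.cong refl) (simp add: split_beta gr_def rate_X_def mult.assoc)
    then have "(LINT t|?L. (\<Sum>(x, x')\<in>E\<^sub>X.
        hX (t, x, x') * (\<alpha> t $ x' - \<alpha> t $ x) * lam_bar lam x x' (\<mu> t) (m t) * \<mu> t $ x)) =
        (LINT t|?L. \<alpha> t \<bullet> v t - (\<Sum>e\<in>E\<^sub>X. rate_X lam (\<mu> t) (m t) e * gr (\<alpha> t) e))"
      using X.LINT_Euler_Lagrange[OF \<alpha> v_meas hX(2,3)] by simp
    also have "\<dots> = (LINT t|?L. \<alpha> t \<bullet> (vector_derivative \<mu> (at t) - Lambda_star E\<^sub>X lam (\<mu> t) (m t)))"
      unfolding inner_diff_right inner_Lambda_star
    proof (rule integral_cong_AE)
      have lin: "(\<lambda>t. \<Sum>e\<in>E\<^sub>X. rate_X lam (\<mu> t) (m t) e * gr (\<alpha> t) e) \<in> borel_measurable ?L"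
        by (rule borel_measurable_integrable[OF X.integrable_linear[OF \<alpha>]])
      show "(\<lambda>t. \<alpha> t \<bullet> v t - (\<Sum>e\<in>E\<^sub>X. rate_X lam (\<mu> t) (m t) e * gr (\<alpha> t) e)) \<in> borel_measurable ?L"
        "(\<lambda>t. \<alpha> t \<bullet> vector_derivative \<mu> (at t) - (\<Sum>e\<in>E\<^sub>X. rate_X lam (\<mu> t) (m t) e * gr (\<alpha> t) e)) \<in> borel_measurable ?L"
        by (intro borel_measurable_diff borel_measurable_inner a v_meas v'_meas lin)+
      show "AE t in ?L. \<alpha> t \<bullet> v t - (\<Sum>e\<in>E\<^sub>X. rate_X lam (\<mu> t) (m t) e * gr (\<alpha> t) e) =
          \<alpha> t \<bullet> vector_derivative \<mu> (at t) - (\<Sum>e\<in>E\<^sub>X. rate_X lam (\<mu> t) (m t) e * gr (\<alpha> t) e)"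
        using v_eq by eventually_elim simp
    qed
    finally show ?thesis .
  qed
  have dY: "(LINT t|?L. (\<Sum>(y, y')\<in>E\<^sub>Y. hY (t, y, y') * (g t $ y' - g t $ y) * gam y y' (\<mu> t) * m t $ y)) =
      - (LINT t|?L. (\<Sum>(y, y')\<in>E\<^sub>Y. (g t $ y' - g t $ y) * gam y y' (\<mu> t) * m t $ y))"
    if g: "bounded_measurable T g" for g
  proof -
    have 1: "(\<Sum>(y, y')\<in>E\<^sub>Y. hY (t, y, y') * (g t $ y' - g t $ y) * gam y y' (\<mu> t) * m t $ y) =
        (\<Sum>e\<in>E\<^sub>Y. hY (t, e) * gr (g t) e * rate_Y gam (\<mu> t) (m t) e)" for t
      by (intro sum.cong refl) (simp add: split_beta gr_def rate_Y_def mult.assoc)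
    have 2: "(\<Sum>(y, y')\<in>E\<^sub>Y. (g t $ y' - g t $ y) * gam y y' (\<mu> t) * m t $ y) =
        (\<Sum>e\<in>E\<^sub>Y. rate_Y gam (\<mu> t) (m t) e * gr (g t) e)" for t
      by (intro sum.cong refl) (simp add: split_beta gr_def rate_Y_def mult_ac)
    show ?thesis
      unfolding 1 2 using Y.LINT_Euler_Lagrange[OF g zero_meas hY(2,3)] by simp
  qed
  have cI: "?I = enn2ereal
      ((\<integral>\<^sup>+ t. (\<Sum>(x, x')\<in>E\<^sub>X. e2ennreal (tau_star (hX (t, x, x'))) *
          ennreal (lam_bar lam x x' (\<mu> t) (m t) * \<mu> t $ x)) \<partial>?L) +
       (\<integral>\<^sup>+ t. (\<Sum>(y, y')\<in>E\<^sub>Y. e2ennreal (tau_star (hY (t, y, y'))) *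
          ennreal (gam y y' (\<mu> t) * m t $ y)) \<partial>?L))"
    unfolding I hX(4) hY(4) by (simp add: rate_X_def rate_Y_def split_beta)
  have c4: "\<exists>(\<alpha>h :: real \<Rightarrow> real^'x) (gh :: real \<Rightarrow> real^'y). AE t in ?L.
       (SUP \<alpha>. ereal (objective_X E\<^sub>X lam (\<mu> t) (m t) (vector_derivative \<mu> (at t)) \<alpha>)) =
         ereal (objective_X E\<^sub>X lam (\<mu> t) (m t) (vector_derivative \<mu> (at t)) (\<alpha>h t)) \<and>
       (SUP g. ereal (objective_Y E\<^sub>Y gam (\<mu> t) (m t) g)) =
         ereal (objective_Y E\<^sub>Y gam (\<mu> t) (m t) (gh t)) \<and>
       (\<forall>x. vector_derivative \<mu> (at t) $ x - Lambda_star E\<^sub>X lam (\<mu> t) (m t) $ x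
          + \<mu> t $ x * (\<Sum>x' | (x, x') \<in> E\<^sub>X.
              (exp (\<alpha>h t $ x' - \<alpha>h t $ x) - 1) * lam_bar lam x x' (\<mu> t) (m t))
          - (\<Sum>x0 | (x0, x) \<in> E\<^sub>X.
              \<mu> t $ x0 * (exp (\<alpha>h t $ x - \<alpha>h t $ x0) - 1) * lam_bar lam x0 x (\<mu> t) (m t)) = 0) \<and>
       (\<forall>y. m t $ y * (\<Sum>y' | (y, y') \<in> E\<^sub>Y. exp (gh t $ y' - gh t $ y) * gam y y' (\<mu> t))
          - (\<Sum>y0 | (y0, y) \<in> E\<^sub>Y. m t $ y0 * exp (gh t $ y - gh t $ y0) * gam y0 y (\<mu> t)) = 0)"
    if \<mu>pos: "0 < (INF t\<in>{0..T}. ereal (MIN x. \<mu> t $ x))" and mpos: "0 < (INF t\<in>{0..T}. ereal (MIN y. m t $ y))"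
  proof -
    have \<mu>0: "0 < \<mu> t $ x" if "t \<in> {0..T}" for t x
    proof -
      have "0 < ereal (MIN x. \<mu> t $ x)" using \<mu>pos INF_lower[OF that] by (rule less_le_trans)
      moreover have "(MIN x. \<mu> t $ x) \<le> \<mu> t $ x" by (rule Min_le) auto
      ultimately show ?thesis by simp
    qed
    have m0: "0 < m t $ y" if "t \<in> {0..T}" for t y
    proof -
      have "0 < ereal (MIN y. m t $ y)" using mpos INF_lower[OF that] by (rule less_le_trans)
      moreover have "(MIN y. m t $ y) \<le> m t $ y" by (rule Min_le) auto
      ultimately show ?thesis by simp
    qed
    \<comment> \<open>Maximisers are found separately at each good time: finiteness of the integral
      makes the supremum finite for almost every t, and positivity of \<mu> makes every rate
      positive.\<close>
    have "AE t in ?L. \<exists>a. (SUP \<alpha>. ereal (objective_X E\<^sub>X lam (\<mu> t) (m t) (vector_derivative \<mu> (at t)) \<alpha>)) =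
        ereal (objective_X E\<^sub>X lam (\<mu> t) (m t) (vector_derivative \<mu> (at t)) a) \<and>
       (\<forall>x. vector_derivative \<mu> (at t) $ x - Lambda_star E\<^sub>X lam (\<mu> t) (m t) $ x
          + \<mu> t $ x * (\<Sum>x' | (x, x') \<in> E\<^sub>X. (exp (a $ x' - a $ x) - 1) * lam_bar lam x x' (\<mu> t) (m t))
          - (\<Sum>x0 | (x0, x) \<in> E\<^sub>X. \<mu> t $ x0 * (exp (a $ x - a $ x0) - 1) * lam_bar lam x0 x (\<mu> t) (m t)) = 0)"
      (is "AE t in ?L. \<exists>a. ?PX t a")
      using X.finite_SUP_AE[OF v_meas J_fin(1)] v_eq m_prob AE_space
    proof eventually_elim
      case (elim t)
      then have t: "t \<in> {0..T}" by (simp add: space_restrict_space)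
      let ?v = "vector_derivative \<mu> (at t)" and ?r = "rate_X lam (\<mu> t) (m t)"
      have pos: "0 < ?r e" if e: "e \<in> E\<^sub>X" for e
      proof -
        have "0 < lam (fst e) (snd e) (\<mu> t) y" for y using e by (intro lam_pos \<mu>_prob t) auto
        from lam_bar_bounds(1)[where lam = lam, OF elim(3) this] show ?thesis
          using \<mu>0[OF t] by (simp add: rate_X_def)
      qed
      obtain a where a: "(SUP a. ereal (obj E\<^sub>X ?r ?v a)) = ereal (obj E\<^sub>X ?r ?v a)"
        "\<And>\<beta>. \<beta> \<bullet> ?v = (\<Sum>e\<in>E\<^sub>X. ?r e * exp (gr a e) * gr \<beta> e)"
        using pointwise_maximizer[OF assms(1,3), of ?r ?v] pos elim(1) unfolding elim(2) by blast
      have "?v $ x - Lambda_star E\<^sub>X lam (\<mu> t) (m t) $ x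
          + \<mu> t $ x * (\<Sum>x' | (x, x') \<in> E\<^sub>X. (exp (a $ x' - a $ x) - 1) * lam_bar lam x x' (\<mu> t) (m t))
          - (\<Sum>x0 | (x0, x) \<in> E\<^sub>X. \<mu> t $ x0 * (exp (a $ x - a $ x0) - 1) * lam_bar lam x0 x (\<mu> t) (m t)) = 0" for x
      proof -
        \<comment> \<open>The balance equation at x is the Euler--Lagrange identity tested with
          \<open>axis x 1\<close>, after subtraction of the drift.\<close>
        have "?v $ x - Lambda_star E\<^sub>X lam (\<mu> t) (m t) $ x =
            axis x 1 \<bullet> ?v - axis x 1 \<bullet> Lambda_star E\<^sub>X lam (\<mu> t) (m t)"
          by (simp add: inner_axis')
        also have "\<dots> = (\<Sum>e\<in>E\<^sub>X. (?r e * (exp (gr a e) - 1)) * gr (axis x 1) e)"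
          unfolding a(2) inner_Lambda_star sum_subtractf[symmetric]
          by (intro sum.cong refl) (simp add: algebra_simps)
        also have "\<dots> = (\<Sum>x0 | (x0, x) \<in> E\<^sub>X. \<mu> t $ x0 * (exp (a $ x - a $ x0) - 1) * lam_bar lam x0 x (\<mu> t) (m t)) -
            \<mu> t $ x * (\<Sum>x' | (x, x') \<in> E\<^sub>X. (exp (a $ x' - a $ x) - 1) * lam_bar lam x x' (\<mu> t) (m t))"
          unfolding sum_gr_axis sum_distrib_left by (simp add: rate_X_def gr_def mult_ac)
        finally show ?thesis by simp
      qed
      with a(1) show ?case unfolding objective_X_eq by blast
    qed
    from AE_choice[OF this] obtain \<alpha>h where eX: "AE t in ?L. ?PX t (\<alpha>h t)" ..
    have "AE t in ?L. \<exists>g'. (SUP g. ereal (objective_Y E\<^sub>Y gam (\<mu> t) (m t) g)) =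
        ereal (objective_Y E\<^sub>Y gam (\<mu> t) (m t) g') \<and>
       (\<forall>y. m t $ y * (\<Sum>y' | (y, y') \<in> E\<^sub>Y. exp (g' $ y' - g' $ y) * gam y y' (\<mu> t))
          - (\<Sum>y0 | (y0, y) \<in> E\<^sub>Y. m t $ y0 * exp (g' $ y - g' $ y0) * gam y0 y (\<mu> t)) = 0)"
      (is "AE t in ?L. \<exists>g'. ?PY t g'")
      using Y.finite_SUP_AE[OF zero_meas J_fin(2)] AE_space
    proof eventually_elim
      case (elim t)
      then have t: "t \<in> {0..T}" by (simp add: space_restrict_space)
      let ?r = "rate_Y gam (\<mu> t) (m t)"
      have pos: "0 < ?r e" if e: "e \<in> E\<^sub>Y" for e
      proof -
        have "0 < gam (fst e) (snd e) (\<mu> t)" using e by (intro gam_pos \<mu>_prob t) auto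
        then show ?thesis using m0[OF t] by (simp add: rate_Y_def)
      qed
      obtain a where a: "(SUP a. ereal (obj E\<^sub>Y ?r 0 a)) = ereal (obj E\<^sub>Y ?r 0 a)"
        "\<And>\<beta>. \<beta> \<bullet> 0 = (\<Sum>e\<in>E\<^sub>Y. ?r e * exp (gr a e) * gr \<beta> e)"
        using pointwise_maximizer[OF assms(2,4), of ?r 0] pos elim(1) by blast
      have "m t $ y * (\<Sum>y' | (y, y') \<in> E\<^sub>Y. exp (a $ y' - a $ y) * gam y y' (\<mu> t))
          - (\<Sum>y0 | (y0, y) \<in> E\<^sub>Y. m t $ y0 * exp (a $ y - a $ y0) * gam y0 y (\<mu> t)) = 0" for y
      proof -
        have "0 = (\<Sum>e\<in>E\<^sub>Y. (?r e * exp (gr a e)) * gr (axis y 1) e)" using a(2)[of "axis y 1"] by simp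
        also have "\<dots> = (\<Sum>y0 | (y0, y) \<in> E\<^sub>Y. m t $ y0 * exp (a $ y - a $ y0) * gam y0 y (\<mu> t)) -
            m t $ y * (\<Sum>y' | (y, y') \<in> E\<^sub>Y. exp (a $ y' - a $ y) * gam y y' (\<mu> t))"
          unfolding sum_gr_axis sum_distrib_left by (simp add: rate_Y_def gr_def mult_ac)
        finally show ?thesis by simp
      qed
      with a(1) show ?case unfolding objective_Y_eq by blast
    qed
    from AE_choice[OF this] obtain gh where eY: "AE t in ?L. ?PY t (gh t)" ..
    show ?thesis
      by (rule exI[of _ \<alpha>h], rule exI[of _ gh]) (use eX eY in \<open>eventually_elim, simp only: simp_thms\<close>)
  qed
  show ?thesis
    unfolding rhoX rhoY
    by (intro conjI c1 c2 c3 impI c4 exI[of _ hX] exI[of _ hY] hX(1) hY(1) orlicz allI dX dY cI)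
qed

end
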